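(* Let $\mathcal{A}$ be an abelian category with small $\operatorname{Ext}$ groups. Then there exists a one-to-one correspondence between any two of the following three collections. (1) Balanced pairs $(\mathcal{C},\mathcal{D})$ in $\mathcal{A}$. (2) Subfunctors $\mathcal{F}\subseteq \operatorname{Ext}^{1}_{\mathcal{A}}(-,-)$ such that $\mathcal{A}$ has enough $\mathcal{F}$-projective objects and enough $\mathcal{F}$-injective objects. (3) Quillen exact structures $\mathcal{E}$ on $\mathcal{A}$ with enough $\mathcal{E}$-projectives and enough $\mathcal{E}$-injectives (that is, such that the resulting exact category $(\mathcal{A},\mathcal{E})$ has enough projective and enough injective objects).
   Context: Small Ext groups: $\operatorname{Ext}^1_{\mathcal{A}}(X,Y)$ (equivalence classes of short exact sequences $0\to Y\to Z\to X\to 0$) is a set for all $X,Y\in\mathcal{A}$. A subcategory of $\mathcal{A}$ means a full and additive subcategory closed under isomorphisms and direct summands. Balanced pairs. Let $\mathcal{C}$ be a subcategory of $\mathcal{A}$. A morphism $f:C\to M$ with $C\in\mathcal{C}$ is a $\mathcal{C}$-precover of $M$ if every morphism $C'\to M$ with $C'\in\mathcal{C}$ factors through $f$. $\mathcal{C}$ is epimorphic precovering if every object of $\mathcal{A}$ has a $\mathcal{C}$-precover that is an epimorphism. Dually, a $\mathcal{D}$-preenvelope of $M$ is a morphism $M\to D$ with $D\in\mathcal{D}$ through which every morphism $M\to D'$ with $D'\in\mathcal{D}$ factors; $\mathcal{D}$ is monomorphic preenveloping if every object has a monomorphic $\mathcal{D}$-preenvelope. A sequence is $\operatorname{Hom}_{\mathcal{A}}(\mathcal{C},-)$-exact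 (resp. $\operatorname{Hom}_{\mathcal{A}}(-,\mathcal{D})$-exact) if it is exact after applying $\operatorname{Hom}_{\mathcal{A}}(C,-)$ for every $C\in\mathcal{C}$ (resp. $\operatorname{Hom}_{\mathcal{A}}(-,D)$ for every $D\in\mathcal{D}$). A $\mathcal{C}$-resolution of $M$ is a $\operatorname{Hom}_{\mathcal{A}}(\mathcal{C},-)$-exact exact sequence $\cdots\to C_1\to C_0\to M\to 0$ with all $C_i\in\mathcal{C}$; a $\mathcal{D}$-coresolution of $N$ is a $\operatorname{Hom}_{\mathcal{A}}(-,\mathcal{D})$-exact exact sequence $0\to N\to D^0\to D^1\to\cdots$ with all $D^i\in\mathcal{D}$. A pair $(\mathcal{C},\mathcal{D})$ of subcategories is a balanced pair if: (a) $\mathcal{C}$ is epimorphic precovering and $\mathcal{D}$ is monomorphic preenveloping; (b) every $M\in\mathcal{A}$ has a $\mathcal{C}$-resolution that is $\operatorname{Hom}_{\mathcal{A}}(-,\mathcal{D})$-exact; (c) every $N\in\mathcal{A}$ has a $\mathcal{D}$-coresolution that is $\operatorname{Hom}_{\mathcal{A}}(\mathcal{C},-)$-exact. Subfunctors. $\operatorname{Ext}^1_{\mathcal{A}}(-,-)$ is regarded as a functor $\mathcal{A}^{op}\times\mathcal{A}\to \mathrm{Ab}$ to abelian groups, and $\mathcal{F}$ is a subfunctor of it. An object $C$ (resp. $D$) is $\mathcal{F}$-projective (resp. $\mathcal{F}$-injective) if $\mathcal{F}(C,-)=0$ (resp. $\mathcal{F}(-,D)=0$). A short exact sequence $0\to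 A'\to A\to A''\to 0$ is an $\mathcal{F}$-sequence if its class lies in $\mathcal{F}(A'',A')$. $\mathcal{A}$ has enough $\mathcal{F}$-projective objects if for every $A\in\mathcal{A}$ there is an $\mathcal{F}$-sequence $0\to X\to C\to A\to 0$ with $C$ $\mathcal{F}$-projective, and enough $\mathcal{F}$-injective objects if for every $A$ there is an $\mathcal{F}$-sequence $0\to A\to D\to Y\to 0$ with $D$ $\mathcal{F}$-injective. Exact structures. A kernel-cokernel pair $(i,p)$ is a composable pair $L\xrightarrow{i}M\xrightarrow{p}N$ with $i$ a kernel of $p$ and $p$ a cokernel of $i$. For a class $\mathcal{E}$ of such pairs, $i$ is an admissible monic (resp. $p$ an admissible epic) if it occurs as the first (resp. second) morphism of a pair in $\mathcal{E}$. $\mathcal{E}$ is a (Quillen) exact structure if it is closed under isomorphisms and: identities are both admissible monics and admissible epics; admissible monics are closed under composition; admissible epics are closed under composition; the push-out of an admissible monic along any morphism exists and is an admissible monic; the pull-back of an admissible epic along any morphism exists and is an admissible epic. An object $P$ is $\mathcal{E}$-projective if every morphism $P\to N$ lifts along every admissible epic $M\to N$; $I$ is $\mathcal{E}$-injective if every morphism $L\to I$ extends along every admissible monic $L\to M$. There are enough $\mathcal{E}$-projectives if every object $M$ admits an admissible epic $P\to M$ with $P$ $\mathcal{E}$-projective, and enough $\mathcal{E}$-injectives if every $M$ admits an admissible monic $M\to I$ with $I$ $\mathcal{E}$-injective. *)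

theory Defs
  imports "HOL-Algebra.Group"
begin

text \<open>
  A category has a set of objects and a set of morphisms, each morphism carrying its domain and
  codomain; \<open>g \<cdot> f\<close> is ``\<open>f\<close> first, then \<open>g\<close>''. The addition and the zero morphisms are those of
  the abelian groups \<open>Hom(X, Y)\<close>.
\<close>

record ('o, 'm) category =
  Ob :: "'o set"
  Mor :: "'m set"
  Dom :: "'m \<Rightarrow> 'o"
  Cod :: "'m \<Rightarrow> 'o"
  Ide :: "'o \<Rightarrow> 'm"
  Comp :: "'m \<Rightarrow> 'm \<Rightarrow> 'm"  (infixl \<open>\<cdot>\<index>\<close> 75)
  Add :: "'m \<Rightarrow> 'm \<Rightarrow> 'm"  (infixl \<open>\<boxplus>\<index>\<close> 65)
  Zero :: "'o \<Rightarrow> 'o \<Rightarrow> 'm"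

locale cat =
  fixes A :: "('o, 'm) category" (structure)
begin

definition Hom :: "'o \<Rightarrow> 'o \<Rightarrow> 'm set" where
  "Hom X Y = {f \<in> Mor A. Dom A f = X \<and> Cod A f = Y}"

definition Hom_group :: "'o \<Rightarrow> 'o \<Rightarrow> 'm monoid" where
  "Hom_group X Y = \<lparr>carrier = Hom X Y, monoid.mult = Add A, one = Zero A X Y\<rparr>"


subsection \<open>Basic notions\<close>

definition is_mono :: "'m \<Rightarrow> bool" where
  "is_mono f \<longleftrightarrow> f \<in> Mor A \<and>
    (\<forall>X. \<forall>g\<in>Hom X (Dom A f). \<forall>h\<in>Hom X (Dom A f). f \<cdot> g = f \<cdot> h \<longrightarrow> g = h)"

definition is_epi :: "'m \<Rightarrow> bool" where
  "is_epi f \<longleftrightarrow> f \<in> Mor A \<and>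
    (\<forall>Y. \<forall>g\<in>Hom (Cod A f) Y. \<forall>h\<in>Hom (Cod A f) Y. g \<cdot> f = h \<cdot> f \<longrightarrow> g = h)"

definition is_iso :: "'m \<Rightarrow> bool" where
  "is_iso f \<longleftrightarrow> f \<in> Mor A \<and>
    (\<exists>g\<in>Hom (Cod A f) (Dom A f). g \<cdot> f = Ide A (Dom A f) \<and> f \<cdot> g = Ide A (Cod A f))"

definition is_zero_object :: "'o \<Rightarrow> bool" where
  "is_zero_object Z \<longleftrightarrow> Z \<in> Ob A \<and>
    (\<forall>X\<in>Ob A. (\<exists>!f. f \<in> Hom X Z) \<and> (\<exists>!f. f \<in> Hom Z X))"

definition is_kernel :: "'m \<Rightarrow> 'm \<Rightarrow> bool"  \<comment> \<open>\<open>k\<close> is a kernel of \<open>f\<close>\<close> where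
  "is_kernel f k \<longleftrightarrow> f \<in> Mor A \<and> k \<in> Mor A \<and> Cod A k = Dom A f \<and>
    f \<cdot> k = Zero A (Dom A k) (Cod A f) \<and>
    (\<forall>X. \<forall>h\<in>Hom X (Dom A f). f \<cdot> h = Zero A X (Cod A f) \<longrightarrow>
      (\<exists>!u. u \<in> Hom X (Dom A k) \<and> k \<cdot> u = h))"

definition is_cokernel :: "'m \<Rightarrow> 'm \<Rightarrow> bool"  \<comment> \<open>\<open>c\<close> is a cokernel of \<open>f\<close>\<close> where
  "is_cokernel f c \<longleftrightarrow> f \<in> Mor A \<and> c \<in> Mor A \<and> Dom A c = Cod A f \<and>
    c \<cdot> f = Zero A (Dom A f) (Cod A c) \<and>
    (\<forall>Y. \<forall>h\<in>Hom (Cod A f) Y. h \<cdot> f = Zero A (Dom A f) Y \<longrightarrow>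
      (\<exists>!u. u \<in> Hom (Cod A c) Y \<and> u \<cdot> c = h))"

text \<open>The biproduct object is the common codomain of \<open>i1\<close>, \<open>i2\<close> and domain of \<open>p1\<close>, \<open>p2\<close>.\<close>

definition is_biproduct :: "'o \<Rightarrow> 'o \<Rightarrow> 'o \<Rightarrow> 'm \<Rightarrow> 'm \<Rightarrow> 'm \<Rightarrow> 'm \<Rightarrow> bool" where
  "is_biproduct X Y P i1 i2 p1 p2 \<longleftrightarrow> X \<in> Ob A \<and> Y \<in> Ob A \<and> P \<in> Ob A \<and>
    i1 \<in> Hom X P \<and> i2 \<in> Hom Y P \<and> p1 \<in> Hom P X \<and> p2 \<in> Hom P Y \<and>
    p1 \<cdot> i1 = Ide A X \<and> p2 \<cdot> i2 = Ide A Y \<and>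
    p2 \<cdot> i1 = Zero A X Y \<and> p1 \<cdot> i2 = Zero A Y X \<and>
    (i1 \<cdot> p1) \<boxplus> (i2 \<cdot> p2) = Ide A P"

text \<open>The square \<open>p \<cdot> u = f \<cdot> q\<close> is a pull-back of the cospan \<open>(p, f)\<close>.\<close>

definition is_pullback :: "'m \<Rightarrow> 'm \<Rightarrow> 'm \<Rightarrow> 'm \<Rightarrow> bool" where
  "is_pullback p f u q \<longleftrightarrow> p \<in> Mor A \<and> f \<in> Mor A \<and> u \<in> Mor A \<and> q \<in> Mor A \<and>
    Cod A p = Cod A f \<and> Dom A u = Dom A q \<and> Cod A u = Dom A p \<and> Cod A q = Dom A f \<and>
    p \<cdot> u = f \<cdot> q \<and>
    (\<forall>X. \<forall>a\<in>Hom X (Dom A p). \<forall>b\<in>Hom X (Dom A f). p \<cdot> a = f \<cdot> b \<longrightarrow>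
      (\<exists>!w. w \<in> Hom X (Dom A u) \<and> u \<cdot> w = a \<and> q \<cdot> w = b))"

text \<open>The square \<open>u \<cdot> i = j \<cdot> f\<close> is a push-out of the span \<open>(i, f)\<close>.\<close>

definition is_pushout :: "'m \<Rightarrow> 'm \<Rightarrow> 'm \<Rightarrow> 'm \<Rightarrow> bool" where
  "is_pushout i f u j \<longleftrightarrow> i \<in> Mor A \<and> f \<in> Mor A \<and> u \<in> Mor A \<and> j \<in> Mor A \<and>
    Dom A i = Dom A f \<and> Cod A u = Cod A j \<and> Dom A u = Cod A i \<and> Dom A j = Cod A f \<and>
    u \<cdot> i = j \<cdot> f \<and>
    (\<forall>Y. \<forall>a\<in>Hom (Cod A i) Y. \<forall>b\<in>Hom (Cod A f) Y. a \<cdot> i = b \<cdot> f \<longrightarrow>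
      (\<exists>!w. w \<in> Hom (Cod A u) Y \<and> w \<cdot> u = a \<and> w \<cdot> j = b))"

text \<open>Exactness of \<open>L \<rightarrow> M \<rightarrow> N\<close> at \<open>M\<close>: the image of \<open>f\<close>, i.e. the kernel of its cokernel, is the
  kernel of \<open>g\<close>.\<close>

definition exact_at :: "'m \<Rightarrow> 'm \<Rightarrow> bool" where
  "exact_at f g \<longleftrightarrow> f \<in> Mor A \<and> g \<in> Mor A \<and> Cod A f = Dom A g \<and>
    (\<exists>c k. is_cokernel f c \<and> is_kernel c k \<and> is_kernel g k)"

text \<open>Exactness at \<open>Hom(X, M)\<close>, resp. \<open>Hom(M, Y)\<close>, of the sequence of abelian groups obtained from
  \<open>L \<rightarrow> M \<rightarrow> N\<close>.\<close>

definition Hom_exact_at :: "'o \<Rightarrow> 'm \<Rightarrow> 'm \<Rightarrow> bool" where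
  "Hom_exact_at X f g \<longleftrightarrow>
    (\<lambda>h. f \<cdot> h) ` Hom X (Dom A f) = {h \<in> Hom X (Dom A g). g \<cdot> h = Zero A X (Cod A g)}"

definition coHom_exact_at :: "'o \<Rightarrow> 'm \<Rightarrow> 'm \<Rightarrow> bool" where
  "coHom_exact_at Y f g \<longleftrightarrow>
    (\<lambda>h. h \<cdot> g) ` Hom (Cod A g) Y = {h \<in> Hom (Cod A f) Y. h \<cdot> f = Zero A (Dom A f) Y}"


subsection \<open>Extensions\<close>

definition short_exact :: "'m \<Rightarrow> 'm \<Rightarrow> bool" where
  "short_exact i p \<longleftrightarrow> (\<exists>Z. is_zero_object Z \<and>
    exact_at (Zero A Z (Dom A i)) i \<and> exact_at i p \<and> exact_at p (Zero A (Cod A p) Z))"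

text \<open>Extensions \<open>0 \<rightarrow> Y \<rightarrow> Z \<rightarrow> X \<rightarrow> 0\<close> of \<open>X\<close> by \<open>Y\<close>, encoded as pairs of morphisms. Note the order of
  \<open>X\<close> and \<open>Y\<close>.\<close>

definition extensions :: "'o \<Rightarrow> 'o \<Rightarrow> ('m \<times> 'm) set" where
  "extensions X Y = {(i, p). short_exact i p \<and> Dom A i = Y \<and> Cod A p = X}"

definition ext_rel :: "'o \<Rightarrow> 'o \<Rightarrow> (('m \<times> 'm) \<times> ('m \<times> 'm)) set" where
  "ext_rel X Y = {((i, p), (j, q)). (i, p) \<in> extensions X Y \<and> (j, q) \<in> extensions X Y \<and>
    (\<exists>u\<in>Hom (Cod A i) (Cod A j). is_iso u \<and> u \<cdot> i = j \<and> q \<cdot> u = p)}"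

text \<open>Smallness of the Ext groups needs no hypothesis: \<open>Ext1 X Y\<close> is a set by construction.\<close>

definition Ext1 :: "'o \<Rightarrow> 'o \<Rightarrow> ('m \<times> 'm) set set" where
  "Ext1 X Y = extensions X Y // ext_rel X Y"

definition ext_class :: "'m \<Rightarrow> 'm \<Rightarrow> ('m \<times> 'm) set" where
  "ext_class i p = ext_rel (Cod A p) (Dom A i) `` {(i, p)}"

text \<open>The action of \<open>f : X' \<rightarrow> X\<close> on \<open>Ext1 X Y\<close>: pull an extension \<open>Y \<rightarrow> Z \<rightarrow> X\<close> back along \<open>f\<close>; the
  monomorphism of the new extension is the one lifting both \<open>Y \<rightarrow> Z\<close> and \<open>0 : Y \<rightarrow> X'\<close>. Dually for
  \<open>g : Y \<rightarrow> Y'\<close>.\<close>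

definition ext_pull :: "'m \<Rightarrow> ('m \<times> 'm) set \<Rightarrow> ('m \<times> 'm) set" where
  "ext_pull f \<xi> = {(j, q). short_exact j q \<and>
    (\<exists>(i, p)\<in>\<xi>. \<exists>u. is_pullback p f u q \<and> Dom A j = Dom A i \<and> u \<cdot> j = i)}"

definition ext_push :: "'m \<Rightarrow> ('m \<times> 'm) set \<Rightarrow> ('m \<times> 'm) set" where
  "ext_push g \<xi> = {(j, q). short_exact j q \<and>
    (\<exists>(i, p)\<in>\<xi>. \<exists>u. is_pushout i g u j \<and> Cod A q = Cod A p \<and> q \<cdot> u = p)}"

definition Ext1_map :: "'m \<Rightarrow> 'm \<Rightarrow> ('m \<times> 'm) set \<Rightarrow> ('m \<times> 'm) set" where
  "Ext1_map f g \<xi> = ext_push g (ext_pull f \<xi>)"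

definition biprod :: "'o \<Rightarrow> 'o \<Rightarrow> 'm \<times> 'm \<times> 'm \<times> 'm" where
  "biprod X Y = (SOME (i1, i2, p1, p2). \<exists>P. is_biproduct X Y P i1 i2 p1 p2)"

definition inl :: "'o \<Rightarrow> 'o \<Rightarrow> 'm" where "inl X Y = fst (biprod X Y)"
definition inr :: "'o \<Rightarrow> 'o \<Rightarrow> 'm" where "inr X Y = fst (snd (biprod X Y))"
definition prl :: "'o \<Rightarrow> 'o \<Rightarrow> 'm" where "prl X Y = fst (snd (snd (biprod X Y)))"
definition prr :: "'o \<Rightarrow> 'o \<Rightarrow> 'm" where "prr X Y = snd (snd (snd (biprod X Y)))"

definition dsum :: "'m \<Rightarrow> 'm \<Rightarrow> 'm" where
  "dsum f g =
    (inl (Cod A f) (Cod A g) \<cdot> f \<cdot> prl (Dom A f) (Dom A g)) \<boxplus>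
    (inr (Cod A f) (Cod A g) \<cdot> g \<cdot> prr (Dom A f) (Dom A g))"

definition diagonal :: "'o \<Rightarrow> 'm" where "diagonal X = inl X X \<boxplus> inr X X"

definition codiagonal :: "'o \<Rightarrow> 'm" where "codiagonal X = prl X X \<boxplus> prr X X"

definition ext_dsum :: "('m \<times> 'm) set \<Rightarrow> ('m \<times> 'm) set \<Rightarrow> ('m \<times> 'm) set" where
  "ext_dsum \<xi> \<eta> = (\<Union>(i, p)\<in>\<xi>. \<Union>(j, q)\<in>\<eta>. ext_class (dsum i j) (dsum p q))"

definition baer_sum :: "'o \<Rightarrow> 'o \<Rightarrow> ('m \<times> 'm) set \<Rightarrow> ('m \<times> 'm) set \<Rightarrow> ('m \<times> 'm) set" where
  "baer_sum X Y \<xi> \<eta> = Ext1_map (diagonal X) (codiagonal Y) (ext_dsum \<xi> \<eta>)"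

definition Ext1_group :: "'o \<Rightarrow> 'o \<Rightarrow> ('m \<times> 'm) set monoid" where
  "Ext1_group X Y =
    \<lparr>carrier = Ext1 X Y, monoid.mult = baer_sum X Y, one = ext_class (inl Y X) (prr Y X)\<rparr>"


subsection \<open>Balanced pairs\<close>

text \<open>A full subcategory is given by its set of objects.\<close>

definition subcategory :: "'o set \<Rightarrow> bool" where
  "subcategory S \<longleftrightarrow> S \<subseteq> Ob A \<and>
    (\<exists>Z\<in>S. is_zero_object Z) \<and>
    (\<forall>X Y P i1 i2 p1 p2. X \<in> S \<and> Y \<in> S \<and> is_biproduct X Y P i1 i2 p1 p2 \<longrightarrow> P \<in> S) \<and>
    (\<forall>f. is_iso f \<and> Dom A f \<in> S \<longrightarrow> Cod A f \<in> S) \<and>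
    (\<forall>X Y P i1 i2 p1 p2. P \<in> S \<and> is_biproduct X Y P i1 i2 p1 p2 \<longrightarrow> X \<in> S \<and> Y \<in> S)"

definition precover :: "'o set \<Rightarrow> 'o \<Rightarrow> 'm \<Rightarrow> bool" where
  "precover S M f \<longleftrightarrow> f \<in> Mor A \<and> Dom A f \<in> S \<and> Cod A f = M \<and>
    (\<forall>C\<in>S. \<forall>g\<in>Hom C M. \<exists>h\<in>Hom C (Dom A f). f \<cdot> h = g)"

definition preenvelope :: "'o set \<Rightarrow> 'o \<Rightarrow> 'm \<Rightarrow> bool" where
  "preenvelope S M f \<longleftrightarrow> f \<in> Mor A \<and> Cod A f \<in> S \<and> Dom A f = M \<and>
    (\<forall>D\<in>S. \<forall>g\<in>Hom M D. \<exists>h\<in>Hom (Cod A f) D. h \<cdot> f = g)"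

definition epimorphic_precovering :: "'o set \<Rightarrow> bool" where
  "epimorphic_precovering S \<longleftrightarrow> (\<forall>M\<in>Ob A. \<exists>f. precover S M f \<and> is_epi f)"

definition monomorphic_preenveloping :: "'o set \<Rightarrow> bool" where
  "monomorphic_preenveloping S \<longleftrightarrow> (\<forall>M\<in>Ob A. \<exists>f. preenvelope S M f \<and> is_mono f)"

text \<open>A resolution \<open>\<dots> \<rightarrow> C\<^sub>1 \<rightarrow> C\<^sub>0 \<rightarrow> M \<rightarrow> 0\<close> is the sequence \<open>d\<close> of its morphisms read from the right:
  \<open>d 0 : M \<rightarrow> 0\<close>, \<open>d 1 : C\<^sub>0 \<rightarrow> M\<close>, \<open>d 2 : C\<^sub>1 \<rightarrow> C\<^sub>0\<close> and so on. Likewise a coresolution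
  \<open>0 \<rightarrow> N \<rightarrow> D\<^sup>0 \<rightarrow> D\<^sup>1 \<rightarrow> \<dots>\<close> starts with \<open>d 0 : 0 \<rightarrow> N\<close>.\<close>

definition resolution :: "'o set \<Rightarrow> 'o \<Rightarrow> (nat \<Rightarrow> 'm) \<Rightarrow> bool" where
  "resolution S M d \<longleftrightarrow> is_zero_object (Cod A (d 0)) \<and> Dom A (d 0) = M \<and>
    (\<forall>n. Dom A (d (Suc n)) \<in> S) \<and>
    (\<forall>n. exact_at (d (Suc n)) (d n)) \<and>
    (\<forall>X\<in>S. \<forall>n. Hom_exact_at X (d (Suc n)) (d n))"

definition coresolution :: "'o set \<Rightarrow> 'o \<Rightarrow> (nat \<Rightarrow> 'm) \<Rightarrow> bool" where
  "coresolution S N d \<longleftrightarrow> is_zero_object (Dom A (d 0)) \<and> Cod A (d 0) = N \<and>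
    (\<forall>n. Cod A (d (Suc n)) \<in> S) \<and>
    (\<forall>n. exact_at (d n) (d (Suc n))) \<and>
    (\<forall>Y\<in>S. \<forall>n. coHom_exact_at Y (d n) (d (Suc n)))"

definition balanced_pairs :: "('o set \<times> 'o set) set" where
  "balanced_pairs = {(C, D). subcategory C \<and> subcategory D \<and>
    epimorphic_precovering C \<and> monomorphic_preenveloping D \<and>
    (\<forall>M\<in>Ob A. \<exists>d. resolution C M d \<and> (\<forall>Y\<in>D. \<forall>n. coHom_exact_at Y (d (Suc n)) (d n))) \<and>
    (\<forall>N\<in>Ob A. \<exists>d. coresolution D N d \<and> (\<forall>X\<in>C. \<forall>n. Hom_exact_at X (d n) (d (Suc n))))}"


subsection \<open>Subfunctors of Ext\<close>

text \<open>A subfunctor of the functor \<open>Ext1\<close> to abelian groups is determined by the subgroups \<open>F X Y\<close>. As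
  \<open>Ext1 X Y\<close> is empty unless \<open>X\<close> and \<open>Y\<close> are objects, the first clause also fixes \<open>F\<close> to be
  empty off the objects, so that equal subfunctors are equal as functions.\<close>

definition Ext1_subfunctor :: "('o \<Rightarrow> 'o \<Rightarrow> ('m \<times> 'm) set set) \<Rightarrow> bool" where
  "Ext1_subfunctor F \<longleftrightarrow>
    (\<forall>X Y. F X Y \<subseteq> Ext1 X Y) \<and>
    (\<forall>X\<in>Ob A. \<forall>Y\<in>Ob A. subgroup (F X Y) (Ext1_group X Y)) \<and>
    (\<forall>f\<in>Mor A. \<forall>g\<in>Mor A. Ext1_map f g ` F (Cod A f) (Dom A g) \<subseteq> F (Dom A f) (Cod A g))"

definition F_projective :: "('o \<Rightarrow> 'o \<Rightarrow> ('m \<times> 'm) set set) \<Rightarrow> 'o \<Rightarrow> bool" where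
  "F_projective F C \<longleftrightarrow> C \<in> Ob A \<and> (\<forall>Y\<in>Ob A. F C Y = {\<one>\<^bsub>Ext1_group C Y\<^esub>})"

definition F_injective :: "('o \<Rightarrow> 'o \<Rightarrow> ('m \<times> 'm) set set) \<Rightarrow> 'o \<Rightarrow> bool" where
  "F_injective F D \<longleftrightarrow> D \<in> Ob A \<and> (\<forall>X\<in>Ob A. F X D = {\<one>\<^bsub>Ext1_group X D\<^esub>})"

definition F_sequence :: "('o \<Rightarrow> 'o \<Rightarrow> ('m \<times> 'm) set set) \<Rightarrow> 'm \<Rightarrow> 'm \<Rightarrow> bool" where
  "F_sequence F i p \<longleftrightarrow> short_exact i p \<and> ext_class i p \<in> F (Cod A p) (Dom A i)"

definition enough_F_projectives :: "('o \<Rightarrow> 'o \<Rightarrow> ('m \<times> 'm) set set) \<Rightarrow> bool" where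
  "enough_F_projectives F \<longleftrightarrow>
    (\<forall>M\<in>Ob A. \<exists>i p. F_sequence F i p \<and> Cod A p = M \<and> F_projective F (Dom A p))"

definition enough_F_injectives :: "('o \<Rightarrow> 'o \<Rightarrow> ('m \<times> 'm) set set) \<Rightarrow> bool" where
  "enough_F_injectives F \<longleftrightarrow>
    (\<forall>M\<in>Ob A. \<exists>i p. F_sequence F i p \<and> Dom A i = M \<and> F_injective F (Cod A i))"

definition Ext1_subfunctors_enough :: "('o \<Rightarrow> 'o \<Rightarrow> ('m \<times> 'm) set set) set" where
  "Ext1_subfunctors_enough =
    {F. Ext1_subfunctor F \<and> enough_F_projectives F \<and> enough_F_injectives F}"


subsection \<open>Exact structures\<close>

definition kernel_cokernel_pair :: "'m \<Rightarrow> 'm \<Rightarrow> bool" where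
  "kernel_cokernel_pair i p \<longleftrightarrow> is_kernel p i \<and> is_cokernel i p"

definition pair_isomorphic :: "'m \<times> 'm \<Rightarrow> 'm \<times> 'm \<Rightarrow> bool" where
  "pair_isomorphic = (\<lambda>(i, p) (j, q). \<exists>a b c. is_iso a \<and> is_iso b \<and> is_iso c \<and>
    a \<in> Hom (Dom A i) (Dom A j) \<and> b \<in> Hom (Cod A i) (Cod A j) \<and> c \<in> Hom (Cod A p) (Cod A q) \<and>
    b \<cdot> i = j \<cdot> a \<and> c \<cdot> p = q \<cdot> b)"

definition admissible_monic :: "('m \<times> 'm) set \<Rightarrow> 'm \<Rightarrow> bool" where
  "admissible_monic E i \<longleftrightarrow> (\<exists>p. (i, p) \<in> E)"

definition admissible_epic :: "('m \<times> 'm) set \<Rightarrow> 'm \<Rightarrow> bool" where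
  "admissible_epic E p \<longleftrightarrow> (\<exists>i. (i, p) \<in> E)"

definition exact_structure :: "('m \<times> 'm) set \<Rightarrow> bool" where
  "exact_structure E \<longleftrightarrow>
    (\<forall>(i, p)\<in>E. kernel_cokernel_pair i p) \<and>
    (\<forall>(i, p)\<in>E. \<forall>j q. kernel_cokernel_pair j q \<and> pair_isomorphic (i, p) (j, q) \<longrightarrow> (j, q) \<in> E) \<and>
    (\<forall>X\<in>Ob A. admissible_monic E (Ide A X) \<and> admissible_epic E (Ide A X)) \<and>
    (\<forall>i j. admissible_monic E i \<and> admissible_monic E j \<and> Cod A i = Dom A j \<longrightarrow>
      admissible_monic E (j \<cdot> i)) \<and>
    (\<forall>p q. admissible_epic E p \<and> admissible_epic E q \<and> Cod A p = Dom A q \<longrightarrow>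
      admissible_epic E (q \<cdot> p)) \<and>
    (\<forall>i. \<forall>f\<in>Mor A. admissible_monic E i \<and> Dom A f = Dom A i \<longrightarrow>
      (\<exists>u j. is_pushout i f u j \<and> admissible_monic E j)) \<and>
    (\<forall>p. \<forall>f\<in>Mor A. admissible_epic E p \<and> Cod A f = Cod A p \<longrightarrow>
      (\<exists>u q. is_pullback p f u q \<and> admissible_epic E q))"

definition E_projective :: "('m \<times> 'm) set \<Rightarrow> 'o \<Rightarrow> bool" where
  "E_projective E P \<longleftrightarrow> P \<in> Ob A \<and>
    (\<forall>p. admissible_epic E p \<longrightarrow> (\<forall>f\<in>Hom P (Cod A p). \<exists>g\<in>Hom P (Dom A p). p \<cdot> g = f))"

definition E_injective :: "('m \<times> 'm) set \<Rightarrow> 'o \<Rightarrow> bool" where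
  "E_injective E I \<longleftrightarrow> I \<in> Ob A \<and>
    (\<forall>i. admissible_monic E i \<longrightarrow> (\<forall>f\<in>Hom (Dom A i) I. \<exists>g\<in>Hom (Cod A i) I. g \<cdot> i = f))"

definition enough_E_projectives :: "('m \<times> 'm) set \<Rightarrow> bool" where
  "enough_E_projectives E \<longleftrightarrow>
    (\<forall>M\<in>Ob A. \<exists>p. admissible_epic E p \<and> Cod A p = M \<and> E_projective E (Dom A p))"

definition enough_E_injectives :: "('m \<times> 'm) set \<Rightarrow> bool" where
  "enough_E_injectives E \<longleftrightarrow>
    (\<forall>M\<in>Ob A. \<exists>i. admissible_monic E i \<and> Dom A i = M \<and> E_injective E (Cod A i))"

definition exact_structures_enough :: "('m \<times> 'm) set set" where
  "exact_structures_enough =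
    {E. exact_structure E \<and> enough_E_projectives E \<and> enough_E_injectives E}"

end


subsection \<open>Abelian categories\<close>

locale preadditive_category = cat +
  assumes Dom_in_Ob: "f \<in> Mor A \<Longrightarrow> Dom A f \<in> Ob A"
    and Cod_in_Ob: "f \<in> Mor A \<Longrightarrow> Cod A f \<in> Ob A"
    and Ide_in_Hom: "X \<in> Ob A \<Longrightarrow> Ide A X \<in> Hom X X"
    and Comp_in_Hom: "\<lbrakk>f \<in> Hom X Y; g \<in> Hom Y Z\<rbrakk> \<Longrightarrow> g \<cdot> f \<in> Hom X Z"
    and Comp_Ide: "f \<in> Hom X Y \<Longrightarrow> f \<cdot> Ide A X = f"
    and Ide_Comp: "f \<in> Hom X Y \<Longrightarrow> Ide A Y \<cdot> f = f"
    and Comp_assoc: "\<lbrakk>f \<in> Hom W X; g \<in> Hom X Y; h \<in> Hom Y Z\<rbrakk> \<Longrightarrow> h \<cdot> (g \<cdot> f) = (h \<cdot> g) \<cdot> f"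
    and Hom_comm_group: "\<lbrakk>X \<in> Ob A; Y \<in> Ob A\<rbrakk> \<Longrightarrow> comm_group (Hom_group X Y)"
    and Comp_Add: "\<lbrakk>f \<in> Hom X Y; g \<in> Hom Y Z; h \<in> Hom Y Z\<rbrakk> \<Longrightarrow> (g \<boxplus> h) \<cdot> f = (g \<cdot> f) \<boxplus> (h \<cdot> f)"
    and Add_Comp: "\<lbrakk>f \<in> Hom X Y; g \<in> Hom X Y; h \<in> Hom Y Z\<rbrakk> \<Longrightarrow> h \<cdot> (f \<boxplus> g) = (h \<cdot> f) \<boxplus> (h \<cdot> g)"

locale abelian_category = preadditive_category +
  assumes zero_object_exists: "\<exists>Z. is_zero_object Z"
    and biproduct_exists:
      "\<lbrakk>X \<in> Ob A; Y \<in> Ob A\<rbrakk> \<Longrightarrow> \<exists>P i1 i2 p1 p2. is_biproduct X Y P i1 i2 p1 p2"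
    and kernel_exists: "f \<in> Mor A \<Longrightarrow> \<exists>k. is_kernel f k"
    and cokernel_exists: "f \<in> Mor A \<Longrightarrow> \<exists>c. is_cokernel f c"
    and mono_is_kernel: "is_mono m \<Longrightarrow> \<exists>f. is_kernel f m"
    and epi_is_cokernel: "is_epi e \<Longrightarrow> \<exists>f. is_cokernel f e"

end

theory Submission
  imports Defs
begin

text \<open>
  All three structures are encoded by one class \<open>E\<close> of short exact sequences: those along which all
  maps from \<open>C\<close> lift (\<open>lift_seqs C\<close>), equivalently those along which all maps to \<open>D\<close> extend
  (\<open>extend_seqs D\<close>). The first two terms of the resolutions of a balanced pair give, for every object
  \<open>M\<close>, one sequence \<open>0 \<rightarrow> K \<rightarrow> P \<rightarrow> M \<rightarrow> 0\<close> with \<open>P \<in> C\<close> that has both properties; a sequence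
  \<open>0 \<rightarrow> Y \<rightarrow> Z \<rightarrow> M \<rightarrow> 0\<close> with the lifting property is a push-out of it, hence has the extension
  property. Closure of \<open>E\<close> under composition of admissible epics (monics) and pull-back (push-out) is
  immediate from the lifting (extension) description. The same push-out argument shows that an exact
  structure, or the class of \<open>F\<close>-sequences of a subfunctor \<open>F\<close>, with enough projectives is determined
  by its projectives. Conversely the classes of the sequences in \<open>E\<close> form a subfunctor, because the
  lifting property passes to direct sums, pull-backs and push-outs, and \<open>- [i, p] = [- i, p]\<close>. Dual
  statements come from the opposite category.
\<close>

section \<open>Calculus in preadditive categories\<close>

text \<open>The \<open>F\<close>-sequences of a subfunctor are closed under pull-back and push-out
  for formal reasons, but for a general subfunctor the admissible epics obtained in this way need
  not compose. Enough projectives remove this obstacle by rewriting the class as a lifting class,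
  where composition is trivial; enough injectives do the same for monics. The balance condition is
  what makes the two descriptions define one and the same class. All diagram chases are
  element-free: a test morphism \<open>h\<close> from an arbitrary object plays the role of an
  element. On the side of Ext, \<open>subgroup\<close> speaks of product, unit and inverse, and the
  inverse is a definite description over the Baer sum. The work on the group therefore consists in
  recognising the neutral class as that of the split sequences and in proving that a sign change on
  the monomorphism gives the only inverse.\<close>

context cat
begin

text \<open>The Hom-group is read off from the endpoints of \<open>f\<close>, so that
  \<open>neg f\<close> carries no object arguments and takes part in simplification like the other
  operations.\<close>

definition neg :: "'m \<Rightarrow> 'm" where
  "neg f = inv\<^bsub>Hom_group (Dom A f) (Cod A f)\<^esub> f"

end

context preadditive_category
begin

lemma in_Hom [simp]:
  "f \<in> Hom X Y \<longleftrightarrow> f \<in> Mor A \<and> Dom A f = X \<and> Cod A f = Y \<and> X \<in> Ob A \<and> Y \<in> Ob A"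
  using Dom_in_Ob Cod_in_Ob by (auto simp: Hom_def)

lemma Dom_Ob [simp]: "f \<in> Mor A \<Longrightarrow> Dom A f \<in> Ob A"
  and Cod_Ob [simp]: "f \<in> Mor A \<Longrightarrow> Cod A f \<in> Ob A"
  by (rule Dom_in_Ob Cod_in_Ob, assumption)+

lemma Comp_simps [simp]:
  assumes "f \<in> Mor A" "g \<in> Mor A" "Cod A f = Dom A g"
  shows "g \<cdot> f \<in> Mor A" "Dom A (g \<cdot> f) = Dom A f" "Cod A (g \<cdot> f) = Cod A g"
  using Comp_in_Hom[of f "Dom A f" "Cod A f" g "Cod A g"] assms by auto

lemma Ide_simps [simp]:
  assumes "X \<in> Ob A"
  shows "Ide A X \<in> Mor A" "Dom A (Ide A X) = X" "Cod A (Ide A X) = X"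
  using Ide_in_Hom[OF assms] by auto

lemma Comp_Ide_simp [simp]: "\<lbrakk>f \<in> Mor A; Dom A f = X\<rbrakk> \<Longrightarrow> f \<cdot> Ide A X = f"
  and Ide_Comp_simp [simp]: "\<lbrakk>f \<in> Mor A; Cod A f = Y\<rbrakk> \<Longrightarrow> Ide A Y \<cdot> f = f"
  using Comp_Ide[of f] Ide_Comp[of f] by auto

lemma Comp_assoc_simp [simp]:
  "\<lbrakk>f \<in> Mor A; g \<in> Mor A; h \<in> Mor A; Cod A f = Dom A g; Cod A g = Dom A h\<rbrakk>
    \<Longrightarrow> (h \<cdot> g) \<cdot> f = h \<cdot> (g \<cdot> f)"
  using Comp_assoc[of f "Dom A f" "Cod A f" g "Cod A g" h "Cod A h"] by auto

text \<open>Composites are normalised with brackets to the right, which hides the factor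
  \<open>h \<cdot> g\<close> of \<open>h \<cdot> (g \<cdot> f)\<close>. This lets an equation for
  \<open>h \<cdot> g\<close> act there; most diagram chases below consist of such
  replacements.\<close>

lemma Comp_rewrite:
  "\<lbrakk>h \<cdot> g = e; f \<in> Mor A; g \<in> Mor A; h \<in> Mor A; Cod A f = Dom A g; Cod A g = Dom A h\<rbrakk>
    \<Longrightarrow> h \<cdot> (g \<cdot> f) = e \<cdot> f"
  using Comp_assoc_simp by metis

lemma Zero_simps [simp]:
  assumes "X \<in> Ob A" "Y \<in> Ob A"
  shows "Zero A X Y \<in> Mor A" "Dom A (Zero A X Y) = X" "Cod A (Zero A X Y) = Y"
proof -
  interpret comm_group "Hom_group X Y" using assms by (rule Hom_comm_group)
  have "Zero A X Y \<in> Hom X Y" using one_closed by (simp only: Hom_group_def partial_object.simps monoid.simps)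
  then show "Zero A X Y \<in> Mor A" "Dom A (Zero A X Y) = X" "Cod A (Zero A X Y) = Y" by auto
qed

lemma Add_group:
  assumes "f \<in> Hom X Y" "g \<in> Hom X Y" "h \<in> Hom X Y"
  shows "f \<boxplus> g \<in> Hom X Y" "f \<boxplus> g = g \<boxplus> f" "(f \<boxplus> g) \<boxplus> h = f \<boxplus> (g \<boxplus> h)"
    "Zero A X Y \<boxplus> f = f" "neg f \<in> Hom X Y" "f \<boxplus> neg f = Zero A X Y"
    "f \<boxplus> g = f \<boxplus> h \<longleftrightarrow> g = h"
proof -
  have "X \<in> Ob A" "Y \<in> Ob A" using assms(1) by auto
  then interpret comm_group "Hom_group X Y" by (rule Hom_comm_group)
  have sel: "carrier (Hom_group X Y) = Hom X Y" "monoid.mult (Hom_group X Y) = Add A"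
    "one (Hom_group X Y) = Zero A X Y" by (simp_all only: Hom_group_def partial_object.simps monoid.simps)
  have n: "neg f = inv\<^bsub>Hom_group X Y\<^esub> f" using assms(1) by (simp add: neg_def)
  show "f \<boxplus> g \<in> Hom X Y" using m_closed[unfolded sel] assms by blast
  show "f \<boxplus> g = g \<boxplus> f" using m_comm[unfolded sel] assms by blast
  show "(f \<boxplus> g) \<boxplus> h = f \<boxplus> (g \<boxplus> h)" using m_assoc[unfolded sel] assms by blast
  show "Zero A X Y \<boxplus> f = f" using l_one[unfolded sel] assms by blast
  show "neg f \<in> Hom X Y" unfolding n using inv_closed[unfolded sel] assms by blast
  show "f \<boxplus> neg f = Zero A X Y" unfolding n using r_inv[unfolded sel] assms by blast
  show "f \<boxplus> g = f \<boxplus> h \<longleftrightarrow> g = h" using Units_l_cancel[unfolded Units_eq sel] assms by blast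
qed

lemma Add_simps [simp]:
  assumes "f \<in> Mor A" "g \<in> Mor A" "Dom A g = Dom A f" "Cod A g = Cod A f"
  shows "f \<boxplus> g \<in> Mor A" "Dom A (f \<boxplus> g) = Dom A f" "Cod A (f \<boxplus> g) = Cod A f"
  using Add_group(1)[of f "Dom A f" "Cod A f" g g] assms by auto

lemma neg_simps [simp]:
  assumes "f \<in> Mor A"
  shows "neg f \<in> Mor A" "Dom A (neg f) = Dom A f" "Cod A (neg f) = Cod A f"
  using Add_group(5)[of f "Dom A f" "Cod A f" f f] assms by auto

lemma Add_commute:
  assumes "f \<in> Mor A" "g \<in> Mor A" "Dom A g = Dom A f" "Cod A g = Cod A f"
  shows "f \<boxplus> g = g \<boxplus> f"
  using Add_group(2)[of f "Dom A f" "Cod A f" g g] assms by auto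

lemma Add_Zero [simp]:
  assumes "f \<in> Mor A" "Dom A f = X" "Cod A f = Y"
  shows "Zero A X Y \<boxplus> f = f" "f \<boxplus> Zero A X Y = f"
  using Add_group(4)[of f X Y f f] Add_commute[of f "Zero A X Y"] assms by auto

lemma Add_neg [simp]:
  assumes "f \<in> Mor A"
  shows "f \<boxplus> neg f = Zero A (Dom A f) (Cod A f)" "neg f \<boxplus> f = Zero A (Dom A f) (Cod A f)"
  using Add_group(6)[of f "Dom A f" "Cod A f" f f] Add_commute[of f "neg f"] assms by auto

lemma Add_cancel:
  assumes "f \<in> Mor A" "g \<in> Mor A" "h \<in> Mor A" "Dom A g = Dom A f" "Cod A g = Cod A f"
    "Dom A h = Dom A f" "Cod A h = Cod A f"
  shows "f \<boxplus> g = f \<boxplus> h \<longleftrightarrow> g = h"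
  using Add_group(7)[of f "Dom A f" "Cod A f" g h] assms by auto

lemma Add_assoc:
  assumes "f \<in> Mor A" "g \<in> Mor A" "h \<in> Mor A" "Dom A g = Dom A f" "Cod A g = Cod A f"
    "Dom A h = Dom A f" "Cod A h = Cod A f"
  shows "(f \<boxplus> g) \<boxplus> h = f \<boxplus> (g \<boxplus> h)"
  using Add_group(3)[of f "Dom A f" "Cod A f" g h] assms by auto

lemma neg_unique:
  assumes "f \<in> Mor A" "g \<in> Mor A" "Dom A g = Dom A f" "Cod A g = Cod A f"
    "f \<boxplus> g = Zero A (Dom A f) (Cod A f)"
  shows "g = neg f"
  using Add_cancel[of f g "neg f"] assms by simp

lemma sub_eq_Zero:
  assumes "f \<in> Mor A" "g \<in> Mor A" "Dom A g = X" "Cod A g = Y" "Dom A f = X" "Cod A f = Y"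
  shows "f \<boxplus> neg g = Zero A X Y \<longleftrightarrow> f = g"
  using Add_cancel[of "neg g" f g] Add_commute[of f "neg g"] assms by auto

lemma Comp_distrib [simp]:
  assumes "f \<in> Mor A" "g \<in> Mor A" "Dom A g = Dom A f" "Cod A g = Cod A f" "h \<in> Mor A"
  shows "Dom A h = Cod A f \<Longrightarrow> h \<cdot> (f \<boxplus> g) = (h \<cdot> f) \<boxplus> (h \<cdot> g)"
    "Cod A h = Dom A f \<Longrightarrow> (f \<boxplus> g) \<cdot> h = (f \<cdot> h) \<boxplus> (g \<cdot> h)"
  using Add_Comp[of f "Dom A f" "Cod A f" g h "Cod A h"] assms
    Comp_Add[of h "Dom A h" "Dom A f" f "Cod A f" g] by auto

text \<open>Zero morphisms are given only as neutral elements of the Hom-groups. By bilinearity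
  \<open>x = f \<cdot> 0\<close> satisfies \<open>x + x = x\<close>, and cancellation gives
  \<open>x = 0\<close>.\<close>

lemma Comp_Zero [simp]:
  assumes "f \<in> Mor A" "Dom A f = Y" "X \<in> Ob A"
  shows "f \<cdot> Zero A X Y = Zero A X (Cod A f)"
proof -
  have Y: "Y \<in> Ob A" using assms by auto
  have "f \<cdot> (Zero A X Y \<boxplus> Zero A X Y) = (f \<cdot> Zero A X Y) \<boxplus> (f \<cdot> Zero A X Y)"
    using assms Y by (intro Comp_distrib) auto
  then have "(f \<cdot> Zero A X Y) \<boxplus> (f \<cdot> Zero A X Y) = (f \<cdot> Zero A X Y) \<boxplus> Zero A X (Cod A f)"
    using assms Y by simp
  then show ?thesis using assms Y by (subst (asm) Add_cancel) auto
qed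

lemma Zero_Comp [simp]:
  assumes "f \<in> Mor A" "Cod A f = X" "Y \<in> Ob A"
  shows "Zero A X Y \<cdot> f = Zero A (Dom A f) Y"
proof -
  have X: "X \<in> Ob A" using assms by auto
  have "(Zero A X Y \<boxplus> Zero A X Y) \<cdot> f = (Zero A X Y \<cdot> f) \<boxplus> (Zero A X Y \<cdot> f)"
    using assms X by (intro Comp_distrib) auto
  then have "(Zero A X Y \<cdot> f) \<boxplus> (Zero A X Y \<cdot> f) = (Zero A X Y \<cdot> f) \<boxplus> Zero A (Dom A f) Y"
    using assms X by simp
  then show ?thesis using assms X by (subst (asm) Add_cancel) auto
qed

lemma Comp_neg [simp]:
  assumes "f \<in> Mor A" "h \<in> Mor A" "Dom A h = Cod A f"
  shows "h \<cdot> neg f = neg (h \<cdot> f)"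
proof (rule neg_unique)
  have "(h \<cdot> f) \<boxplus> (h \<cdot> neg f) = h \<cdot> (f \<boxplus> neg f)" using assms by (intro Comp_distrib[symmetric]) auto
  then show "(h \<cdot> f) \<boxplus> (h \<cdot> neg f) = Zero A (Dom A (h \<cdot> f)) (Cod A (h \<cdot> f))"
    using assms by simp
qed (use assms in auto)

lemma neg_Comp [simp]:
  assumes "f \<in> Mor A" "h \<in> Mor A" "Cod A h = Dom A f"
  shows "neg f \<cdot> h = neg (f \<cdot> h)"
proof (rule neg_unique)
  have "(f \<cdot> h) \<boxplus> (neg f \<cdot> h) = (f \<boxplus> neg f) \<cdot> h" using assms by (intro Comp_distrib[symmetric]) auto
  then show "(f \<cdot> h) \<boxplus> (neg f \<cdot> h) = Zero A (Dom A (f \<cdot> h)) (Cod A (f \<cdot> h))"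
    using assms by simp
qed (use assms in auto)

lemma neg_neg [simp]: "f \<in> Mor A \<Longrightarrow> neg (neg f) = f"
  using neg_unique[of "neg f" f] by auto

lemma neg_Zero [simp]: "\<lbrakk>X \<in> Ob A; Y \<in> Ob A\<rbrakk> \<Longrightarrow> neg (Zero A X Y) = Zero A X Y"
  using neg_unique[of "Zero A X Y" "Zero A X Y"] by auto

end

section \<open>The opposite category\<close>

text \<open>Only the structure maps are reversed; objects and morphisms stay what they are. The dual
  of a theorem is therefore its instance at \<open>op_cat A\<close>, and simp rules translate each
  notion back into one about \<open>A\<close>.\<close>

definition op_cat :: "('o, 'm) category \<Rightarrow> ('o, 'm) category" where
  "op_cat A = \<lparr>Ob = Ob A, Mor = Mor A, Dom = Cod A, Cod = Dom A, Ide = Ide A,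
    Comp = (\<lambda>g f. Comp A f g), Add = Add A, Zero = (\<lambda>X Y. Zero A Y X)\<rparr>"

lemma op_cat_simps [simp]:
  "Ob (op_cat A) = Ob A" "Mor (op_cat A) = Mor A" "Dom (op_cat A) = Cod A" "Cod (op_cat A) = Dom A"
  "Ide (op_cat A) = Ide A" "Comp (op_cat A) g f = Comp A f g" "Add (op_cat A) = Add A"
  "Zero (op_cat A) X Y = Zero A Y X" "cat.Hom (op_cat A) X Y = cat.Hom A Y X"
  by (auto simp: op_cat_def cat.Hom_def)

lemma op_cat_notions [simp]:
  "cat.is_mono (op_cat A) = cat.is_epi A"
  "cat.is_epi (op_cat A) = cat.is_mono A"
  "cat.is_iso (op_cat A) = cat.is_iso A"
  "cat.is_zero_object (op_cat A) = cat.is_zero_object A"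
  "cat.is_kernel (op_cat A) = cat.is_cokernel A"
  "cat.is_cokernel (op_cat A) = cat.is_kernel A"
  "cat.is_biproduct (op_cat A) X Y P i1 i2 p1 p2 = cat.is_biproduct A X Y P p1 p2 i1 i2"
  "cat.is_pullback (op_cat A) = cat.is_pushout A"
  "cat.is_pushout (op_cat A) = cat.is_pullback A"
  "cat.Hom_exact_at (op_cat A) X f g = cat.coHom_exact_at A X g f"
  "cat.coHom_exact_at (op_cat A) X f g = cat.Hom_exact_at A X g f"
  by (auto simp: fun_eq_iff cat.is_mono_def cat.is_epi_def cat.is_iso_def cat.is_zero_object_def
      cat.is_kernel_def cat.is_cokernel_def cat.is_biproduct_def cat.is_pullback_def
      cat.is_pushout_def cat.Hom_exact_at_def cat.coHom_exact_at_def)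

lemma (in preadditive_category) preadditive_op_cat: "preadditive_category (op_cat A)"
proof (rule preadditive_category.intro)
  show "comm_group (cat.Hom_group (op_cat A) X Y)" if "X \<in> Ob (op_cat A)" "Y \<in> Ob (op_cat A)" for X Y
    using Hom_comm_group[of Y X] that by (simp add: cat.Hom_group_def)
qed auto

lemma (in abelian_category) abelian_op_cat: "abelian_category (op_cat A)"
proof -
  interpret op: preadditive_category "op_cat A" by (rule preadditive_op_cat)
  show ?thesis
  proof
    show "\<exists>P i1 i2 p1 p2. op.is_biproduct X Y P i1 i2 p1 p2"
      if "X \<in> Ob (op_cat A)" "Y \<in> Ob (op_cat A)" for X Y
      using biproduct_exists[of X Y] that by (simp; blast)
  qed (use zero_object_exists kernel_exists cokernel_exists mono_is_kernel epi_is_cokernel in auto)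
qed

section \<open>Short exact sequences, pull-backs and push-outs\<close>

context preadditive_category
begin

section \<open>Monomorphisms, epimorphisms, kernels, cokernels and isomorphisms\<close>

lemma is_mono_cancel:
  "\<lbrakk>is_mono f; f \<in> Hom X Y; g \<in> Hom W X; h \<in> Hom W X; f \<cdot> g = f \<cdot> h\<rbrakk> \<Longrightarrow> g = h"
  unfolding is_mono_def by (metis in_Hom)

lemma is_epi_cancel:
  "\<lbrakk>is_epi f; f \<in> Hom X Y; g \<in> Hom Y W; h \<in> Hom Y W; g \<cdot> f = h \<cdot> f\<rbrakk> \<Longrightarrow> g = h"
  unfolding is_epi_def by (metis in_Hom)

lemma is_mono_iff:
  assumes "f \<in> Hom X Y"
  shows "is_mono f \<longleftrightarrow> (\<forall>W. \<forall>h\<in>Hom W X. f \<cdot> h = Zero A W Y \<longrightarrow> h = Zero A W X)"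
proof
  assume m: "is_mono f"
  show "\<forall>W. \<forall>h\<in>Hom W X. f \<cdot> h = Zero A W Y \<longrightarrow> h = Zero A W X"
  proof (intro allI ballI impI)
    fix W h assume h: "h \<in> Hom W X" and z: "f \<cdot> h = Zero A W Y"
    have "f \<cdot> h = f \<cdot> Zero A W X" using h z assms by simp
    then show "h = Zero A W X" by (rule is_mono_cancel[OF m assms, rotated 2]) (use h assms in auto)
  qed
next
  assume R: "\<forall>W. \<forall>h\<in>Hom W X. f \<cdot> h = Zero A W Y \<longrightarrow> h = Zero A W X"
  show "is_mono f" unfolding is_mono_def
  proof (intro conjI allI ballI impI)
    fix W g h assume g: "g \<in> Hom W (Dom A f)" and h: "h \<in> Hom W (Dom A f)" and e: "f \<cdot> g = f \<cdot> h"
    have "f \<cdot> (g \<boxplus> neg h) = Zero A W Y" using g h e assms by simp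
    then have "g \<boxplus> neg h = Zero A W X" using R g h assms by simp
    then show "g = h" using g h assms by (simp add: sub_eq_Zero)
  qed (use assms in auto)
qed

lemma is_epi_iff:
  assumes "f \<in> Hom X Y"
  shows "is_epi f \<longleftrightarrow> (\<forall>W. \<forall>h\<in>Hom Y W. h \<cdot> f = Zero A X W \<longrightarrow> h = Zero A Y W)"
  using preadditive_category.is_mono_iff[OF preadditive_op_cat, of f Y X] assms by simp

lemma is_mono_comp:
  assumes "is_mono f" "is_mono g" "f \<in> Hom X Y" "g \<in> Hom Y Z"
  shows "is_mono (g \<cdot> f)"
  unfolding is_mono_def
proof (intro conjI allI ballI impI)
  fix W a b assume ab: "a \<in> Hom W (Dom A (g \<cdot> f))" "b \<in> Hom W (Dom A (g \<cdot> f))"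
    and e: "(g \<cdot> f) \<cdot> a = (g \<cdot> f) \<cdot> b"
  then have "g \<cdot> (f \<cdot> a) = g \<cdot> (f \<cdot> b)" using assms by simp
  then have "f \<cdot> a = f \<cdot> b"
    by (rule is_mono_cancel[OF assms(2,4), rotated 2]) (use assms ab in auto)
  then show "a = b" by (rule is_mono_cancel[OF assms(1,3), rotated 2]) (use assms ab in auto)
qed (use assms in auto)

lemma is_epi_comp:
  assumes "is_epi f" "is_epi g" "f \<in> Hom X Y" "g \<in> Hom Y Z"
  shows "is_epi (g \<cdot> f)"
  using preadditive_category.is_mono_comp[OF preadditive_op_cat, of g f Z Y X] assms by simp

lemma is_mono_of_comp:
  assumes "is_mono (g \<cdot> f)" "f \<in> Hom X Y" "g \<in> Hom Y Z"
  shows "is_mono f"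
  unfolding is_mono_def
proof (intro conjI allI ballI impI)
  fix W a b assume ab: "a \<in> Hom W (Dom A f)" "b \<in> Hom W (Dom A f)" "f \<cdot> a = f \<cdot> b"
  then have "(g \<cdot> f) \<cdot> a = (g \<cdot> f) \<cdot> b" using assms by simp
  then show "a = b" by (rule is_mono_cancel[OF assms(1), rotated 3]) (use assms ab in auto)
qed (use assms in auto)

lemma is_epi_of_comp:
  assumes "is_epi (g \<cdot> f)" "f \<in> Hom X Y" "g \<in> Hom Y Z"
  shows "is_epi g"
  using preadditive_category.is_mono_of_comp[OF preadditive_op_cat, of f g Z Y X] assms by simp

lemma is_kernel_Mor: "is_kernel f k \<Longrightarrow> f \<in> Mor A \<and> k \<in> Mor A \<and> Cod A k = Dom A f"
  by (simp add: is_kernel_def)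

lemma is_kernel_Comp: "is_kernel f k \<Longrightarrow> f \<cdot> k = Zero A (Dom A k) (Cod A f)"
  by (simp add: is_kernel_def)

lemma is_kernel_lift:
  assumes "is_kernel f k" "k \<in> Hom K X" "f \<in> Hom X Y" "h \<in> Hom W X" "f \<cdot> h = Zero A W Y"
  obtains u where "u \<in> Hom W K" "k \<cdot> u = h"
  using assms unfolding is_kernel_def by (metis in_Hom)

lemma is_kernel_mono:
  assumes "is_kernel f k"
  shows "is_mono k"
  unfolding is_mono_def
proof (intro conjI allI ballI impI)
  show "k \<in> Mor A" using assms by (simp add: is_kernel_def)
  fix W g h assume gh: "g \<in> Hom W (Dom A k)" "h \<in> Hom W (Dom A k)" and e: "k \<cdot> g = k \<cdot> h"
  have k: "f \<in> Mor A" "k \<in> Mor A" "Cod A k = Dom A f" using is_kernel_Mor[OF assms] by auto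
  have "f \<cdot> (k \<cdot> g) = Zero A W (Cod A f)"
    using Comp_rewrite[OF is_kernel_Comp[OF assms], of g] gh k by simp
  then have "\<exists>!u. u \<in> Hom W (Dom A k) \<and> k \<cdot> u = k \<cdot> g"
    using assms gh k unfolding is_kernel_def by simp
  then show "g = h" using gh e by metis
qed

lemma is_kernelI:
  assumes "is_mono k" "k \<in> Hom K X" "f \<in> Hom X Y" "f \<cdot> k = Zero A K Y"
    "\<And>W h. h \<in> Hom W X \<Longrightarrow> f \<cdot> h = Zero A W Y \<Longrightarrow> \<exists>u\<in>Hom W K. k \<cdot> u = h"
  shows "is_kernel f k"
  unfolding is_kernel_def
proof (intro conjI allI ballI impI)
  fix W h assume h: "h \<in> Hom W (Dom A f)" "f \<cdot> h = Zero A W (Cod A f)"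
  then obtain u where "u\<in>Hom W K" "k \<cdot> u = h" using assms(3) assms(5)[of h W] by auto
  then show "\<exists>!u. u \<in> Hom W (Dom A k) \<and> k \<cdot> u = h"
    using is_mono_cancel[OF assms(1,2)] assms(2) by (intro ex1I[of _ u]) auto
qed (use assms in auto)

lemma is_cokernel_Mor: "is_cokernel f c \<Longrightarrow> f \<in> Mor A \<and> c \<in> Mor A \<and> Dom A c = Cod A f"
  by (simp add: is_cokernel_def)

lemma is_cokernel_Comp: "is_cokernel f c \<Longrightarrow> c \<cdot> f = Zero A (Dom A f) (Cod A c)"
  by (simp add: is_cokernel_def)

lemma is_cokernel_lift:
  assumes "is_cokernel f c" "c \<in> Hom Y C" "f \<in> Hom X Y" "h \<in> Hom Y W" "h \<cdot> f = Zero A X W"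
  obtains u where "u \<in> Hom C W" "u \<cdot> c = h"
  using preadditive_category.is_kernel_lift[OF preadditive_op_cat, of f c C Y X h W] assms by auto

lemma is_cokernel_epi: "is_cokernel f c \<Longrightarrow> is_epi c"
  using preadditive_category.is_kernel_mono[OF preadditive_op_cat, of f c] by simp

lemma is_isoI:
  assumes "u \<in> Hom X Y" "v \<in> Hom Y X" "v \<cdot> u = Ide A X" "u \<cdot> v = Ide A Y"
  shows "is_iso u"
  using assms unfolding is_iso_def by auto

lemma is_isoE:
  assumes "is_iso u" "u \<in> Hom X Y"
  obtains v where "v \<in> Hom Y X" "v \<cdot> u = Ide A X" "u \<cdot> v = Ide A Y" "is_iso v"
proof -
  obtain v where v: "v \<in> Hom Y X" "v \<cdot> u = Ide A X" "u \<cdot> v = Ide A Y"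
    using assms unfolding is_iso_def by auto
  then show ?thesis using that is_isoI[OF v(1) assms(2)] by blast
qed

end

section \<open>Normality of monomorphisms and epimorphisms\<close>

context abelian_category
begin

text \<open>\<open>m\<close> is the kernel of some \<open>f\<close>. As \<open>f\<close> kills
  \<open>m\<close>, it factors as \<open>t \<cdot> c\<close>; whatever \<open>c\<close> kills is
  then killed by \<open>f\<close> and factors through \<open>m\<close>.\<close>

lemma mono_is_kernel_of_cokernel:
  assumes "is_mono m" "is_cokernel m c"
  shows "is_kernel c m"
proof -
  have c: "m \<in> Mor A" "c \<in> Mor A" "Dom A c = Cod A m" using is_cokernel_Mor[OF assms(2)] by auto
  obtain f where f: "is_kernel f m" using mono_is_kernel[OF assms(1)] by blast
  then have fm: "f \<in> Mor A" "Cod A m = Dom A f" "f \<cdot> m = Zero A (Dom A m) (Cod A f)"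
    using is_kernel_Mor is_kernel_Comp by auto
  obtain t where t: "t \<in> Hom (Cod A c) (Cod A f)" "t \<cdot> c = f"
    by (rule is_cokernel_lift[OF assms(2), of _ _ _ f]) (use c fm in auto)
  show ?thesis
  proof (rule is_kernelI[OF assms(1)])
    show "c \<cdot> m = Zero A (Dom A m) (Cod A c)" using is_cokernel_Comp[OF assms(2)] .
    fix W h assume h: "h \<in> Hom W (Cod A m)" "c \<cdot> h = Zero A W (Cod A c)"
    have "t \<cdot> (c \<cdot> h) = f \<cdot> h" using t c fm h(1) by (intro Comp_rewrite) auto
    then have fh: "f \<cdot> h = Zero A W (Cod A f)" using t h by simp
    show "\<exists>u\<in>Hom W (Dom A m). m \<cdot> u = h"
      by (rule is_kernel_lift[OF f _ _ h(1) fh, of "Dom A m"]) (use fm c h in auto)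
  qed (use c in auto)
qed

lemma epi_is_cokernel_of_kernel:
  assumes "is_epi e" "is_kernel e k"
  shows "is_cokernel k e"
  using abelian_category.mono_is_kernel_of_cokernel[OF abelian_op_cat, of e k] assms by simp

text \<open>\<open>m\<close> is the kernel of some \<open>f\<close>, and
  \<open>f \<cdot> m = 0\<close> with \<open>m\<close> epi forces \<open>f = 0\<close>. Hence the
  identity factors through the kernel, which gives a right inverse; cancelling \<open>m\<close>
  makes it two-sided.\<close>

lemma mono_epi_is_iso:
  assumes "is_mono m" "is_epi m"
  shows "is_iso m"
proof -
  obtain f where f: "is_kernel f m" using mono_is_kernel[OF assms(1)] by blast
  then have fm: "f \<in> Mor A" "m \<in> Mor A" "Cod A m = Dom A f" "f \<cdot> m = Zero A (Dom A m) (Cod A f)"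
    using is_kernel_Mor is_kernel_Comp by auto
  have "f = Zero A (Dom A f) (Cod A f)"
    using is_epi_iff[of m "Dom A m" "Cod A m"] assms(2) fm by auto
  then have "f \<cdot> Ide A (Cod A m) = Zero A (Cod A m) (Cod A f)" using fm by simp
  then obtain r where r: "r \<in> Hom (Cod A m) (Dom A m)" "m \<cdot> r = Ide A (Cod A m)"
    using is_kernel_lift[OF f, of "Dom A m" "Cod A m" "Cod A f" "Ide A (Cod A m)" "Cod A m"] fm by auto
  have "m \<cdot> (r \<cdot> m) = m \<cdot> Ide A (Dom A m)" using Comp_rewrite[OF r(2), of m] fm r(1) by simp
  then have "r \<cdot> m = Ide A (Dom A m)"
    by (rule is_mono_cancel[OF assms(1), of "Dom A m" "Cod A m" _ "Dom A m", rotated 3]) (use fm r in auto)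
  then show ?thesis using fm r by (intro is_isoI[of m _ _ r]) auto
qed

end

section \<open>Short exact sequences with named objects and the short five lemma\<close>

definition (in cat) ses :: "'o \<Rightarrow> 'o \<Rightarrow> 'o \<Rightarrow> 'm \<Rightarrow> 'm \<Rightarrow> bool" where
  "ses Y Z X i p \<longleftrightarrow> i \<in> Hom Y Z \<and> p \<in> Hom Z X \<and> is_kernel p i \<and> is_cokernel i p"

lemma op_cat_ses [simp]: "cat.ses (op_cat A) Y Z X i p = cat.ses A X Z Y p i"
  by (auto simp: cat.ses_def)

context abelian_category
begin

lemma ses_Hom:
  assumes "ses Y Z X i p"
  shows "i \<in> Mor A" "p \<in> Mor A" "Dom A i = Y" "Cod A i = Z" "Dom A p = Z" "Cod A p = X"
    "X \<in> Ob A" "Y \<in> Ob A" "Z \<in> Ob A" "p \<cdot> i = Zero A Y X" "is_mono i" "is_epi p"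
    "is_kernel p i" "is_cokernel i p"
  using assms is_kernel_mono[of p i] is_cokernel_epi[of i p] is_kernel_Comp[of p i]
  unfolding ses_def by simp_all

lemma ses_of_epi:
  assumes "is_epi p" "is_kernel p i" "i \<in> Hom Y Z" "p \<in> Hom Z X"
  shows "ses Y Z X i p"
  using assms epi_is_cokernel_of_kernel unfolding ses_def by auto

lemma ses_of_epi_ex:
  assumes "is_epi p" "p \<in> Hom Z X"
  obtains Y i where "ses Y Z X i p"
proof -
  obtain i where "is_kernel p i" using kernel_exists[of p] assms by auto
  then show ?thesis using assms is_kernel_Mor[of p i]
    by (intro that[of "Dom A i" i] ses_of_epi) auto
qed

lemma ses_lift:
  assumes "ses Y Z X i p" "h \<in> Hom W Z" "p \<cdot> h = Zero A W X"
  obtains u where "u \<in> Hom W Y" "i \<cdot> u = h"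
  using assms is_kernel_lift[of p i Y Z X h W] unfolding ses_def by auto

lemma ses_extend:
  assumes "ses Y Z X i p" "h \<in> Hom Z W" "h \<cdot> i = Zero A Y W"
  obtains u where "u \<in> Hom X W" "u \<cdot> p = h"
  using assms is_cokernel_lift[of i p Z X Y h W] unfolding ses_def by auto

lemma ses_Comp_Comp: "ses Y Z X i p \<Longrightarrow> f \<in> Hom W Y \<Longrightarrow> p \<cdot> (i \<cdot> f) = Zero A W X"
  using Comp_rewrite[of p i "Zero A Y X" f] ses_Hom[of Y Z X i p] by auto

text \<open>One half of the short five lemma with identities at both ends. If
  \<open>u \<cdot> h = 0\<close>, then \<open>p \<cdot> h = 0\<close>, so
  \<open>h = i \<cdot> y\<close>, and \<open>j \<cdot> y = 0\<close> gives \<open>y = 0\<close>. The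
  other half is the dual statement.\<close>

lemma ses_middle_mono:
  assumes "ses Y Z X i p" "ses Y Z' X j q" "u \<in> Hom Z Z'" "u \<cdot> i = j" "q \<cdot> u = p"
  shows "is_mono u"
proof (subst is_mono_iff[OF assms(3)], intro allI ballI impI)
  note s = ses_Hom[OF assms(1)] ses_Hom[OF assms(2)]
  fix W h assume h: "h \<in> Hom W Z" "u \<cdot> h = Zero A W Z'"
  have "q \<cdot> (u \<cdot> h) = p \<cdot> h" using assms(3,5) s h(1) by (intro Comp_rewrite) auto
  then have "p \<cdot> h = Zero A W X" using assms(3) s h by simp
  then obtain y where y: "y \<in> Hom W Y" "i \<cdot> y = h" using ses_lift[OF assms(1) h(1)] by blast
  have "u \<cdot> (i \<cdot> y) = j \<cdot> y" using assms(3,4) s y(1) by (intro Comp_rewrite) auto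
  then have "y = Zero A W Y" using is_mono_iff[of j Y Z'] s h y by auto
  then show "h = Zero A W Z" using y s h by auto
qed

lemma ses_middle_iso:
  assumes "ses Y Z X i p" "ses Y Z' X j q" "u \<in> Hom Z Z'" "u \<cdot> i = j" "q \<cdot> u = p"
  shows "is_iso u"
proof (rule mono_epi_is_iso)
  show "is_mono u" using assms by (rule ses_middle_mono)
  show "is_epi u"
    using abelian_category.ses_middle_mono[OF abelian_op_cat, of X Z' Y q j Z p i u] assms by simp
qed

lemma ses_middle_inverse:
  assumes "ses Y Z X i p" "ses Y Z' X j q" "u \<in> Hom Z Z'" "u \<cdot> i = j" "q \<cdot> u = p"
  obtains v where "v \<in> Hom Z' Z" "v \<cdot> j = i" "p \<cdot> v = q" "v \<cdot> u = Ide A Z" "u \<cdot> v = Ide A Z'"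
proof -
  obtain v where v: "v \<in> Hom Z' Z" "v \<cdot> u = Ide A Z" "u \<cdot> v = Ide A Z'"
    using is_isoE[OF ses_middle_iso[OF assms] assms(3)] by blast
  note s = ses_Hom[OF assms(1)] ses_Hom[OF assms(2)]
  have "v \<cdot> (u \<cdot> i) = Ide A Z \<cdot> i" using s v(1,2) assms(3) by (intro Comp_rewrite) auto
  then have "v \<cdot> j = i" using assms(4) s by simp
  moreover have "q \<cdot> (u \<cdot> v) = p \<cdot> v" using s v(1) assms(3,5) by (intro Comp_rewrite) auto
  then have "p \<cdot> v = q" using v(3) s by simp
  ultimately show ?thesis using that[of v] v s by simp
qed

section \<open>Pull-backs and biproducts\<close>

lemma pullback_Hom:
  assumes "is_pullback p f u q" "p \<in> Hom Z X" "f \<in> Hom X' X"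
  obtains P where "u \<in> Hom P Z" "q \<in> Hom P X'" "p \<cdot> u = f \<cdot> q"
  using assms unfolding is_pullback_def by auto

lemma pullback_lift:
  assumes "is_pullback p f u q" "p \<in> Hom Z X" "f \<in> Hom X' X" "q \<in> Hom P X'"
    "a \<in> Hom W Z" "b \<in> Hom W X'" "p \<cdot> a = f \<cdot> b"
  obtains w where "w \<in> Hom W P" "u \<cdot> w = a" "q \<cdot> w = b"
proof -
  have "\<forall>a\<in>Hom W (Dom A p). \<forall>b\<in>Hom W (Dom A f). p \<cdot> a = f \<cdot> b \<longrightarrow>
      (\<exists>!w. w \<in> Hom W (Dom A u) \<and> u \<cdot> w = a \<and> q \<cdot> w = b)" and d: "Dom A u = Dom A q"
    using assms(1) unfolding is_pullback_def by blast+
  then have "\<exists>!w. w \<in> Hom W (Dom A u) \<and> u \<cdot> w = a \<and> q \<cdot> w = b" using assms by auto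
  then show ?thesis using that d assms(4) by auto
qed

lemma pullback_eqI:
  assumes "is_pullback p f u q" "p \<in> Hom Z X" "f \<in> Hom X' X" "q \<in> Hom P X'"
    "a \<in> Hom W P" "b \<in> Hom W P" "u \<cdot> a = u \<cdot> b" "q \<cdot> a = q \<cdot> b"
  shows "a = b"
proof -
  obtain P' where P': "u \<in> Hom P' Z" "q \<in> Hom P' X'" and pu: "p \<cdot> u = f \<cdot> q"
    using pullback_Hom[OF assms(1-3)] .
  have [simp]: "P' = P" using P' assms(4) by simp
  have "\<forall>a\<in>Hom W (Dom A p). \<forall>b\<in>Hom W (Dom A f). p \<cdot> a = f \<cdot> b \<longrightarrow>
      (\<exists>!w. w \<in> Hom W (Dom A u) \<and> u \<cdot> w = a \<and> q \<cdot> w = b)"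
    using assms(1) unfolding is_pullback_def by blast
  moreover have "p \<cdot> (u \<cdot> a) = f \<cdot> (q \<cdot> a)"
    using Comp_rewrite[OF pu, of a] P' assms(2-5) by simp
  ultimately have "\<exists>!w. w \<in> Hom W (Dom A u) \<and> u \<cdot> w = u \<cdot> a \<and> q \<cdot> w = q \<cdot> a"
    using assms(2-5) P' by simp
  moreover have "a \<in> Hom W (Dom A u)" "b \<in> Hom W (Dom A u)" using assms P' by auto
  ultimately show ?thesis using assms(7,8) by metis
qed

lemma is_pullbackI:
  assumes "p \<in> Hom Z X" "f \<in> Hom X' X" "u \<in> Hom P Z" "q \<in> Hom P X'" "p \<cdot> u = f \<cdot> q"
    "\<And>W a b. a \<in> Hom W Z \<Longrightarrow> b \<in> Hom W X' \<Longrightarrow> p \<cdot> a = f \<cdot> b \<Longrightarrow> \<exists>w\<in>Hom W P. u \<cdot> w = a \<and> q \<cdot> w = b"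
    "\<And>W a b. a \<in> Hom W P \<Longrightarrow> b \<in> Hom W P \<Longrightarrow> u \<cdot> a = u \<cdot> b \<Longrightarrow> q \<cdot> a = q \<cdot> b \<Longrightarrow> a = b"
  shows "is_pullback p f u q"
  unfolding is_pullback_def
proof (intro conjI allI ballI impI)
  fix W a b assume ab: "a \<in> Hom W (Dom A p)" "b \<in> Hom W (Dom A f)" "p \<cdot> a = f \<cdot> b"
  then obtain w where w: "w\<in>Hom W P" "u \<cdot> w = a" "q \<cdot> w = b" using assms(1,2) assms(6)[of a W b] by auto
  show "\<exists>!w. w \<in> Hom W (Dom A u) \<and> u \<cdot> w = a \<and> q \<cdot> w = b"
  proof (rule ex1I[of _ w])
    show "w \<in> Hom W (Dom A u) \<and> u \<cdot> w = a \<and> q \<cdot> w = b" using w assms(3) by simp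
  next
    fix w' assume "w' \<in> Hom W (Dom A u) \<and> u \<cdot> w' = a \<and> q \<cdot> w' = b"
    then show "w' = w" using w assms(3) by (intro assms(7)[of w' W w]) auto
  qed
qed (use assms in auto)

lemma biproduct_simps:
  assumes "is_biproduct X Y P i1 i2 p1 p2"
  shows "X \<in> Ob A" "Y \<in> Ob A" "P \<in> Ob A" "i1 \<in> Mor A" "i2 \<in> Mor A" "p1 \<in> Mor A" "p2 \<in> Mor A"
    "Dom A i1 = X" "Cod A i1 = P" "Dom A i2 = Y" "Cod A i2 = P"
    "Dom A p1 = P" "Cod A p1 = X" "Dom A p2 = P" "Cod A p2 = Y"
    "p1 \<cdot> i1 = Ide A X" "p2 \<cdot> i2 = Ide A Y" "p2 \<cdot> i1 = Zero A X Y" "p1 \<cdot> i2 = Zero A Y X"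
    "(i1 \<cdot> p1) \<boxplus> (i2 \<cdot> p2) = Ide A P"
    "f \<in> Hom W X \<Longrightarrow> p1 \<cdot> (i1 \<cdot> f) = f" "f \<in> Hom W X \<Longrightarrow> p2 \<cdot> (i1 \<cdot> f) = Zero A W Y"
    "g \<in> Hom W Y \<Longrightarrow> p2 \<cdot> (i2 \<cdot> g) = g" "g \<in> Hom W Y \<Longrightarrow> p1 \<cdot> (i2 \<cdot> g) = Zero A W X"
    "h \<in> Hom W P \<Longrightarrow> (i1 \<cdot> (p1 \<cdot> h)) \<boxplus> (i2 \<cdot> (p2 \<cdot> h)) = h"
proof -
  show m: "X \<in> Ob A" "Y \<in> Ob A" "P \<in> Ob A" "i1 \<in> Mor A" "i2 \<in> Mor A" "p1 \<in> Mor A" "p2 \<in> Mor A"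
    "Dom A i1 = X" "Cod A i1 = P" "Dom A i2 = Y" "Cod A i2 = P"
    "Dom A p1 = P" "Cod A p1 = X" "Dom A p2 = P" "Cod A p2 = Y"
    and e: "p1 \<cdot> i1 = Ide A X" "p2 \<cdot> i2 = Ide A Y" "p2 \<cdot> i1 = Zero A X Y" "p1 \<cdot> i2 = Zero A Y X"
    "(i1 \<cdot> p1) \<boxplus> (i2 \<cdot> p2) = Ide A P"
    using assms unfolding is_biproduct_def by simp_all
  show "f \<in> Hom W X \<Longrightarrow> p1 \<cdot> (i1 \<cdot> f) = f" using Comp_rewrite[OF e(1), of f] m by simp
  show "f \<in> Hom W X \<Longrightarrow> p2 \<cdot> (i1 \<cdot> f) = Zero A W Y" using Comp_rewrite[OF e(3), of f] m by simp
  show "g \<in> Hom W Y \<Longrightarrow> p2 \<cdot> (i2 \<cdot> g) = g" using Comp_rewrite[OF e(2), of g] m by simp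
  show "g \<in> Hom W Y \<Longrightarrow> p1 \<cdot> (i2 \<cdot> g) = Zero A W X" using Comp_rewrite[OF e(4), of g] m by simp
  show "(i1 \<cdot> (p1 \<cdot> h)) \<boxplus> (i2 \<cdot> (p2 \<cdot> h)) = h" if h: "h \<in> Hom W P"
  proof -
    have "(i1 \<cdot> (p1 \<cdot> h)) \<boxplus> (i2 \<cdot> (p2 \<cdot> h)) = ((i1 \<cdot> p1) \<boxplus> (i2 \<cdot> p2)) \<cdot> h" using m h by simp
    also have "\<dots> = Ide A P \<cdot> h" by (simp only: e(5))
    also have "\<dots> = h" using h by simp
    finally show ?thesis .
  qed
qed

lemma biproduct_eqI_to:
  assumes "is_biproduct X Y P i1 i2 p1 p2" "a \<in> Hom W P" "b \<in> Hom W P"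
    "p1 \<cdot> a = p1 \<cdot> b" "p2 \<cdot> a = p2 \<cdot> b"
  shows "a = b"
  using biproduct_simps(25)[OF assms(1,2)] biproduct_simps(25)[OF assms(1,3)] assms(4,5) by metis

lemma biproduct_eqI_from:
  assumes "is_biproduct X Y P i1 i2 p1 p2" "a \<in> Hom P W" "b \<in> Hom P W"
    "a \<cdot> i1 = b \<cdot> i1" "a \<cdot> i2 = b \<cdot> i2"
  shows "a = b"
  using abelian_category.biproduct_eqI_to[OF abelian_op_cat, of X Y P p1 p2 i1 i2 a W b] assms by simp

text \<open>The pull-back is the equaliser of the two morphisms \<open>Z + X' -> X\<close>, hence
  the kernel of their difference. In this form normality can be applied to it, which
  \<open>pullback_epi\<close> relies on.\<close>

lemma pullback_is_kernel:
  assumes B: "is_biproduct Z X' B i1 i2 p1 p2" and pb: "is_pullback p f u q"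
    and p: "p \<in> Hom Z X" and f: "f \<in> Hom X' X" and u: "u \<in> Hom P Z" and q: "q \<in> Hom P X'"
  shows "is_kernel ((p \<cdot> p1) \<boxplus> neg (f \<cdot> p2)) ((i1 \<cdot> u) \<boxplus> (i2 \<cdot> q))"
proof (rule is_kernelI)
  note b = biproduct_simps[OF B]
  have pu: "p \<cdot> u = f \<cdot> q" using pullback_Hom[OF pb p f] by metis
  show k: "(i1 \<cdot> u) \<boxplus> (i2 \<cdot> q) \<in> Hom P B" using b u q by simp
  show s: "(p \<cdot> p1) \<boxplus> neg (f \<cdot> p2) \<in> Hom B X" using b p f by simp
  have p1k: "p1 \<cdot> ((i1 \<cdot> u) \<boxplus> (i2 \<cdot> q)) = u" and p2k: "p2 \<cdot> ((i1 \<cdot> u) \<boxplus> (i2 \<cdot> q)) = q"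
    using b u q by simp_all
  show "is_mono ((i1 \<cdot> u) \<boxplus> (i2 \<cdot> q))"
  proof (subst is_mono_iff[OF k], intro allI ballI impI)
    fix W h assume h: "h \<in> Hom W P" "((i1 \<cdot> u) \<boxplus> (i2 \<cdot> q)) \<cdot> h = Zero A W B"
    have "p1 \<cdot> (((i1 \<cdot> u) \<boxplus> (i2 \<cdot> q)) \<cdot> h) = u \<cdot> h" "p2 \<cdot> (((i1 \<cdot> u) \<boxplus> (i2 \<cdot> q)) \<cdot> h) = q \<cdot> h"
      using Comp_rewrite[OF p1k, of h] Comp_rewrite[OF p2k, of h] h(1) k b by simp_all
    then have "u \<cdot> h = Zero A W Z" "q \<cdot> h = Zero A W X'" using h b by simp_all
    then show "h = Zero A W P"
      by (intro pullback_eqI[OF pb p f q h(1)]) (use u q h(1) in simp_all)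
  qed
  show "((p \<cdot> p1) \<boxplus> neg (f \<cdot> p2)) \<cdot> ((i1 \<cdot> u) \<boxplus> (i2 \<cdot> q)) = Zero A P X"
    using b u q p f pu by simp
  fix W h assume h: "h \<in> Hom W B" "((p \<cdot> p1) \<boxplus> neg (f \<cdot> p2)) \<cdot> h = Zero A W X"
  have "(p \<cdot> (p1 \<cdot> h)) \<boxplus> neg (f \<cdot> (p2 \<cdot> h)) = Zero A W X" using h b p f by simp
  then have "p \<cdot> (p1 \<cdot> h) = f \<cdot> (p2 \<cdot> h)"
    using h(1) b p f by (subst (asm) sub_eq_Zero) simp_all
  then obtain w where w: "w \<in> Hom W P" "u \<cdot> w = p1 \<cdot> h" "q \<cdot> w = p2 \<cdot> h"
    by (rule pullback_lift[OF pb p f q, where W=W, rotated 2]) (use h(1) b in simp_all, blast?)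
  have "((i1 \<cdot> u) \<boxplus> (i2 \<cdot> q)) \<cdot> w = h" using w b(25)[OF h(1)] u q b(1-15) by simp
  then show "\<exists>w\<in>Hom W P. ((i1 \<cdot> u) \<boxplus> (i2 \<cdot> q)) \<cdot> w = h" using w by blast
qed

lemma pullback_exists:
  assumes p: "p \<in> Hom Z X" and f: "f \<in> Hom X' X"
  obtains P u q where "is_pullback p f u q" "u \<in> Hom P Z" "q \<in> Hom P X'"
proof -
  obtain B i1 i2 p1 p2 where B: "is_biproduct Z X' B i1 i2 p1 p2"
    using biproduct_exists[of Z X'] p f by auto
  note b = biproduct_simps[OF B]
  let ?s = "(p \<cdot> p1) \<boxplus> neg (f \<cdot> p2)"
  have s: "?s \<in> Hom B X" using b p f by simp
  obtain k where k: "is_kernel ?s k" using kernel_exists[of ?s] s by auto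
  define P where "P = Dom A k"
  have kP: "k \<in> Hom P B" using is_kernel_Mor[OF k] s by (auto simp: P_def)
  have "?s \<cdot> k = Zero A P X" using is_kernel_Comp[OF k] s kP by simp
  then have "(p \<cdot> (p1 \<cdot> k)) \<boxplus> neg (f \<cdot> (p2 \<cdot> k)) = Zero A P X" using kP b p f by simp
  then have e: "p \<cdot> (p1 \<cdot> k) = f \<cdot> (p2 \<cdot> k)"
    using kP b p f by (subst (asm) sub_eq_Zero) simp_all
  have "is_pullback p f (p1 \<cdot> k) (p2 \<cdot> k)"
  proof (rule is_pullbackI[OF p f _ _ e])
    show "p1 \<cdot> k \<in> Hom P Z" "p2 \<cdot> k \<in> Hom P X'" using b kP by simp_all
  next
    fix W x y assume x: "x \<in> Hom W Z" and y: "y \<in> Hom W X'" and xy: "p \<cdot> x = f \<cdot> y"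
    have h: "(i1 \<cdot> x) \<boxplus> (i2 \<cdot> y) \<in> Hom W B" "?s \<cdot> ((i1 \<cdot> x) \<boxplus> (i2 \<cdot> y)) = Zero A W X"
      using b p f x y xy by simp_all
    obtain w where w: "w \<in> Hom W P" "k \<cdot> w = (i1 \<cdot> x) \<boxplus> (i2 \<cdot> y)"
      by (rule is_kernel_lift[OF k kP s h])
    then have "(p1 \<cdot> k) \<cdot> w = x" "(p2 \<cdot> k) \<cdot> w = y" using kP b x y by simp_all
    then show "\<exists>w\<in>Hom W P. (p1 \<cdot> k) \<cdot> w = x \<and> (p2 \<cdot> k) \<cdot> w = y" using w by blast
  next
    fix W x y assume x: "x \<in> Hom W P" and y: "y \<in> Hom W P"
      and xy: "(p1 \<cdot> k) \<cdot> x = (p1 \<cdot> k) \<cdot> y" "(p2 \<cdot> k) \<cdot> x = (p2 \<cdot> k) \<cdot> y"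
    have "k \<cdot> x = k \<cdot> y"
      by (rule biproduct_eqI_to[OF B, where W=W]) (use xy x y kP b in simp_all)
    then show "x = y" by (rule is_mono_cancel[OF is_kernel_mono[OF k] kP x y])
  qed
  then show ?thesis using that[of "p1 \<cdot> k" "p2 \<cdot> k" P] kP b by simp
qed

text \<open>The difference \<open>?s : Z + X' -> X\<close> restricts to \<open>p\<close> on the
  first summand, so it is epi and thus the cokernel of its kernel \<open>P\<close>. If
  \<open>h \<cdot> q = 0\<close>, then \<open>h \<cdot> p2\<close> kills \<open>P\<close> and equals
  \<open>t \<cdot> ?s\<close>. Restriction to the first summand gives
  \<open>t \<cdot> p = 0\<close>, so \<open>t = 0\<close>; restriction to the second gives
  \<open>h = 0\<close>.\<close>

lemma pullback_epi:
  assumes pb: "is_pullback p f u q" and p: "p \<in> Hom Z X" and f: "f \<in> Hom X' X"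
    and u: "u \<in> Hom P Z" and q: "q \<in> Hom P X'" and e: "is_epi p"
  shows "is_epi q"
proof (subst is_epi_iff[OF q], intro allI ballI impI)
  fix W h assume h: "h \<in> Hom X' W" "h \<cdot> q = Zero A P W"
  obtain B i1 i2 p1 p2 where B: "is_biproduct Z X' B i1 i2 p1 p2"
    using biproduct_exists[of Z X'] p f by auto
  note b = biproduct_simps[OF B]
  let ?s = "(p \<cdot> p1) \<boxplus> neg (f \<cdot> p2)"
  have s: "?s \<in> Hom B X" using b p f by simp
  have k: "is_kernel ?s ((i1 \<cdot> u) \<boxplus> (i2 \<cdot> q))" by (rule pullback_is_kernel[OF B pb p f u q])
  have si: "?s \<cdot> i1 = p" using b p f by simp
  have "is_epi ?s" by (rule is_epi_of_comp[of ?s i1 Z B X]) (use si e b s in simp_all)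
  then have c: "is_cokernel ((i1 \<cdot> u) \<boxplus> (i2 \<cdot> q)) ?s" by (rule epi_is_cokernel_of_kernel[OF _ k])
  obtain t where t: "t \<in> Hom X W" "t \<cdot> ?s = h \<cdot> p2"
    by (rule is_cokernel_lift[OF c s, of P "h \<cdot> p2" W]) (use b u q h in simp_all, blast?)
  have "t \<cdot> (?s \<cdot> i1) = (h \<cdot> p2) \<cdot> i1" by (rule Comp_rewrite[OF t(2)]) (use t(1) b s in simp_all)
  then have "t \<cdot> p = Zero A Z W" unfolding si using b h by simp
  then have "t = Zero A X W" using is_epi_iff[OF p] e t(1) by blast
  then have "h \<cdot> p2 = Zero A B W" using t s by simp
  then have "(h \<cdot> p2) \<cdot> i2 = Zero A X' W" using b h by simp
  then show "h = Zero A X' W" using b h by simp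
qed

section \<open>Pull-back and push-out of short exact sequences\<close>

lemma ses_pull:
  assumes S: "ses Y Z X i p" and f: "f \<in> Hom X' X"
  obtains P u j q where "ses Y P X' j q" "u \<in> Hom P Z" "u \<cdot> j = i" "p \<cdot> u = f \<cdot> q" "is_pullback p f u q"
proof -
  note s = ses_Hom[OF S]
  have p: "p \<in> Hom Z X" using s by simp
  obtain P u q where pb: "is_pullback p f u q" and u: "u \<in> Hom P Z" and q: "q \<in> Hom P X'"
    using pullback_exists[OF p f] .
  have pu: "p \<cdot> u = f \<cdot> q" using pullback_Hom[OF pb p f] by metis
  \<comment> \<open>The kernel of \<open>q\<close> is the old kernel \<open>Y\<close>, embedded in
    the pull-back with components \<open>i\<close> and 0.\<close>
  obtain j where j: "j \<in> Hom Y P" "u \<cdot> j = i" "q \<cdot> j = Zero A Y X'"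
    by (rule pullback_lift[OF pb p f q, of i Y "Zero A Y X'"]) (use s f in simp_all, blast?)
  have "is_kernel q j"
  proof (rule is_kernelI[OF _ j(1) q j(3)])
    show "is_mono j" by (rule is_mono_of_comp[of u _ Y P Z]) (use j s u in simp_all)
    fix W h assume h: "h \<in> Hom W P" "q \<cdot> h = Zero A W X'"
    have "p \<cdot> (u \<cdot> h) = (f \<cdot> q) \<cdot> h" by (rule Comp_rewrite[OF pu]) (use h u p in simp_all)
    then have "p \<cdot> (u \<cdot> h) = Zero A W X" using h q f by simp
    then obtain y where y: "y \<in> Hom W Y" "i \<cdot> y = u \<cdot> h"
      by (rule ses_lift[OF S, rotated]) (use h u in simp_all, blast?)
    have "j \<cdot> y = h"
    proof (rule pullback_eqI[OF pb p f q, where W=W])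
      show "u \<cdot> (j \<cdot> y) = u \<cdot> h" using Comp_rewrite[OF j(2), of y] y j u by simp
      show "q \<cdot> (j \<cdot> y) = q \<cdot> h" using Comp_rewrite[OF j(3), of y] y j q h f by simp
    qed (use y j h in simp_all)
    then show "\<exists>y\<in>Hom W Y. j \<cdot> y = h" using y by blast
  qed
  moreover have "is_epi q" by (rule pullback_epi[OF pb p f u q]) (use s in simp)
  ultimately have "ses Y P X' j q" using j q by (intro ses_of_epi)
  then show ?thesis using that pb u j pu by blast
qed

lemma ses_push:
  assumes "ses Y Z X i p" "g \<in> Hom Y Y'"
  obtains P u j q where "ses Y' P X j q" "u \<in> Hom Z P" "u \<cdot> i = j \<cdot> g" "q \<cdot> u = p" "is_pushout i g u j"
  by (rule abelian_category.ses_pull[OF abelian_op_cat, of X Z Y p i g Y']) (use assms that in simp_all, blast?)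

lemma ses_pull_iso:
  assumes S: "ses Y Z X i p" and f: "f \<in> Hom X' X"
    and S1: "ses Y Z1 X' i1 p1" "u1 \<in> Hom Z1 Z" "u1 \<cdot> i1 = i" "p \<cdot> u1 = f \<cdot> p1"
    and S2: "ses Y Z2 X' i2 p2" "u2 \<in> Hom Z2 Z" "u2 \<cdot> i2 = i" "p \<cdot> u2 = f \<cdot> p2"
    and pb: "is_pullback p f u2 p2"
  obtains w where "w \<in> Hom Z1 Z2" "w \<cdot> i1 = i2" "p2 \<cdot> w = p1" "u2 \<cdot> w = u1"
proof -
  note s = ses_Hom[OF S] ses_Hom[OF S1(1)] ses_Hom[OF S2(1)]
  have p: "p \<in> Hom Z X" and q: "p2 \<in> Hom Z2 X'" using s by simp_all
  obtain w where w: "w \<in> Hom Z1 Z2" "u2 \<cdot> w = u1" "p2 \<cdot> w = p1"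
    by (rule pullback_lift[OF pb p f q, of u1 Z1 p1]) (use s S1 in simp_all, blast?)
  have "w \<cdot> i1 = i2"
  proof (rule pullback_eqI[OF pb p f q])
    show "u2 \<cdot> (w \<cdot> i1) = u2 \<cdot> i2" using Comp_rewrite[OF w(2), of i1] w(1) S1 S2 s by simp
    show "p2 \<cdot> (w \<cdot> i1) = p2 \<cdot> i2" using Comp_rewrite[OF w(3), of i1] w(1) s by simp
  qed (use w s in simp_all)
  then show ?thesis using that w by blast
qed

text \<open>Compare with a genuine pull-back sequence: its universal property yields a morphism
  between the middle objects, which is an isomorphism by the short five lemma, and the universal
  property is carried across it. Consequently any morphism of short exact sequences that is the
  identity on the left serves as a pull-back square.\<close>

lemma ses_pull_is_pullback:
  assumes S: "ses Y Z X i p" and f: "f \<in> Hom X' X"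
    and S1: "ses Y Z1 X' i1 p1" "u1 \<in> Hom Z1 Z" "u1 \<cdot> i1 = i" "p \<cdot> u1 = f \<cdot> p1"
  shows "is_pullback p f u1 p1"
proof -
  obtain P u j q where P: "ses Y P X' j q" "u \<in> Hom P Z" "u \<cdot> j = i" "p \<cdot> u = f \<cdot> q"
    and pb: "is_pullback p f u q" using ses_pull[OF S f] .
  obtain w where w: "w \<in> Hom Z1 P" "w \<cdot> i1 = j" "q \<cdot> w = p1" "u \<cdot> w = u1"
    using ses_pull_iso[OF S f S1 P pb] .
  obtain v where v: "v \<in> Hom P Z1" "v \<cdot> j = i1" "p1 \<cdot> v = q" "v \<cdot> w = Ide A Z1" "w \<cdot> v = Ide A P"
    using ses_middle_inverse[OF S1(1) P(1) w(1-3)] .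
  note s = ses_Hom[OF S] ses_Hom[OF S1(1)] ses_Hom[OF P(1)]
  have p: "p \<in> Hom Z X" and q: "q \<in> Hom P X'" using s by simp_all
  have uv: "u1 \<cdot> v = u" using Comp_rewrite[OF w(4), of v] w(1) v(1,5) P(2) by simp
  show ?thesis
  proof (rule is_pullbackI[OF p f S1(2) _ S1(4)])
    show "p1 \<in> Hom Z1 X'" using s by simp
  next
    fix W a b assume ab: "a \<in> Hom W Z" "b \<in> Hom W X'" "p \<cdot> a = f \<cdot> b"
    obtain t where t: "t \<in> Hom W P" "u \<cdot> t = a" "q \<cdot> t = b"
      by (rule pullback_lift[OF pb p f q ab])
    have "u1 \<cdot> (v \<cdot> t) = a" "p1 \<cdot> (v \<cdot> t) = b"
      using Comp_rewrite[OF uv, of t] Comp_rewrite[OF v(3), of t] t v(1) S1(2) s by simp_all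
    then show "\<exists>t\<in>Hom W Z1. u1 \<cdot> t = a \<and> p1 \<cdot> t = b" using t v(1) by (intro bexI[of _ "v \<cdot> t"]) simp_all
  next
    fix W a b assume ab: "a \<in> Hom W Z1" "b \<in> Hom W Z1" "u1 \<cdot> a = u1 \<cdot> b" "p1 \<cdot> a = p1 \<cdot> b"
    have "w \<cdot> a = w \<cdot> b"
    proof (rule pullback_eqI[OF pb p f q, where W=W])
      show "u \<cdot> (w \<cdot> a) = u \<cdot> (w \<cdot> b)"
        using Comp_rewrite[OF w(4), of a] Comp_rewrite[OF w(4), of b] w(1) P(2) ab by simp
      show "q \<cdot> (w \<cdot> a) = q \<cdot> (w \<cdot> b)"
        using Comp_rewrite[OF w(3), of a] Comp_rewrite[OF w(3), of b] w(1) ab s by simp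
    qed (use w(1) ab in simp_all)
    then have "v \<cdot> (w \<cdot> a) = v \<cdot> (w \<cdot> b)" by simp
    then show "a = b"
      using Comp_rewrite[OF v(4), of a] Comp_rewrite[OF v(4), of b] w(1) v(1) ab by simp
  qed
qed

lemma ses_push_is_pushout:
  assumes "ses Y Z X i p" "g \<in> Hom Y Y'"
    "ses Y' Z1 X i1 p1" "u1 \<in> Hom Z Z1" "p1 \<cdot> u1 = p" "u1 \<cdot> i = i1 \<cdot> g"
  shows "is_pushout i g u1 i1"
  using abelian_category.ses_pull_is_pullback[OF abelian_op_cat, of X Z Y p i g Y' Z1 p1 i1 u1] assms
  by simp

lemma ses_pull_unique:
  assumes S: "ses Y Z X i p" and f: "f \<in> Hom X' X"
    and S1: "ses Y Z1 X' i1 p1" "u1 \<in> Hom Z1 Z" "u1 \<cdot> i1 = i" "p \<cdot> u1 = f \<cdot> p1"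
    and S2: "ses Y Z2 X' i2 p2" "u2 \<in> Hom Z2 Z" "u2 \<cdot> i2 = i" "p \<cdot> u2 = f \<cdot> p2"
  obtains w where "w \<in> Hom Z1 Z2" "w \<cdot> i1 = i2" "p2 \<cdot> w = p1" "u2 \<cdot> w = u1"
  using ses_pull_iso[OF S f S1 S2 ses_pull_is_pullback[OF S f S2]] .

lemma ses_push_unique:
  assumes "ses Y Z X i p" "g \<in> Hom Y Y'"
    "ses Y' Z1 X i1 p1" "u1 \<in> Hom Z Z1" "p1 \<cdot> u1 = p" "u1 \<cdot> i = i1 \<cdot> g"
    "ses Y' Z2 X i2 p2" "u2 \<in> Hom Z Z2" "p2 \<cdot> u2 = p" "u2 \<cdot> i = i2 \<cdot> g"
  obtains w where "w \<in> Hom Z1 Z2" "w \<cdot> i1 = i2" "p2 \<cdot> w = p1"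
  by (rule abelian_category.ses_pull_unique[OF abelian_op_cat, of X Z Y p i g Y' Z2 p2 i2 u2 Z1 p1 i1 u1])
    (use assms that in simp_all, blast?)

text \<open>A self-dual form of exactness, so that it can be transferred to the opposite category.\<close>

lemma exact_at_iff:
  "exact_at f g \<longleftrightarrow> f \<in> Mor A \<and> g \<in> Mor A \<and> Cod A f = Dom A g \<and> g \<cdot> f = Zero A (Dom A f) (Cod A g) \<and>
    (\<exists>c k. is_cokernel f c \<and> is_kernel g k \<and> c \<cdot> k = Zero A (Dom A k) (Cod A c))"
  (is "_ \<longleftrightarrow> ?R")
proof
  assume "exact_at f g"
  then obtain c k where fg: "f \<in> Mor A" "g \<in> Mor A" "Cod A f = Dom A g"
    and c: "is_cokernel f c" and k: "is_kernel c k" "is_kernel g k" unfolding exact_at_def by blast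
  have c': "c \<in> Mor A" "Dom A c = Dom A g" "c \<cdot> f = Zero A (Dom A f) (Cod A c)"
    using is_cokernel_Mor[OF c] is_cokernel_Comp[OF c] fg by simp_all
  have k': "k \<in> Mor A" "Cod A k = Dom A g" "g \<cdot> k = Zero A (Dom A k) (Cod A g)"
    using is_kernel_Mor[OF k(2)] is_kernel_Comp[OF k(2)] by simp_all
  obtain u where u: "u \<in> Hom (Dom A f) (Dom A k)" "k \<cdot> u = f"
    by (rule is_kernel_lift[OF k(1), of "Dom A k" "Dom A g" "Cod A c" f "Dom A f"]) (use c' k' fg in simp_all, blast?)
  have "g \<cdot> f = Zero A (Dom A f) (Cod A g)" using Comp_rewrite[OF k'(3), of u] u k' fg by simp
  then show ?R using fg c k is_kernel_Comp[OF k(1)] by blast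
next
  assume ?R
  then obtain c k where fg: "f \<in> Mor A" "g \<in> Mor A" "Cod A f = Dom A g" "g \<cdot> f = Zero A (Dom A f) (Cod A g)"
    and c: "is_cokernel f c" and k: "is_kernel g k" and ck: "c \<cdot> k = Zero A (Dom A k) (Cod A c)" by blast
  have c': "c \<in> Mor A" "Dom A c = Dom A g" using is_cokernel_Mor[OF c] fg by simp_all
  have k': "k \<in> Mor A" "Cod A k = Dom A g" using is_kernel_Mor[OF k] by simp_all
  obtain t where t: "t \<in> Hom (Cod A c) (Cod A g)" "t \<cdot> c = g"
    by (rule is_cokernel_lift[OF c, of "Dom A g" "Cod A c" "Dom A f" g "Cod A g"]) (use c' fg in simp_all, blast?)
  have "is_kernel c k"
  proof (rule is_kernelI[OF is_kernel_mono[OF k] _ _ ck])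
    fix W h assume h: "h \<in> Hom W (Dom A g)" "c \<cdot> h = Zero A W (Cod A c)"
    have "t \<cdot> (c \<cdot> h) = g \<cdot> h" by (rule Comp_rewrite[OF t(2)]) (use h(1) t(1) c' in simp_all)
    then have gh: "g \<cdot> h = Zero A W (Cod A g)" using t(1) h by simp
    show "\<exists>u\<in>Hom W (Dom A k). k \<cdot> u = h"
      by (rule is_kernel_lift[OF k _ _ h(1) gh, of "Dom A k"]) (use k' fg in auto)
  qed (use c' k' fg in simp_all)
  then show "exact_at f g" unfolding exact_at_def using fg c k by blast
qed

lemma op_cat_exact_at [simp]: "cat.exact_at (op_cat A) f g = exact_at g f"
  unfolding exact_at_iff abelian_category.exact_at_iff[OF abelian_op_cat] by auto

text \<open>The splicing step for resolutions: since \<open>e\<close> is epi, the cokernel of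
  \<open>m \<cdot> e\<close> already kills \<open>m\<close>.\<close>

lemma exact_at_epi_mono:
  assumes "is_epi e" "e \<in> Hom X K" "is_kernel g m" "m \<in> Hom K Y" "g \<in> Hom Y Z"
  shows "exact_at (m \<cdot> e) g"
proof -
  have mm: "g \<cdot> m = Zero A K Z" using is_kernel_Comp[OF assms(3)] assms(4,5) by simp
  then have 0: "g \<cdot> (m \<cdot> e) = Zero A X Z" using Comp_rewrite[OF mm, of e] assms by simp
  obtain c where c: "is_cokernel (m \<cdot> e) c" using cokernel_exists[of "m \<cdot> e"] assms by auto
  have c': "c \<in> Mor A" "Dom A c = Y" "c \<cdot> (m \<cdot> e) = Zero A X (Cod A c)"
    using is_cokernel_Mor[OF c] is_cokernel_Comp[OF c] assms by simp_all
  then have "c \<cdot> m = Zero A K (Cod A c)"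
    using is_epi_iff[OF assms(2)] assms(1,2,4) by simp
  then show ?thesis unfolding exact_at_iff using 0 c assms by auto
qed

text \<open>Let \<open>h \<cdot> e = 0\<close> and let \<open>m\<close> be the kernel of
  \<open>h\<close>, so that \<open>f\<close> factors through the mono \<open>k \<cdot> m\<close>.
  Its cokernel \<open>c2\<close> kills \<open>f\<close>, hence factors through the cokernel
  \<open>c\<close> of \<open>f\<close>, and by exactness kills \<open>k\<close>. As
  \<open>k \<cdot> m\<close> is the kernel of \<open>c2\<close>, \<open>k\<close> factors through
  it; cancelling \<open>k\<close> shows that \<open>m\<close> has a right inverse, so
  \<open>h = 0\<close>.\<close>

lemma exact_at_epi_factor:
  assumes "exact_at f g" "is_kernel g k" "f \<in> Hom X Y" "e \<in> Hom X K" "k \<in> Hom K Y" "k \<cdot> e = f"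
  shows "is_epi e"
proof (subst is_epi_iff[OF assms(4)], intro allI ballI impI)
  obtain c k0 where c: "is_cokernel f c" and k0: "is_kernel g k0" and "c \<cdot> k0 = Zero A (Dom A k0) (Cod A c)"
    and g: "g \<in> Mor A" "Cod A f = Dom A g"
    using assms(1) unfolding exact_at_iff by blast
  have c': "c \<in> Mor A" "Dom A c = Y" "c \<cdot> f = Zero A X (Cod A c)"
    using is_cokernel_Mor[OF c] is_cokernel_Comp[OF c] assms(3) by simp_all
  have k0': "k0 \<in> Mor A" "Cod A k0 = Y" using is_kernel_Mor[OF k0] g assms(3) by simp_all
  obtain u where u: "u \<in> Hom K (Dom A k0)" "k0 \<cdot> u = k"
    by (rule is_kernel_lift[OF k0, of "Dom A k0" Y "Cod A g" k K])
      (use assms(3,5) is_kernel_Comp[OF assms(2)] k0' g in simp_all, blast?)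
  have ck: "c \<cdot> k = Zero A K (Cod A c)"
    using Comp_rewrite[OF \<open>c \<cdot> k0 = _\<close>, of u] u c' k0' by simp
  fix W h assume h: "h \<in> Hom K W" "h \<cdot> e = Zero A X W"
  obtain m where m: "is_kernel h m" using kernel_exists[of h] h by auto
  define M where "M = Dom A m"
  have m': "m \<in> Hom M K" "h \<cdot> m = Zero A M W"
    using is_kernel_Mor[OF m] is_kernel_Comp[OF m] h by (simp_all add: M_def)
  obtain e' where e': "e' \<in> Hom X M" "m \<cdot> e' = e"
    by (rule is_kernel_lift[OF m m'(1) h(1), of e X]) (use assms h in simp_all, blast?)
  have km: "is_mono (k \<cdot> m)"
    using is_mono_comp[OF is_kernel_mono[OF m] is_kernel_mono[OF assms(2)] m'(1) assms(5)] .
  obtain c2 where c2: "is_cokernel (k \<cdot> m) c2" using cokernel_exists[of "k \<cdot> m"] m' assms(5) by auto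
  have c2': "c2 \<in> Hom Y (Cod A c2)" "c2 \<cdot> (k \<cdot> m) = Zero A M (Cod A c2)"
    using is_cokernel_Mor[OF c2] is_cokernel_Comp[OF c2] m' assms(5) by simp_all
  have "c2 \<cdot> f = (c2 \<cdot> (k \<cdot> m)) \<cdot> e'" using c2'(1) m' assms(5,6) e' by simp
  then have "c2 \<cdot> f = Zero A X (Cod A c2)" using c2' e' by simp
  then obtain t where t: "t \<in> Hom (Cod A c) (Cod A c2)" "t \<cdot> c = c2"
    by (rule is_cokernel_lift[OF c, of Y "Cod A c", rotated 3]) (use c' c2' assms(3) in simp_all, blast?)
  have "c2 \<cdot> k = Zero A K (Cod A c2)" using Comp_rewrite[OF t(2), of k] ck t(1) c' assms(5) by simp
  then obtain s where s: "s \<in> Hom K M" "(k \<cdot> m) \<cdot> s = k"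
    by (rule is_kernel_lift[OF mono_is_kernel_of_cokernel[OF km c2], of M Y "Cod A c2" k K, rotated 3])
      (use m' assms(5) c2' in simp_all, blast?)
  have "m \<cdot> s = Ide A K"
    by (rule is_mono_cancel[OF is_kernel_mono[OF assms(2)] assms(5), of _ K]) (use m' s assms(5) in simp_all)
  then have "h \<cdot> (m \<cdot> s) = h" using h by simp
  then show "h = Zero A K W" using Comp_rewrite[OF m'(2), of s] m' s h by simp
qed

lemma exact_at_Zero_left:
  assumes "Z \<in> Ob A" "i \<in> Hom Y M"
  shows "exact_at (Zero A Z Y) i \<longleftrightarrow> is_mono i"
proof
  assume "exact_at (Zero A Z Y) i"
  then obtain c k where c: "is_cokernel (Zero A Z Y) c" and k: "is_kernel i k"
    and ck: "c \<cdot> k = Zero A (Dom A k) (Cod A c)" unfolding exact_at_iff by blast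
  have Y: "Y \<in> Ob A" using assms by simp
  have c': "c \<in> Hom Y (Cod A c)" using is_cokernel_Mor[OF c] assms by simp
  have k': "k \<in> Hom (Dom A k) Y" using is_kernel_Mor[OF k] assms by simp
  \<comment> \<open>The composite of the identity of \<open>Y\<close> with the zero morphism
    vanishes, so the identity factors through the cokernel \<open>c\<close>. Thus \<open>c\<close>
    is a split mono, and \<open>c \<cdot> k = 0\<close> forces \<open>k = 0\<close>.\<close>
  obtain t where t: "t \<in> Hom (Cod A c) Y" "t \<cdot> c = Ide A Y"
    by (rule is_cokernel_lift[OF c c', of Z "Ide A Y" Y]) (use assms Y in simp_all, blast?)
  have k0: "k = Zero A (Dom A k) Y" using Comp_rewrite[OF t(2), of k] ck t(1) c' k' by simp
  show "is_mono i"
  proof (subst is_mono_iff[OF assms(2)], intro allI ballI impI)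
    fix W h assume h: "h \<in> Hom W Y" "i \<cdot> h = Zero A W M"
    obtain u where u: "u \<in> Hom W (Dom A k)" "k \<cdot> u = h"
      using is_kernel_lift[OF k k' assms(2) h] .
    have "Zero A (Dom A k) Y \<cdot> u = h" using u(2) k0 by simp
    then show "h = Zero A W Y" using u(1) Y by simp
  qed
next
  assume m: "is_mono i"
  have Y: "Y \<in> Ob A" using assms by simp
  obtain c where c: "is_cokernel (Zero A Z Y) c" using cokernel_exists[of "Zero A Z Y"] assms Y by auto
  obtain k where k: "is_kernel i k" using kernel_exists[of i] assms by auto
  have k': "k \<in> Hom (Dom A k) Y" "i \<cdot> k = Zero A (Dom A k) M"
    using is_kernel_Mor[OF k] is_kernel_Comp[OF k] assms by simp_all
  then have "k = Zero A (Dom A k) Y" using is_mono_iff[OF assms(2)] m by blast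
  then have "c \<cdot> k = c \<cdot> Zero A (Dom A k) Y" by simp
  then have "c \<cdot> k = Zero A (Dom A k) (Cod A c)" using is_cokernel_Mor[OF c] assms Y k' by simp
  then show "exact_at (Zero A Z Y) i" unfolding exact_at_iff using c k assms Y by auto
qed

lemma exact_at_Zero_right:
  "\<lbrakk>Z \<in> Ob A; p \<in> Hom M X\<rbrakk> \<Longrightarrow> exact_at p (Zero A X Z) \<longleftrightarrow> is_epi p"
  using abelian_category.exact_at_Zero_left[OF abelian_op_cat, of Z p X M] by simp

text \<open>Exactness at the ends says that \<open>i\<close> is mono and \<open>p\<close> is epi. In
  the middle it says that the cokernel of \<open>i\<close> kills the kernel of \<open>p\<close>; as
  a mono is the kernel of its cokernel, \<open>i\<close> is then a kernel of \<open>p\<close>. This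
  replaces the images in the definition by two universal properties.\<close>

lemma short_exact_iff: "short_exact i p \<longleftrightarrow> ses (Dom A i) (Cod A i) (Cod A p) i p"
proof
  assume "short_exact i p"
  then obtain Z where Z: "Z \<in> Ob A" and l: "exact_at (Zero A Z (Dom A i)) i"
    and e: "exact_at i p" and r: "exact_at p (Zero A (Cod A p) Z)"
    unfolding short_exact_def is_zero_object_def by blast
  obtain c k where ip: "i \<in> Mor A" "p \<in> Mor A" "Cod A i = Dom A p" "p \<cdot> i = Zero A (Dom A i) (Cod A p)"
    and c: "is_cokernel i c" and k: "is_kernel p k" and ck: "c \<cdot> k = Zero A (Dom A k) (Cod A c)"
    using e unfolding exact_at_iff by blast
  have m: "is_mono i" using exact_at_Zero_left[of Z i "Dom A i" "Cod A i"] Z l ip by simp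
  have ep: "is_epi p" using exact_at_Zero_right[of Z p "Dom A p" "Cod A p"] Z r ip by simp
  have ker: "is_kernel c i" using mono_is_kernel_of_cokernel[OF m c] .
  have cM: "c \<in> Hom (Dom A p) (Cod A c)" "k \<in> Hom (Dom A k) (Dom A p)"
    using is_cokernel_Mor[OF c] is_kernel_Mor[OF k] ip by simp_all
  have "is_kernel p i"
  proof (rule is_kernelI[OF m _ _ ip(4)])
    fix W h assume h: "h \<in> Hom W (Dom A p)" "p \<cdot> h = Zero A W (Cod A p)"
    obtain u where u: "u \<in> Hom W (Dom A k)" "k \<cdot> u = h"
      by (rule is_kernel_lift[OF k cM(2) _ h]) (use ip in simp, blast?)
    have ch: "c \<cdot> h = Zero A W (Cod A c)" using Comp_rewrite[OF ck, of u] u cM by simp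
    show "\<exists>u\<in>Hom W (Dom A i). i \<cdot> u = h"
      by (rule is_kernel_lift[OF ker _ cM(1) h(1) ch, of "Dom A i"]) (use ip in auto)
  qed (use ip in simp_all)
  then show "ses (Dom A i) (Cod A i) (Cod A p) i p" using ep ip by (intro ses_of_epi) simp_all
next
  assume S: "ses (Dom A i) (Cod A i) (Cod A p) i p"
  note s = ses_Hom[OF S]
  obtain Z where Z: "is_zero_object Z" using zero_object_exists by blast
  then have ZO: "Z \<in> Ob A" unfolding is_zero_object_def by blast
  have "exact_at i p" unfolding exact_at_iff using s by auto
  then show "short_exact i p" unfolding short_exact_def
    using Z exact_at_Zero_left[OF ZO, of i "Dom A i" "Cod A i"]
      exact_at_Zero_right[OF ZO, of p "Cod A i" "Cod A p"] s by auto
qed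

lemma short_exactE:
  assumes "short_exact i p"
  obtains Y Z X where "ses Y Z X i p"
  using assms short_exact_iff by blast

lemma ses_short_exact: "ses Y Z X i p \<Longrightarrow> short_exact i p"
  unfolding short_exact_iff using ses_Hom[of Y Z X i p] by simp

lemma kernel_cokernel_pair_iff: "kernel_cokernel_pair i p \<longleftrightarrow> short_exact i p"
proof
  assume k: "kernel_cokernel_pair i p"
  then have "ses (Dom A i) (Cod A i) (Cod A p) i p"
    using is_kernel_Mor[of p i] unfolding ses_def kernel_cokernel_pair_def by simp
  then show "short_exact i p" by (simp add: short_exact_iff)
qed (simp add: short_exact_iff ses_def kernel_cokernel_pair_def)

lemma op_cat_short_exact [simp]: "cat.short_exact (op_cat A) i p = short_exact p i"
proof -
  have "Dom A i = Cod A p" if "ses Y Z X p i" for Y Z X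
    using ses_Hom[OF that] by simp
  then show ?thesis
    unfolding short_exact_iff abelian_category.short_exact_iff[OF abelian_op_cat]
      op_cat_ses op_cat_simps by metis
qed

end

section \<open>Balanced pairs and exact structures\<close>

context cat
begin

text \<open>For a short exact sequence the functor \<open>Hom(C, -)\<close> is left exact anyway, so
  this surjectivity is all of its exactness.\<close>

definition lifts :: "'o set \<Rightarrow> 'm \<Rightarrow> bool" where
  "lifts S p \<longleftrightarrow> (\<forall>C\<in>S. \<forall>f\<in>Hom C (Cod A p). \<exists>g\<in>Hom C (Dom A p). p \<cdot> g = f)"

definition extends :: "'o set \<Rightarrow> 'm \<Rightarrow> bool" where
  "extends S i \<longleftrightarrow> (\<forall>D\<in>S. \<forall>f\<in>Hom (Dom A i) D. \<exists>g\<in>Hom (Cod A i) D. g \<cdot> i = f)"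

definition lift_seqs :: "'o set \<Rightarrow> ('m \<times> 'm) set" where
  "lift_seqs S = {(i, p). short_exact i p \<and> lifts S p}"

definition extend_seqs :: "'o set \<Rightarrow> ('m \<times> 'm) set" where
  "extend_seqs S = {(i, p). short_exact i p \<and> extends S i}"

text \<open>The part of the resolutions of a balanced pair that the proof uses, and from which the whole
  resolutions can be spliced together again.\<close>

definition covers :: "'o set \<Rightarrow> 'o set \<Rightarrow> bool" where
  "covers C D \<longleftrightarrow> (\<forall>M\<in>Ob A. \<exists>i p. short_exact i p \<and> Cod A p = M \<and> Dom A p \<in> C \<and> lifts C p \<and> extends D i)"

definition cocovers :: "'o set \<Rightarrow> 'o set \<Rightarrow> bool" where
  "cocovers C D \<longleftrightarrow> (\<forall>M\<in>Ob A. \<exists>i p. short_exact i p \<and> Dom A i = M \<and> Cod A i \<in> D \<and> lifts C p \<and> extends D i)"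

end

lemma op_cat_lifts [simp]:
  "cat.lifts (op_cat A) = cat.extends A" "cat.extends (op_cat A) = cat.lifts A"
  by (auto simp: fun_eq_iff cat.lifts_def cat.extends_def)

section \<open>Lifting and extension along short exact sequences\<close>

context abelian_category
begin

text \<open>A class of sequences is a relation between the first and the second morphism; reversing
  arrows exchanges them, so duality acts on such classes as relational converse.\<close>

lemma op_cat_seqs [simp]:
  "cat.lift_seqs (op_cat A) S = (extend_seqs S)\<inverse>" "cat.extend_seqs (op_cat A) S = (lift_seqs S)\<inverse>"
  by (auto simp: cat.lift_seqs_def cat.extend_seqs_def)

lemma op_cat_covers [simp]:
  "cat.covers (op_cat A) D C = cocovers C D" "cat.cocovers (op_cat A) D C = covers C D"
  unfolding cat.covers_def cat.cocovers_def by (simp_all; blast)+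

lemma lifts_iff: "p \<in> Hom Z X \<Longrightarrow> lifts S p \<longleftrightarrow> (\<forall>C\<in>S. \<forall>f\<in>Hom C X. \<exists>g\<in>Hom C Z. p \<cdot> g = f)"
  unfolding lifts_def by simp

lemma lifts_ses: "ses Y Z X i p \<Longrightarrow> lifts S p \<longleftrightarrow> (\<forall>C\<in>S. \<forall>f\<in>Hom C X. \<exists>g\<in>Hom C Z. p \<cdot> g = f)"
  using ses_Hom[of Y Z X i p] unfolding lifts_def by simp

lemma extends_ses: "ses Y Z X i p \<Longrightarrow> extends S i \<longleftrightarrow> (\<forall>D\<in>S. \<forall>f\<in>Hom Y D. \<exists>g\<in>Hom Z D. g \<cdot> i = f)"
  using ses_Hom[of Y Z X i p] unfolding extends_def by simp

lemma liftsE: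
  assumes "lifts S p" "p \<in> Hom Z X" "C \<in> S" "f \<in> Hom C X"
  obtains g where "g \<in> Hom C Z" "p \<cdot> g = f"
proof -
  have "\<forall>f\<in>Hom C (Cod A p). \<exists>g\<in>Hom C (Dom A p). p \<cdot> g = f"
    using assms(1,3) unfolding lifts_def by blast
  then have "\<exists>g\<in>Hom C Z. p \<cdot> g = f" using assms(2,4) by simp
  then show ?thesis using that by blast
qed

lemma extendsE:
  assumes "extends S i" "i \<in> Hom Y Z" "D \<in> S" "f \<in> Hom Y D"
  obtains g where "g \<in> Hom Z D" "g \<cdot> i = f"
  by (rule abelian_category.liftsE[OF abelian_op_cat, of S i Z Y D f]) (use assms that in simp_all, blast?)

lemma pushout_lift:
  assumes "is_pushout i g u j" "i \<in> Hom Y Z" "g \<in> Hom Y Y'" "j \<in> Hom Y' P"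
    "a \<in> Hom Z W" "b \<in> Hom Y' W" "a \<cdot> i = b \<cdot> g"
  obtains w where "w \<in> Hom P W" "w \<cdot> u = a" "w \<cdot> j = b"
  by (rule abelian_category.pullback_lift[OF abelian_op_cat, of i g u j Z Y Y' P a W b])
    (use assms that in simp_all, blast?)

lemma pushout_eqI:
  assumes "is_pushout i g u j" "i \<in> Hom Y Z" "g \<in> Hom Y Y'" "j \<in> Hom Y' P"
    "a \<in> Hom P W" "b \<in> Hom P W" "a \<cdot> u = b \<cdot> u" "a \<cdot> j = b \<cdot> j"
  shows "a = b"
  using abelian_category.pullback_eqI[OF abelian_op_cat, of i g u j Z Y Y' P a W b] assms by simp

text \<open>Comparing with a sequence whose middle object has the lifting property exhibits any liftable
  sequence as a push-out of it.\<close>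

lemma lifts_pushout:
  assumes S: "ses Y Z X i p" and T: "ses K P X k e" and l: "lifts C p" and P: "P \<in> C"
  obtains h g where "h \<in> Hom P Z" "p \<cdot> h = e" "g \<in> Hom K Y" "h \<cdot> k = i \<cdot> g" "is_pushout k g h i"
proof -
  note s = ses_Hom[OF S] and t = ses_Hom[OF T]
  obtain h where h: "h \<in> Hom P Z" "p \<cdot> h = e"
    by (rule liftsE[OF l _ P, of Z X e]) (use s t in simp_all, blast?)
  obtain g where g: "g \<in> Hom K Y" "i \<cdot> g = h \<cdot> k"
    by (rule ses_lift[OF S, of "h \<cdot> k" K]) (use s t h Comp_rewrite[OF h(2), of k] in simp_all, blast?)
  have "is_pushout k g h i"
    by (rule ses_push_is_pushout[OF T g(1) S h]) (use g in simp)
  then show ?thesis using that[OF h g(1)] g(2) by simp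
qed

lemma extends_of_lifts:
  assumes cov: "covers C D" and S: "short_exact i p" and l: "lifts C p"
  shows "extends D i"
proof -
  obtain Y Z X where S: "ses Y Z X i p" using short_exactE[OF S] .
  note s = ses_Hom[OF S]
  obtain k e where "short_exact k e" "Cod A e = X" and P: "Dom A e \<in> C" and k: "extends D k"
    using cov s(7) unfolding covers_def by blast
  then obtain K P where T: "ses K P X k e" using short_exact_iff ses_Hom(2,4) by metis
  note t = ses_Hom[OF T]
  have PC: "P \<in> C" using P t by simp
  obtain h g where h: "h \<in> Hom P Z" "p \<cdot> h = e" and g: "g \<in> Hom K Y" "h \<cdot> k = i \<cdot> g"
    and po: "is_pushout k g h i" using lifts_pushout[OF S T l PC] .
  show ?thesis
    unfolding extends_ses[OF S]
  proof (intro ballI)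
    fix T f assume T: "T \<in> D" and f: "f \<in> Hom Y T"
    \<comment> \<open>The push-out square turns the problem of extending \<open>f\<close> along
      \<open>i\<close> into that of extending \<open>f \<cdot> g\<close> along \<open>k\<close>,
      which is solvable by the choice of the covering sequence.\<close>
    obtain v where v: "v \<in> Hom P T" "v \<cdot> k = f \<cdot> g"
      by (rule extendsE[OF k _ T, of K P "f \<cdot> g"]) (use t f g in simp_all, blast?)
    obtain w where "w \<in> Hom Z T" "w \<cdot> h = v" "w \<cdot> i = f"
      by (rule pushout_lift[OF po _ g(1) _ v(1) f v(2), where P=Z]) (use t s in simp_all, blast?)
    then show "\<exists>w\<in>Hom Z T. w \<cdot> i = f" by blast
  qed
qed

lemma lifts_of_extends:
  "\<lbrakk>cocovers C D; short_exact i p; extends D i\<rbrakk> \<Longrightarrow> lifts C p"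
  using abelian_category.extends_of_lifts[OF abelian_op_cat, of D C p i] by simp

lemma lift_seqs_eq_extend_seqs:
  "\<lbrakk>covers C D; cocovers C D\<rbrakk> \<Longrightarrow> lift_seqs C = extend_seqs D"
  unfolding lift_seqs_def extend_seqs_def using extends_of_lifts lifts_of_extends by blast

text \<open>Every epi completes to a short exact sequence by its kernel. The axioms for admissible
  epics thereby become statements about single morphisms.\<close>

lemma admissible_epic_lift_seqs: "admissible_epic (lift_seqs S) p \<longleftrightarrow> is_epi p \<and> lifts S p"
proof
  assume "admissible_epic (lift_seqs S) p"
  then show "is_epi p \<and> lifts S p"
    unfolding admissible_epic_def lift_seqs_def short_exact_iff using ses_Hom(12) by blast
next
  assume p: "is_epi p \<and> lifts S p"
  then have "p \<in> Hom (Dom A p) (Cod A p)" unfolding is_epi_def by simp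
  then obtain Y i where "ses Y (Dom A p) (Cod A p) i p" using ses_of_epi_ex p by metis
  then show "admissible_epic (lift_seqs S) p"
    unfolding admissible_epic_def lift_seqs_def using p ses_short_exact by blast
qed

lemma admissible_converse [simp]:
  "admissible_epic (E\<inverse>) = admissible_monic E"
  "admissible_monic (E\<inverse>) = admissible_epic E"
  by (auto simp: fun_eq_iff admissible_epic_def admissible_monic_def)

lemma admissible_monic_extend_seqs: "admissible_monic (extend_seqs S) i \<longleftrightarrow> is_mono i \<and> extends S i"
  using abelian_category.admissible_epic_lift_seqs[OF abelian_op_cat, of S i] by simp

section \<open>The axioms of an exact structure for liftable and extendable sequences\<close>

lemma lifts_Ide: "X \<in> Ob A \<Longrightarrow> lifts S (Ide A X)"
  unfolding lifts_def by auto

lemma lifts_Comp: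
  assumes "p \<in> Hom X Y" "q \<in> Hom Y Z" "lifts S p" "lifts S q"
  shows "lifts S (q \<cdot> p)"
  unfolding lifts_def
proof (intro ballI)
  fix C f assume C: "C \<in> S" and f: "f \<in> Hom C (Cod A (q \<cdot> p))"
  obtain g where g: "g \<in> Hom C Y" "q \<cdot> g = f"
    by (rule liftsE[OF assms(4,2) C, of f]) (use f assms(1,2) in simp_all, blast?)
  obtain h where "h \<in> Hom C X" "p \<cdot> h = g" using liftsE[OF assms(3,1) C g(1)] .
  then show "\<exists>h\<in>Hom C (Dom A (q \<cdot> p)). (q \<cdot> p) \<cdot> h = f"
    using g assms(1,2) by (intro bexI[of _ h]) simp_all
qed

lemma is_epi_Ide: "X \<in> Ob A \<Longrightarrow> is_epi (Ide A X)"
  by (subst is_epi_iff[of _ X X]) simp_all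

lemma epi_pullback_exists:
  assumes e: "is_epi p" and l: "lifts S p" and p: "p \<in> Hom Z X" and f: "f \<in> Hom X' X"
  obtains u q where "is_pullback p f u q" "is_epi q" "lifts S q"
proof -
  obtain P u q where pb: "is_pullback p f u q" and u: "u \<in> Hom P Z" and q: "q \<in> Hom P X'"
    using pullback_exists[OF p f] .
  have "\<exists>g\<in>Hom C P. q \<cdot> g = h" if C: "C \<in> S" and h: "h \<in> Hom C X'" for C h
  proof -
    have fh: "f \<cdot> h \<in> Hom C X" using h f by simp
    obtain g where g: "g \<in> Hom C Z" "p \<cdot> g = f \<cdot> h" using liftsE[OF l p C fh] .
    obtain w where "w \<in> Hom C P" "q \<cdot> w = h" using pullback_lift[OF pb p f q g(1) h g(2)] .
    then show ?thesis by blast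
  qed
  then have "lifts S q" unfolding lifts_iff[OF q] by blast
  then show ?thesis using that pb pullback_epi[OF pb p f u q e] by blast
qed

lemma lift_seqs_epic_axioms:
  shows "X \<in> Ob A \<Longrightarrow> admissible_epic (lift_seqs S) (Ide A X)"
    and "\<lbrakk>admissible_epic (lift_seqs S) p; admissible_epic (lift_seqs S) q; Cod A p = Dom A q\<rbrakk>
      \<Longrightarrow> admissible_epic (lift_seqs S) (q \<cdot> p)"
    and "\<lbrakk>f \<in> Mor A; admissible_epic (lift_seqs S) p; Cod A f = Cod A p\<rbrakk>
      \<Longrightarrow> \<exists>u q. is_pullback p f u q \<and> admissible_epic (lift_seqs S) q"
  unfolding admissible_epic_lift_seqs
proof -
  show "X \<in> Ob A \<Longrightarrow> is_epi (Ide A X) \<and> lifts S (Ide A X)" using is_epi_Ide lifts_Ide by blast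
  assume pq: "is_epi p \<and> lifts S p" "is_epi q \<and> lifts S q" "Cod A p = Dom A q"
  then have "p \<in> Hom (Dom A p) (Dom A q)" "q \<in> Hom (Dom A q) (Cod A q)"
    unfolding is_epi_def by auto
  then show "is_epi (q \<cdot> p) \<and> lifts S (q \<cdot> p)" using pq is_epi_comp lifts_Comp by blast
next
  assume f: "f \<in> Mor A" and p: "is_epi p \<and> lifts S p" and d: "Cod A f = Cod A p"
  have "p \<in> Mor A" using p unfolding is_epi_def by blast
  then have "p \<in> Hom (Dom A p) (Cod A p)" "f \<in> Hom (Dom A f) (Cod A p)" using f d by simp_all
  then show "\<exists>u q. is_pullback p f u q \<and> is_epi q \<and> lifts S q"
    using epi_pullback_exists p by metis
qed

lemma extend_seqs_monic_axioms:
  shows "X \<in> Ob A \<Longrightarrow> admissible_monic (extend_seqs S) (Ide A X)"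
    and "\<lbrakk>admissible_monic (extend_seqs S) i; admissible_monic (extend_seqs S) j; Cod A i = Dom A j\<rbrakk>
      \<Longrightarrow> admissible_monic (extend_seqs S) (j \<cdot> i)"
    and "\<lbrakk>f \<in> Mor A; admissible_monic (extend_seqs S) i; Dom A f = Dom A i\<rbrakk>
      \<Longrightarrow> \<exists>u j. is_pushout i f u j \<and> admissible_monic (extend_seqs S) j"
  using abelian_category.lift_seqs_epic_axioms(1)[OF abelian_op_cat, of X S]
    abelian_category.lift_seqs_epic_axioms(2)[OF abelian_op_cat, of S j i]
    abelian_category.lift_seqs_epic_axioms(3)[OF abelian_op_cat, of f S i] by simp_all

lemma lift_seqs_iso_closed:
  assumes ip: "(i, p) \<in> lift_seqs S" and jq: "kernel_cokernel_pair j q"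
    and iso: "pair_isomorphic (i, p) (j, q)"
  shows "(j, q) \<in> lift_seqs S"
proof -
  obtain Y Z X where s: "ses Y Z X i p" and l: "lifts S p"
    using ip unfolding lift_seqs_def by (auto elim: short_exactE)
  have jq': "short_exact j q" using jq kernel_cokernel_pair_iff by simp
  then obtain Y' Z' X' where t: "ses Y' Z' X' j q" by (rule short_exactE)
  note st = ses_Hom[OF s] ses_Hom[OF t]
  obtain b c where b: "b \<in> Hom Z Z'" and c: "c \<in> Hom X X'" "is_iso c" and e: "c \<cdot> p = q \<cdot> b"
    using iso st unfolding pair_isomorphic_def by auto
  obtain d where d: "d \<in> Hom X' X" "c \<cdot> d = Ide A X'" using is_isoE[OF c(2,1)] by blast
  have "lifts S q" unfolding lifts_ses[OF t]
  proof (intro ballI)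
    fix C f assume C: "C \<in> S" and f: "f \<in> Hom C X'"
    \<comment> \<open>The test morphism is moved to \<open>X\<close> by the inverse \<open>d\<close>
      of \<open>c\<close>, lifted there along \<open>p\<close>, and returned to \<open>Z'\<close> by
      \<open>b\<close>.\<close>
    obtain g where g: "g \<in> Hom C Z" "p \<cdot> g = d \<cdot> f"
      by (rule liftsE[OF l _ C, of Z X "d \<cdot> f"]) (use st f d in simp_all, blast?)
    have "q \<cdot> (b \<cdot> g) = (c \<cdot> p) \<cdot> g" by (rule Comp_rewrite) (use e st b g in simp_all)
    also have "\<dots> = c \<cdot> (d \<cdot> f)" using g st c by simp
    also have "\<dots> = Ide A X' \<cdot> f" by (rule Comp_rewrite) (use d c f in simp_all)
    also have "\<dots> = f" using f by simp
    finally show "\<exists>g\<in>Hom C Z'. q \<cdot> g = f" using b g by (intro bexI[of _ "b \<cdot> g"]) simp_all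
  qed
  then show ?thesis using jq' unfolding lift_seqs_def by blast
qed

lemma lift_seqs_exact_structure:
  assumes "lift_seqs C = extend_seqs D"
  shows "exact_structure (lift_seqs C)"
  unfolding exact_structure_def
proof (intro conjI)
  show "\<forall>(i, p)\<in>lift_seqs C. kernel_cokernel_pair i p"
    unfolding lift_seqs_def kernel_cokernel_pair_iff by blast
  show "\<forall>(i, p)\<in>lift_seqs C. \<forall>j q. kernel_cokernel_pair j q \<and> pair_isomorphic (i, p) (j, q) \<longrightarrow>
      (j, q) \<in> lift_seqs C"
    using lift_seqs_iso_closed by blast
  show "\<forall>X\<in>Ob A. admissible_monic (lift_seqs C) (Ide A X) \<and> admissible_epic (lift_seqs C) (Ide A X)"
    using lift_seqs_epic_axioms(1) extend_seqs_monic_axioms(1) assms by metis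
  show "\<forall>i j. admissible_monic (lift_seqs C) i \<and> admissible_monic (lift_seqs C) j \<and> Cod A i = Dom A j \<longrightarrow>
      admissible_monic (lift_seqs C) (j \<cdot> i)"
    using extend_seqs_monic_axioms(2) assms by metis
  show "\<forall>p q. admissible_epic (lift_seqs C) p \<and> admissible_epic (lift_seqs C) q \<and> Cod A p = Dom A q \<longrightarrow>
      admissible_epic (lift_seqs C) (q \<cdot> p)"
    using lift_seqs_epic_axioms(2) by metis
  show "\<forall>i. \<forall>f\<in>Mor A. admissible_monic (lift_seqs C) i \<and> Dom A f = Dom A i \<longrightarrow>
      (\<exists>u j. is_pushout i f u j \<and> admissible_monic (lift_seqs C) j)"
    using extend_seqs_monic_axioms(3) assms by metis
  show "\<forall>p. \<forall>f\<in>Mor A. admissible_epic (lift_seqs C) p \<and> Cod A f = Cod A p \<longrightarrow>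
      (\<exists>u q. is_pullback p f u q \<and> admissible_epic (lift_seqs C) q)"
    using lift_seqs_epic_axioms(3) by metis
qed

section \<open>Projective and injective objects of a class of sequences\<close>

lemma E_projective_iff: "E_projective E P \<longleftrightarrow> P \<in> Ob A \<and> (\<forall>p. admissible_epic E p \<longrightarrow> lifts {P} p)"
  unfolding E_projective_def lifts_def by blast

lemma E_injective_iff: "E_injective E P \<longleftrightarrow> P \<in> Ob A \<and> (\<forall>p. admissible_monic E p \<longrightarrow> extends {P} p)"
  unfolding E_injective_def extends_def by blast

lemma lifts_Collect: "lifts (Collect (E_projective E)) p" if "admissible_epic E p"
  using that unfolding E_projective_iff lifts_def by blast

lemma extends_Collect: "extends (Collect (E_injective E)) i" if "admissible_monic E i"
  using that unfolding E_injective_iff extends_def by blast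

lemma op_cat_E_projective [simp]:
  "cat.E_projective (op_cat A) (E\<inverse>) = E_injective E"
  "cat.E_injective (op_cat A) (E\<inverse>) = E_projective E"
  by (auto simp: fun_eq_iff E_projective_iff E_injective_iff
    abelian_category.E_projective_iff[OF abelian_op_cat] abelian_category.E_injective_iff[OF abelian_op_cat])

lemma ses_split_biproduct:
  assumes S: "ses Y Z X i p" and t: "t \<in> Hom X Z" "p \<cdot> t = Ide A X"
  obtains r where "is_biproduct Y X Z i t r p"
proof -
  note s = ses_Hom[OF S]
  have pt: "p \<cdot> (t \<cdot> p) = p" using Comp_rewrite[OF t(2), of p] s t(1) by simp
  \<comment> \<open>The endomorphism \<open>1 - t \<cdot> p\<close> is killed by \<open>p\<close>,
    so it factors through \<open>i\<close>; the factor is the missing projection to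
    \<open>Y\<close>.\<close>
  obtain r where r: "r \<in> Hom Z Y" "i \<cdot> r = Ide A Z \<boxplus> neg (t \<cdot> p)"
    by (rule ses_lift[OF S, of "Ide A Z \<boxplus> neg (t \<cdot> p)" Z]) (use s t(1) pt in simp_all, blast?)
  have i: "i \<in> Hom Y Z" using s by simp
  have "i \<cdot> (r \<cdot> i) = i \<cdot> Ide A Y" using Comp_rewrite[OF r(2), of i] r(1) s t(1) by simp
  then have ri: "r \<cdot> i = Ide A Y"
    by (rule is_mono_cancel[OF s(11) i, rotated 2]) (use r(1) s in simp_all)
  have "i \<cdot> (r \<cdot> t) = i \<cdot> Zero A X Y" using Comp_rewrite[OF r(2), of t] r(1) s t by simp
  then have rt: "r \<cdot> t = Zero A X Y"
    by (rule is_mono_cancel[OF s(11) i, rotated 2]) (use r(1) s t(1) in simp_all)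
  have "(i \<cdot> r) \<boxplus> (t \<cdot> p) = Ide A Z" unfolding r(2) using s t(1) by (simp add: Add_assoc)
  then have "is_biproduct Y X Z i t r p" unfolding is_biproduct_def using s t r(1) ri rt by simp
  then show ?thesis using that by blast
qed

text \<open>The covering sequence of a projective \<open>P\<close> splits, so \<open>P\<close> is a
  direct summand of an object of \<open>C\<close>. This is where closure under direct summands
  enters.\<close>

lemma E_projective_lift_seqs:
  assumes C: "subcategory C" and cov: "covers C D"
  shows "Collect (E_projective (lift_seqs C)) = C"
proof (intro Set.set_eqI iffI)
  fix P assume "P \<in> C"
  then show "P \<in> Collect (E_projective (lift_seqs C))"
    using C unfolding E_projective_iff admissible_epic_lift_seqs subcategory_def lifts_def by blast
next
  fix P assume "P \<in> Collect (E_projective (lift_seqs C))"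
  then have P: "P \<in> Ob A" and l: "\<And>p. is_epi p \<Longrightarrow> lifts C p \<Longrightarrow> lifts {P} p"
    unfolding E_projective_iff admissible_epic_lift_seqs by auto
  obtain k e where "short_exact k e" "Cod A e = P" and Q: "Dom A e \<in> C" and e: "lifts C e"
    using cov P unfolding covers_def by blast
  then obtain K where T: "ses K (Dom A e) P k e" using short_exact_iff ses_Hom(5) by metis
  note t = ses_Hom[OF T]
  obtain s where s: "s \<in> Hom P (Dom A e)" "e \<cdot> s = Ide A P"
    by (rule liftsE[OF l[OF t(12) e], of "Dom A e" P P "Ide A P"]) (use t in simp_all, blast?)
  obtain r where "is_biproduct K P (Dom A e) k s r e" using ses_split_biproduct[OF T s] .
  then show "P \<in> C" using C Q unfolding subcategory_def by blast
qed

lemma op_cat_subcategory [simp]: "cat.subcategory (op_cat A) S = subcategory S"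
proof -
  \<comment> \<open>Duality turns closure along isomorphisms leaving \<open>S\<close> into closure
    along isomorphisms entering \<open>S\<close>; passing to inverses identifies the two.\<close>
  have eq: "(\<forall>f. is_iso f \<and> Cod A f \<in> S \<longrightarrow> Dom A f \<in> S) \<longleftrightarrow> (\<forall>f. is_iso f \<and> Dom A f \<in> S \<longrightarrow> Cod A f \<in> S)"
  proof -
    have "\<exists>g. is_iso g \<and> Dom A g = Cod A f \<and> Cod A g = Dom A f" if "is_iso f" for f
      using is_isoE[OF that, of "Dom A f" "Cod A f"] that unfolding is_iso_def by (metis in_Hom Dom_Ob Cod_Ob)
    then show ?thesis by metis
  qed
  show ?thesis unfolding cat.subcategory_def op_cat_simps op_cat_notions eq by blast
qed

lemma E_injective_extend_seqs:
  "\<lbrakk>subcategory D; cocovers C D\<rbrakk> \<Longrightarrow> Collect (E_injective (extend_seqs D)) = D"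
  using abelian_category.E_projective_lift_seqs[OF abelian_op_cat, of D C] by simp

text \<open>A left lifting property against any set of morphisms is inherited by zero objects,
  biproducts and retracts. With the admissible epics as \<open>Q\<close> it shows that the
  projectives form a subcategory.\<close>

lemma subcategory_lifting:
  assumes "\<And>p. p \<in> Q \<Longrightarrow> p \<in> Mor A"
  shows "subcategory {P \<in> Ob A. \<forall>p\<in>Q. lifts {P} p}"
  unfolding subcategory_def
proof (intro conjI allI impI; (elim conjE)?)
  let ?S = "{P \<in> Ob A. \<forall>p\<in>Q. lifts {P} p}"
  have lift: "\<exists>g\<in>Hom P (Dom A p). p \<cdot> g = f" if "P \<in> ?S" "p \<in> Q" "f \<in> Hom P (Cod A p)" for P p f
    using that unfolding lifts_def by blast
  have mem: "P \<in> ?S" if "P \<in> Ob A" "\<And>p f. p \<in> Q \<Longrightarrow> f \<in> Hom P (Cod A p) \<Longrightarrow> \<exists>g\<in>Hom P (Dom A p). p \<cdot> g = f" for P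
    using that unfolding lifts_def by blast
  show "?S \<subseteq> Ob A" by blast
  obtain Z where Z: "is_zero_object Z" using zero_object_exists by blast
  then have ZO: "Z \<in> Ob A" unfolding is_zero_object_def by blast
  have "Z \<in> ?S"
  proof (rule mem[OF ZO])
    fix p f assume p: "p \<in> Q" and f: "f \<in> Hom Z (Cod A p)"
    have pM: "p \<in> Mor A" using assms p .
    then have "\<exists>!g. g \<in> Hom Z (Cod A p)" using Z Cod_Ob[OF pM] unfolding is_zero_object_def by blast
    then have "f = Zero A Z (Cod A p)" using f ZO pM by (metis Zero_simps in_Hom)
    then show "\<exists>g\<in>Hom Z (Dom A p). p \<cdot> g = f" using ZO pM by (intro bexI[of _ "Zero A Z (Dom A p)"]) simp_all
  qed
  then show "\<exists>Z\<in>?S. is_zero_object Z" using Z by blast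
  show "P \<in> ?S" if S: "X \<in> ?S" "Y \<in> ?S" and B: "is_biproduct X Y P i1 i2 p1 p2" for X Y P i1 i2 p1 p2
  proof (rule mem)
    note b = biproduct_simps[OF B]
    show "P \<in> Ob A" by (rule b)
    fix p f assume p: "p \<in> Q" and f: "f \<in> Hom P (Cod A p)"
    have pM: "p \<in> Mor A" using assms p .
    obtain g where g: "g \<in> Hom X (Dom A p)" "p \<cdot> g = f \<cdot> i1" using lift[OF S(1) p, of "f \<cdot> i1"] f b by auto
    obtain h where h: "h \<in> Hom Y (Dom A p)" "p \<cdot> h = f \<cdot> i2" using lift[OF S(2) p, of "f \<cdot> i2"] f b by auto
    have "p \<cdot> ((g \<cdot> p1) \<boxplus> (h \<cdot> p2)) = f"
    proof (rule biproduct_eqI_from[OF B, where W="Cod A p"])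
      show "(p \<cdot> ((g \<cdot> p1) \<boxplus> (h \<cdot> p2))) \<cdot> i1 = f \<cdot> i1" "(p \<cdot> ((g \<cdot> p1) \<boxplus> (h \<cdot> p2))) \<cdot> i2 = f \<cdot> i2"
        using g h f b pM by simp_all
    qed (use g(1) h(1) f b pM in simp_all)
    then show "\<exists>g\<in>Hom P (Dom A p). p \<cdot> g = f"
      using g(1) h(1) b pM by (intro bexI[of _ "(g \<cdot> p1) \<boxplus> (h \<cdot> p2)"]) simp_all
  qed
  show "Cod A u \<in> ?S" if u: "is_iso u" and S: "Dom A u \<in> ?S" for u
  proof (rule mem)
    have uM: "u \<in> Hom (Dom A u) (Cod A u)" using u unfolding is_iso_def by simp
    then show "Cod A u \<in> Ob A" by simp
    obtain v where v: "v \<in> Hom (Cod A u) (Dom A u)" "u \<cdot> v = Ide A (Cod A u)"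
      using is_isoE[OF u uM] by blast
    fix p f assume p: "p \<in> Q" and f: "f \<in> Hom (Cod A u) (Cod A p)"
    have pM: "p \<in> Mor A" using assms p .
    obtain g where g: "g \<in> Hom (Dom A u) (Dom A p)" "p \<cdot> g = f \<cdot> u" using lift[OF S p, of "f \<cdot> u"] f uM by auto
    have "p \<cdot> (g \<cdot> v) = f" using Comp_rewrite[OF g(2), of v] f uM v g(1) pM by simp
    then show "\<exists>g\<in>Hom (Cod A u) (Dom A p). p \<cdot> g = f"
      using g(1) v(1) by (intro bexI[of _ "g \<cdot> v"]) simp_all
  qed
  \<comment> \<open>Both summands of a biproduct are retracts, and a retraction
    \<open>r \<cdot> i = 1\<close> is enough: lift \<open>f \<cdot> r\<close> and restrict along
    \<open>i\<close>.\<close>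
  have summand: "X \<in> ?S" if S: "P \<in> ?S" and i: "i \<in> Hom X P" and r: "r \<in> Hom P X" and e: "r \<cdot> i = Ide A X"
    for X P i r
  proof (rule mem)
    show "X \<in> Ob A" using i by simp
    fix p f assume p: "p \<in> Q" and f: "f \<in> Hom X (Cod A p)"
    have pM: "p \<in> Mor A" using assms p .
    obtain g where g: "g \<in> Hom P (Dom A p)" "p \<cdot> g = f \<cdot> r" using lift[OF S p, of "f \<cdot> r"] f r by auto
    have "p \<cdot> (g \<cdot> i) = f" using Comp_rewrite[OF g(2), of i] f i r e g(1) pM by simp
    then show "\<exists>g\<in>Hom X (Dom A p). p \<cdot> g = f"
      using g(1) i by (intro bexI[of _ "g \<cdot> i"]) simp_all
  qed
  show "X \<in> ?S" "Y \<in> ?S" if S: "P \<in> ?S" and B: "is_biproduct X Y P i1 i2 p1 p2" for X Y P i1 i2 p1 p2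
    using summand[OF S, of i1 X p1] summand[OF S, of i2 Y p2] biproduct_simps[OF B] by simp_all
qed

text \<open>Both second morphisms are cokernels, so an isomorphism between the first morphisms
  induces one on the right ends. Membership of a pair in an exact structure can thus be recovered
  from its monic alone.\<close>

lemma ses_iso_right:
  assumes S: "ses Y Z X i p" and T: "ses Y Z' X' j q" and b: "is_iso b" "b \<in> Hom Z Z'" "b \<cdot> i = j"
  shows "pair_isomorphic (i, p) (j, q)"
proof -
  note s = ses_Hom[OF S] ses_Hom[OF T]
  obtain v where v: "v \<in> Hom Z' Z" "v \<cdot> b = Ide A Z" "b \<cdot> v = Ide A Z'" using is_isoE[OF b(1,2)] by blast
  have vj: "v \<cdot> j = i" using Comp_rewrite[OF v(2), of i] v(1) b(2,3) s by simp
  obtain c where c: "c \<in> Hom X X'" "c \<cdot> p = q \<cdot> b"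
    by (rule ses_extend[OF S, of "q \<cdot> b" X']) (use s b in simp_all, blast?)
  obtain c' where c': "c' \<in> Hom X' X" "c' \<cdot> q = p \<cdot> v"
    by (rule ses_extend[OF T, of "p \<cdot> v" X]) (use s vj v in simp_all, blast?)
  have p: "p \<in> Hom Z X" and q: "q \<in> Hom Z' X'" using s by simp_all
  have "(c' \<cdot> c) \<cdot> p = (p \<cdot> v) \<cdot> b"
    using Comp_rewrite[OF c'(2), of b] s v(1) b(2) c c'(1) by simp
  then have "(c' \<cdot> c) \<cdot> p = Ide A X \<cdot> p" using s v b(2) by simp
  then have cc: "c' \<cdot> c = Ide A X"
    by (rule is_epi_cancel[OF s(12) p, rotated 2]) (use c c' s in simp_all)
  have "(c \<cdot> c') \<cdot> q = (q \<cdot> b) \<cdot> v"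
    using Comp_rewrite[OF c(2), of v] s v(1) b(2) c(1) c' by simp
  then have "(c \<cdot> c') \<cdot> q = Ide A X' \<cdot> q" using s v b(2) by simp
  then have "c \<cdot> c' = Ide A X'"
    by (rule is_epi_cancel[OF s(26) q, rotated 2]) (use c c' s in simp_all)
  then have "is_iso c" using is_isoI[OF c(1) c'(1) cc] by blast
  moreover have "is_iso (Ide A Y)" by (rule is_isoI[of _ Y Y "Ide A Y"]) (use s in simp_all)
  ultimately show ?thesis unfolding pair_isomorphic_def prod.case
    by (intro exI[of _ "Ide A Y"] exI[of _ b] exI[of _ c] conjI) (use b c s in simp_all)
qed

lemma pushout_unique:
  assumes P: "is_pushout i g u j" and P': "is_pushout i g u' j'"
    and i: "i \<in> Hom Y Z" and g: "g \<in> Hom Y Y'" and j: "j \<in> Hom Y' W" and j': "j' \<in> Hom Y' W'"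
  obtains w where "w \<in> Hom W W'" "w \<cdot> j = j'" "is_iso w"
proof -
  have u: "u \<in> Hom Z W" "u \<cdot> i = j \<cdot> g" and u': "u' \<in> Hom Z W'" "u' \<cdot> i = j' \<cdot> g"
    using P P' i g j j' unfolding is_pushout_def by auto
  obtain w where w: "w \<in> Hom W W'" "w \<cdot> u = u'" "w \<cdot> j = j'"
    using pushout_lift[OF P i g j u'(1) j' u'(2)] .
  obtain v where v: "v \<in> Hom W' W" "v \<cdot> u' = u" "v \<cdot> j' = j"
    using pushout_lift[OF P' i g j' u(1) j u(2)] .
  have "v \<cdot> w = Ide A W"
    by (rule pushout_eqI[OF P i g j, where W=W]) (use u(1) j w v in simp_all)
  moreover have "w \<cdot> v = Ide A W'"
    by (rule pushout_eqI[OF P' i g j', where W=W']) (use u'(1) j' w v in simp_all)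
  ultimately have "is_iso w" using is_isoI w(1) v(1) by blast
  then show ?thesis using that w by blast
qed

lemma exact_structure_short_exact: "\<lbrakk>exact_structure E; (i, p) \<in> E\<rbrakk> \<Longrightarrow> short_exact i p"
  unfolding exact_structure_def kernel_cokernel_pair_iff by blast

lemma exact_structure_eq_lift_seqs:
  assumes E: "exact_structure E" and en: "enough_E_projectives E"
  shows "lift_seqs (Collect (E_projective E)) = E"
proof (rule equalityI)
  show "E \<subseteq> lift_seqs (Collect (E_projective E))"
    unfolding lift_seqs_def admissible_epic_def
    using exact_structure_short_exact[OF E] lifts_Collect admissible_epic_def by blast
  show "lift_seqs (Collect (E_projective E)) \<subseteq> E"
  proof (intro subsetI, clarify)
    fix i p assume "(i, p) \<in> lift_seqs (Collect (E_projective E))"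
    then have ip: "short_exact i p" and l: "lifts (Collect (E_projective E)) p"
      unfolding lift_seqs_def by auto
    obtain Y Z X where S: "ses Y Z X i p" using short_exactE[OF ip] .
    note s = ses_Hom[OF S]
    obtain k e where ke: "(k, e) \<in> E" and "Cod A e = X" and P: "E_projective E (Dom A e)"
      using en s(7) unfolding enough_E_projectives_def admissible_epic_def by blast
    then obtain K P where T: "ses K P X k e" using exact_structure_short_exact[OF E ke] short_exact_iff by metis
    note t = ses_Hom[OF T]
    have PC: "P \<in> Collect (E_projective E)" using P t by simp
    obtain h g where h: "h \<in> Hom P Z" "p \<cdot> h = e" and g: "g \<in> Hom K Y" "h \<cdot> k = i \<cdot> g"
      and po: "is_pushout k g h i" using lifts_pushout[OF S T l PC] .
    have "admissible_monic E k" using ke unfolding admissible_monic_def by blast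
    moreover have "g \<in> Mor A" "Dom A g = Dom A k" using g t by simp_all
    \<comment> \<open>The push-out axiom grants some push-out \<open>j\<close> of \<open>k\<close>
      and some partner \<open>q\<close> of it, whereas \<open>i\<close> is another push-out of the
      same span. Uniqueness of push-outs gives an isomorphism of pairs, under which \<open>E\<close>
      is closed.\<close>
    ultimately obtain u j where po': "is_pushout k g u j" and "admissible_monic E j"
      using E unfolding exact_structure_def by blast
    then obtain q where jq: "(j, q) \<in> E" unfolding admissible_monic_def by blast
    have "j \<in> Hom Y (Cod A j)" using po' g(1) unfolding is_pushout_def by auto
    then obtain W X' where T': "ses Y W X' j q"
      using exact_structure_short_exact[OF E jq] short_exact_iff by auto
    note t' = ses_Hom[OF T']
    obtain w where w: "w \<in> Hom W Z" "w \<cdot> j = i" "is_iso w"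
      by (rule pushout_unique[OF po' po _ g(1), of P W Z]) (use t t' s in simp_all, blast?)
    have "pair_isomorphic (j, q) (i, p)" by (rule ses_iso_right[OF T' S w(3,1,2)])
    moreover have "kernel_cokernel_pair i p" using ip kernel_cokernel_pair_iff by simp
    ultimately show "(i, p) \<in> E" using E jq unfolding exact_structure_def by blast
  qed
qed

section \<open>Duality for exact structures, and their projectives and injectives as covers\<close>

lemma op_cat_kernel_cokernel_pair [simp]:
  "cat.kernel_cokernel_pair (op_cat A) i p = kernel_cokernel_pair p i"
  unfolding cat.kernel_cokernel_pair_def by auto

text \<open>Reversing arrows also reverses the isomorphism of pairs, whence the exchanged arguments
  on the right; \<open>pair_isomorphic_sym\<close> later turns it round again. The hypotheses make
  the two names of each middle object agree.\<close>

lemma op_cat_pair_isomorphic: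
  assumes "kernel_cokernel_pair p i" "kernel_cokernel_pair q j"
  shows "cat.pair_isomorphic (op_cat A) (i, p) (j, q) = pair_isomorphic (q, j) (p, i)"
proof -
  have e: "Dom A i = Cod A p" "Dom A j = Cod A q"
    using assms is_kernel_Mor unfolding kernel_cokernel_pair_def by metis+
  show ?thesis
    unfolding cat.pair_isomorphic_def prod.case op_cat_simps op_cat_notions e
  proof (rule iffI; elim exE conjE)
    fix a b c
    assume "is_iso a" "is_iso b" "is_iso c" "a \<in> Hom (Cod A j) (Cod A i)" "b \<in> Hom (Cod A q) (Cod A p)"
      "c \<in> Hom (Dom A q) (Dom A p)" "i \<cdot> b = a \<cdot> j" "p \<cdot> c = b \<cdot> q"
    then show "\<exists>a b c. is_iso a \<and> is_iso b \<and> is_iso c \<and> a \<in> Hom (Dom A q) (Dom A p) \<and>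
        b \<in> Hom (Cod A q) (Cod A p) \<and> c \<in> Hom (Cod A j) (Cod A i) \<and> b \<cdot> q = p \<cdot> a \<and> c \<cdot> j = i \<cdot> b"
      by metis
  next
    fix a b c
    assume "is_iso a" "is_iso b" "is_iso c" "a \<in> Hom (Dom A q) (Dom A p)" "b \<in> Hom (Cod A q) (Cod A p)"
      "c \<in> Hom (Cod A j) (Cod A i)" "b \<cdot> q = p \<cdot> a" "c \<cdot> j = i \<cdot> b"
    then show "\<exists>a b c. is_iso a \<and> is_iso b \<and> is_iso c \<and> a \<in> Hom (Cod A j) (Cod A i) \<and>
        b \<in> Hom (Cod A q) (Cod A p) \<and> c \<in> Hom (Dom A q) (Dom A p) \<and> i \<cdot> b = a \<cdot> j \<and> p \<cdot> c = b \<cdot> q"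
      by metis
  qed
qed

lemma pair_isomorphic_sym:
  assumes "pair_isomorphic (i, p) (j, q)" "kernel_cokernel_pair i p" "kernel_cokernel_pair j q"
  shows "pair_isomorphic (j, q) (i, p)"
proof -
  obtain Y Z X Y' Z' X' where S: "ses Y Z X i p" and T: "ses Y' Z' X' j q"
    using assms(2,3) short_exactE unfolding kernel_cokernel_pair_iff by metis
  note s = ses_Hom[OF S] ses_Hom[OF T]
  obtain a b c where iso: "is_iso a" "is_iso b" "is_iso c"
    and a: "a \<in> Hom Y Y'" and b: "b \<in> Hom Z Z'" and c: "c \<in> Hom X X'"
    and e: "b \<cdot> i = j \<cdot> a" "c \<cdot> p = q \<cdot> b"
    using assms(1) s unfolding pair_isomorphic_def by auto
  obtain a' where a': "a' \<in> Hom Y' Y" "a \<cdot> a' = Ide A Y'" "is_iso a'" using is_isoE[OF iso(1) a] by blast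
  obtain b' where b': "b' \<in> Hom Z' Z" "b' \<cdot> b = Ide A Z" "b \<cdot> b' = Ide A Z'" "is_iso b'"
    using is_isoE[OF iso(2) b] by blast
  obtain c' where c': "c' \<in> Hom X' X" "c' \<cdot> c = Ide A X" "is_iso c'" using is_isoE[OF iso(3) c] by blast
  have "b' \<cdot> j = b' \<cdot> ((b \<cdot> i) \<cdot> a')" unfolding e(1) using a a' s by simp
  also have "\<dots> = i \<cdot> a'" using Comp_rewrite[OF b'(2), of "i \<cdot> a'"] b b'(1) a'(1) s by simp
  finally have 1: "b' \<cdot> j = i \<cdot> a'" .
  have "c' \<cdot> q = c' \<cdot> ((q \<cdot> b) \<cdot> b')" using b b' c' s by simp
  also have "\<dots> = p \<cdot> b'" unfolding e(2)[symmetric]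
    using Comp_rewrite[OF c'(2), of "p \<cdot> b'"] b'(1) c c'(1) s by simp
  finally have "c' \<cdot> q = p \<cdot> b'" .
  then show ?thesis unfolding pair_isomorphic_def prod.case
    by (intro exI[of _ a'] exI[of _ b'] exI[of _ c'] conjI) (use 1 a' b' c' s in simp_all)
qed

lemma op_cat_exact_structure:
  assumes "exact_structure E"
  shows "cat.exact_structure (op_cat A) (E\<inverse>)"
proof -
  have kc: "kernel_cokernel_pair i p" if "(i, p) \<in> E" for i p
    using assms that unfolding exact_structure_def by blast
  have cl: "(j, q) \<in> E" if "(i, p) \<in> E" "kernel_cokernel_pair j q" "pair_isomorphic (j, q) (i, p)" for i p j q
    using assms that kc[OF that(1)] pair_isomorphic_sym unfolding exact_structure_def by blast
  show ?thesis
    unfolding cat.exact_structure_def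
  proof (intro conjI)
    show "\<forall>(i, p)\<in>E\<inverse>. \<forall>j q. cat.kernel_cokernel_pair (op_cat A) j q \<and>
        cat.pair_isomorphic (op_cat A) (i, p) (j, q) \<longrightarrow> (j, q) \<in> E\<inverse>"
      using cl kc op_cat_pair_isomorphic unfolding op_cat_kernel_cokernel_pair by blast
  qed (use assms kc in \<open>auto simp: exact_structure_def admissible_converse\<close>)
qed

lemma op_cat_enough [simp]:
  "cat.enough_E_projectives (op_cat A) (E\<inverse>) = enough_E_injectives E"
  "cat.enough_E_injectives (op_cat A) (E\<inverse>) = enough_E_projectives E"
  unfolding cat.enough_E_projectives_def cat.enough_E_injectives_def by simp_all

text \<open>An admissible sequence has both properties at once: projectives lift along its epic by
  their definition, and morphisms to injectives extend along its monic by theirs.\<close>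

lemma covers_of_exact_structure:
  assumes E: "exact_structure E" and en: "enough_E_projectives E"
  shows "covers (Collect (E_projective E)) (Collect (E_injective E))"
  unfolding covers_def
proof
  fix M assume "M \<in> Ob A"
  then obtain i p where ip: "(i, p) \<in> E" and M: "Cod A p = M" "E_projective E (Dom A p)"
    using en unfolding enough_E_projectives_def admissible_epic_def by blast
  have "admissible_epic E p" "admissible_monic E i"
    using ip unfolding admissible_epic_def admissible_monic_def by blast+
  then show "\<exists>i p. short_exact i p \<and> Cod A p = M \<and> Dom A p \<in> Collect (E_projective E) \<and>
      lifts (Collect (E_projective E)) p \<and> extends (Collect (E_injective E)) i"
    using exact_structure_short_exact[OF E ip] M lifts_Collect extends_Collect by blast
qed

lemma cocovers_of_exact_structure:
  assumes "exact_structure E" "enough_E_injectives E"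
  shows "cocovers (Collect (E_projective E)) (Collect (E_injective E))"
  using abelian_category.covers_of_exact_structure[OF abelian_op_cat, of "E\<inverse>"]
    op_cat_exact_structure[OF assms(1)] assms(2) by simp

lemma subcategory_E_projective:
  assumes "exact_structure E"
  shows "subcategory (Collect (E_projective E))"
proof -
  have "Collect (E_projective E) = {P \<in> Ob A. \<forall>p\<in>Collect (admissible_epic E). lifts {P} p}"
    unfolding E_projective_iff by auto
  moreover have "p \<in> Mor A" if "p \<in> Collect (admissible_epic E)" for p
    using that exact_structure_short_exact[OF assms] ses_Hom(2) short_exact_iff
    unfolding admissible_epic_def by blast
  ultimately show ?thesis using subcategory_lifting by metis
qed

lemma subcategory_E_injective:
  "exact_structure E \<Longrightarrow> subcategory (Collect (E_injective E))"
  using abelian_category.subcategory_E_projective[OF abelian_op_cat, of "E\<inverse>"]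
    op_cat_exact_structure by simp

section \<open>Resolutions of balanced pairs and their covering sequences\<close>

lemma covers_of_resolution:
  assumes M: "M \<in> Ob A" and R: "resolution C M d"
    and co: "\<And>Y n. Y \<in> D \<Longrightarrow> coHom_exact_at Y (d (Suc n)) (d n)"
  shows "\<exists>i p. short_exact i p \<and> Cod A p = M \<and> Dom A p \<in> C \<and> lifts C p \<and> extends D i"
proof -
  define Z where "Z = Cod A (d 0)"
  define C0 C1 where "C0 = Dom A (d 1)" and "C1 = Dom A (d 2)"
  have Z: "is_zero_object Z" and d0M: "Dom A (d 0) = M" and C0: "C0 \<in> C"
    and ex: "\<And>n. exact_at (d (Suc n)) (d n)" and H: "\<And>X n. X \<in> C \<Longrightarrow> Hom_exact_at X (d (Suc n)) (d n)"
    using R unfolding resolution_def Z_def C0_def C1_def by auto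
  have ZO: "Z \<in> Ob A" using Z unfolding is_zero_object_def by blast
  have e: "d (Suc n) \<in> Mor A" "d n \<in> Mor A" "Cod A (d (Suc n)) = Dom A (d n)"
    "d n \<cdot> d (Suc n) = Zero A (Dom A (d (Suc n))) (Cod A (d n))" for n
    using ex[of n] unfolding exact_at_iff by auto
  have d0: "d 0 \<in> Hom M Z" using e(2)[of 0] d0M Z_def M by simp
  have d1: "d 1 \<in> Hom C0 M" using e(1,3)[of 0] d0M C0_def M by simp
  have d2: "d 2 \<in> Hom C1 C0" "d 1 \<cdot> d 2 = Zero A C1 M"
    using e[of 1] d1 C0_def C1_def by (simp_all add: numeral_2_eq_2)
  have d3: "d 3 \<in> Hom (Dom A (d 3)) C1" "d 2 \<cdot> d 3 = Zero A (Dom A (d 3)) C0"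
    using e[of 2] d2 C1_def by (simp_all add: numeral_3_eq_3 numeral_2_eq_2)
  have "d 0 = Zero A M Z"
    using Z M d0 unfolding is_zero_object_def by (metis Zero_simps in_Hom)
  then have epi: "is_epi (d 1)"
    using ex[of 0] exact_at_Zero_right[OF ZO d1] by simp
  obtain K k where S: "ses K C0 M k (d 1)" using ses_of_epi_ex[OF epi d1] .
  note s = ses_Hom[OF S]
  have "lifts C (d 1)" unfolding lifts_iff[OF d1]
  proof (intro ballI)
    fix X f assume X: "X \<in> C" and f: "f \<in> Hom X M"
    have "f \<in> {h \<in> Hom X (Dom A (d 0)). d 0 \<cdot> h = Zero A X (Cod A (d 0))}"
      using f \<open>d 0 = Zero A M Z\<close> d0 by simp
    then have "f \<in> (\<lambda>h. d 1 \<cdot> h) ` Hom X (Dom A (d 1))"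
      using H[OF X, of 0] unfolding Hom_exact_at_def by simp
    then show "\<exists>g\<in>Hom X C0. d 1 \<cdot> g = f" unfolding C0_def by blast
  qed
  moreover have "extends D k" unfolding extends_ses[OF S]
  proof (intro ballI)
    fix Y f assume Y: "Y \<in> D" and f: "f \<in> Hom K Y"
    have k: "k \<in> Hom K C0" using s by simp
    \<comment> \<open>\<open>d 2\<close> factors through the kernel \<open>K\<close> of
      \<open>d 1\<close>; exactness at \<open>C0\<close> makes the factor \<open>g\<close> epi, so
      that it can be cancelled at the end.\<close>
    obtain g where g: "g \<in> Hom C1 K" "k \<cdot> g = d 2" using ses_lift[OF S d2] .
    have ge: "is_epi g"
      by (rule exact_at_epi_factor[OF _ s(13) d2(1) g(1) k g(2)])
        (use ex[of 1] in \<open>simp add: numeral_2_eq_2\<close>)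
    have "k \<cdot> (g \<cdot> d 3) = Zero A (Dom A (d 3)) C0" using Comp_rewrite[OF g(2), of "d 3"] g d3 k by simp
    then have "g \<cdot> d 3 = Zero A (Dom A (d 3)) K"
      using is_mono_iff[OF k] s(11) g(1) d3(1) by simp
    \<comment> \<open>As \<open>f \<cdot> g\<close> kills \<open>d 3\<close>, exactness at
      \<open>Hom(C1, Y)\<close>, which is the index 2 of the hypothesis, gives \<open>t\<close> with
      \<open>t \<cdot> d 2 = f \<cdot> g\<close>. Cancelling \<open>g\<close> leaves the required
      extension \<open>t \<cdot> k = f\<close>.\<close>
    then have "f \<cdot> g \<in> {h \<in> Hom (Cod A (d 3)) Y. h \<cdot> d 3 = Zero A (Dom A (d 3)) Y}"
      using f g(1) d3(1) by simp
    then have "f \<cdot> g \<in> (\<lambda>h. h \<cdot> d 2) ` Hom (Cod A (d 2)) Y"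
      using co[OF Y, of 2] unfolding coHom_exact_at_def by (simp only: numeral_3_eq_3 numeral_2_eq_2)
    then obtain t where t: "t \<in> Hom C0 Y" "t \<cdot> d 2 = f \<cdot> g" using d2(1) by auto
    have "(t \<cdot> k) \<cdot> g = f \<cdot> g" using t(1) g k t(2) by simp
    then have "t \<cdot> k = f" by (rule is_epi_cancel[OF ge g(1), where W=Y, rotated 2]) (use t(1) k f in simp_all)
    then show "\<exists>t\<in>Hom C0 Y. t \<cdot> k = f" using t(1) by blast
  qed
  ultimately show ?thesis using ses_short_exact[OF S] d1 C0 by auto
qed

lemma resolution_exists:
  assumes cov: "covers C D" and M: "M \<in> Ob A"
  shows "\<exists>d. resolution C M d \<and> (\<forall>Y\<in>D. \<forall>n. coHom_exact_at Y (d (Suc n)) (d n))"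
proof -
  obtain I P where IP: "\<And>M. M \<in> Ob A \<Longrightarrow> short_exact (I M) (P M) \<and> Cod A (P M) = M \<and>
      Dom A (P M) \<in> C \<and> lifts C (P M) \<and> extends D (I M)"
    using cov unfolding covers_def by metis
  obtain Z where Z: "is_zero_object Z" using zero_object_exists by blast
  then have ZO: "Z \<in> Ob A" unfolding is_zero_object_def by blast
  define Q where "Q M = Dom A (P M)" for M
  \<comment> \<open>\<open>K n\<close> is the n-th syzygy, with \<open>K 0 = M\<close>, and
    \<open>m n\<close> embeds it into the domain of \<open>d n\<close>. Taking the identity for
    \<open>m 0\<close> makes \<open>d 1\<close> an instance of the general formula
    \<open>m k \<cdot> P (K k)\<close>.\<close>
  define K where "K n = ((\<lambda>M. Dom A (I M)) ^^ n) M" for n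
  define m where "m n = (case n of 0 \<Rightarrow> Ide A M | Suc k \<Rightarrow> I (K k))" for n
  define d where "d n = (case n of 0 \<Rightarrow> Zero A M Z | Suc k \<Rightarrow> m k \<cdot> P (K k))" for n
  have ses: "ses (Dom A (I N)) (Q N) N (I N) (P N)" if "N \<in> Ob A" for N
  proof -
    note ip = IP[OF that]
    obtain Y W X where S: "ses Y W X (I N) (P N)" using ip short_exactE by blast
    show ?thesis using S ses_Hom[OF S] ip unfolding Q_def by simp
  qed
  have KO: "K n \<in> Ob A" for n
  proof (induction n)
    case 0 show ?case using M by (simp add: K_def)
  next
    case (Suc n) then show ?case using ses_Hom(8)[OF ses[OF Suc]] by (simp add: K_def)
  qed
  have S: "ses (K (Suc n)) (Q (K n)) (K n) (I (K n)) (P (K n))" for n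
    using ses[OF KO[of n]] by (simp add: K_def)
  have P: "P (K n) \<in> Hom (Q (K n)) (K n)" "is_epi (P (K n))" for n using ses_Hom[OF S[of n]] by simp_all
  define T where "T n = (case n of 0 \<Rightarrow> M | Suc k \<Rightarrow> Q (K k))" for n
  have K0: "K 0 = M" by (simp add: K_def)
  have m: "m n \<in> Hom (K n) (T n)" for n
    using ses_Hom[OF S[of "n - 1"]] M K0 by (cases n) (simp_all add: m_def T_def)
  define U where "U n = (case n of 0 \<Rightarrow> Z | Suc k \<Rightarrow> T k)" for n
  have d: "d n \<in> Hom (T n) (U n)" for n
    using m[of "n - 1"] P(1)[of "n - 1"] M ZO by (cases n) (simp_all add: d_def T_def U_def)
  have dSuc: "d (Suc n) = m n \<cdot> P (K n)" for n by (simp add: d_def)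
  have mono: "is_mono (m n)" for n
  proof (cases n)
    case 0 then show ?thesis using M by (simp add: m_def is_mono_iff[of "Ide A M" M M])
  next
    case (Suc k) then show ?thesis using ses_Hom(11)[OF S[of k]] by (simp add: m_def)
  qed
  \<comment> \<open>Each differential has the next syzygy as its kernel, and
    \<open>d (Suc n)\<close> is \<open>m n\<close> after an epi. Exactness and both Hom conditions
    are derived from this; for \<open>n = 0\<close> the kernel of \<open>M -> 0\<close> is the
    identity of \<open>M\<close>.\<close>
  have ker: "is_kernel (d n) (m n)" for n
  proof (rule is_kernelI[OF mono m d])
    show "d n \<cdot> m n = Zero A (K n) (U n)"
    proof (cases n)
      case 0 then show ?thesis using M ZO K0 by (simp add: d_def m_def U_def)
    next
      case (Suc k)
      then show ?thesis
        using m[of k] ses_Hom[OF S[of k]] by (simp add: d_def m_def[of "Suc k"] U_def)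
    qed
    fix W h assume h: "h \<in> Hom W (T n)" "d n \<cdot> h = Zero A W (U n)"
    show "\<exists>u\<in>Hom W (K n). m n \<cdot> u = h"
    proof (cases n)
      case 0 then show ?thesis using h M K0 by (intro bexI[of _ h]) (simp_all add: m_def T_def)
    next
      case (Suc k)
      then have hk: "h \<in> Hom W (Q (K k))" "m k \<cdot> (P (K k) \<cdot> h) = Zero A W (T k)"
        using h m[of k] P(1)[of k] by (simp_all add: T_def U_def d_def)
      then have "P (K k) \<cdot> h = Zero A W (K k)"
        using is_mono_iff[OF m[of k]] mono[of k] P(1)[of k] by simp
      then obtain u where "u \<in> Hom W (K (Suc k))" "I (K k) \<cdot> u = h" using ses_lift[OF S hk(1)] by blast
      then show ?thesis using Suc by (auto simp: m_def)
    qed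
  qed
  \<comment> \<open>For a successor this is the extension property of the covering sequence that
    defines the syzygy; for \<open>n = 0\<close> it is trivial because \<open>m 0\<close> is an
    identity.\<close>
  have mext: "\<exists>g\<in>Hom (T n) Y. g \<cdot> m n = f" if "Y \<in> D" "f \<in> Hom (K n) Y" for n Y f
  proof (cases n)
    case 0 then show ?thesis using that M K0 by (intro bexI[of _ f]) (simp_all add: m_def T_def)
  next
    case (Suc k)
    have "extends D (I (K k))" using IP[OF KO] by blast
    then show ?thesis using that Suc unfolding extends_ses[OF S[of k]] by (simp add: m_def T_def)
  qed
  have "resolution C M d"
    unfolding resolution_def
  proof (intro conjI allI ballI)
    show "is_zero_object (Cod A (d 0))" "Dom A (d 0) = M" using Z M ZO by (simp_all add: d_def)
    fix n
    show "Dom A (d (Suc n)) \<in> C" using d[of "Suc n"] IP[OF KO[of n]] by (simp add: T_def Q_def)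
    show "exact_at (d (Suc n)) (d n)" unfolding dSuc by (rule exact_at_epi_mono[OF P(2,1) ker m d])
    fix X assume X: "X \<in> C"
    show "Hom_exact_at X (d (Suc n)) (d n)"
      unfolding Hom_exact_at_def
    proof (intro equalityI subsetI)
      fix h assume "h \<in> (\<lambda>h. d (Suc n) \<cdot> h) ` Hom X (Dom A (d (Suc n)))"
      then obtain g where g: "g \<in> Hom X (Q (K n))" "h = d (Suc n) \<cdot> g"
        using d[of "Suc n"] by (auto simp: T_def)
      have dm: "d n \<cdot> m n = Zero A (K n) (U n)" using is_kernel_Comp[OF ker[of n]] m[of n] d[of n] by simp
      have "d n \<cdot> (m n \<cdot> (P (K n) \<cdot> g)) = Zero A X (U n)"
        using Comp_rewrite[OF dm, of "P (K n) \<cdot> g"] m[of n] d[of n] P(1)[of n] g(1) by simp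
      then show "h \<in> {h \<in> Hom X (Dom A (d n)). d n \<cdot> h = Zero A X (Cod A (d n))}"
        using g m[of n] d[of n] P(1)[of n] by (simp add: dSuc)
    next
      fix h assume "h \<in> {h \<in> Hom X (Dom A (d n)). d n \<cdot> h = Zero A X (Cod A (d n))}"
      then have h: "h \<in> Hom X (T n)" "d n \<cdot> h = Zero A X (U n)" using d[of n] by auto
      obtain u where u: "u \<in> Hom X (K n)" "m n \<cdot> u = h" using is_kernel_lift[OF ker m d h] .
      have "lifts C (P (K n))" using IP[OF KO] by blast
      then obtain g where g: "g \<in> Hom X (Q (K n))" "P (K n) \<cdot> g = u"
        using liftsE[OF _ P(1) X u(1)] by blast
      have "d (Suc n) \<cdot> g = h" using g u m[of n] P(1)[of n] by (simp add: dSuc)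
      then show "h \<in> (\<lambda>h. d (Suc n) \<cdot> h) ` Hom X (Dom A (d (Suc n)))"
        using g(1) d[of "Suc n"] by (intro image_eqI[of _ _ g]) (simp_all add: T_def)
    qed
  qed
  moreover have "coHom_exact_at Y (d (Suc n)) (d n)" if Y: "Y \<in> D" for Y n
    unfolding coHom_exact_at_def
  proof (intro equalityI subsetI)
    have e: "exact_at (d (Suc n)) (d n)" unfolding dSuc by (rule exact_at_epi_mono[OF P(2,1) ker m d])
    have d2: "d (Suc n) \<in> Hom (Q (K n)) (T n)" using d[of "Suc n"] by (simp add: T_def U_def)
    have dd: "d n \<cdot> d (Suc n) = Zero A (Q (K n)) (U n)"
      using e d2 d[of n] unfolding exact_at_iff by simp
    {
      fix h assume "h \<in> (\<lambda>h. h \<cdot> d n) ` Hom (Cod A (d n)) Y"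
      then obtain g where g: "g \<in> Hom (U n) Y" "h = g \<cdot> d n" using d[of n] by auto
      have "h \<cdot> d (Suc n) = Zero A (Q (K n)) Y" using g dd d[of n] d2 by simp
      then show "h \<in> {h \<in> Hom (Cod A (d (Suc n))) Y. h \<cdot> d (Suc n) = Zero A (Dom A (d (Suc n))) Y}"
        using g d[of n] d2 by simp
    next
      fix h assume "h \<in> {h \<in> Hom (Cod A (d (Suc n))) Y. h \<cdot> d (Suc n) = Zero A (Dom A (d (Suc n))) Y}"
      then have h: "h \<in> Hom (T n) Y" "h \<cdot> d (Suc n) = Zero A (Q (K n)) Y" using d2 by auto
      then have "(h \<cdot> m n) \<cdot> P (K n) = Zero A (Q (K n)) Y"
        using m[of n] P(1)[of n] by (simp add: dSuc)
      then have hm: "h \<cdot> m n = Zero A (K n) Y"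
        using is_epi_iff[OF P(1)[of n]] P(2)[of n] h(1) m[of n] by simp
      \<comment> \<open>Since \<open>h\<close> kills the syzygy \<open>m n\<close>, it factors as
        \<open>u \<cdot> P (K k)\<close> through the preceding covering epi, and \<open>u\<close>
        extends along \<open>m k\<close>. At \<open>n = 0\<close> the morphism \<open>h\<close>
        itself vanishes.\<close>
      have "\<exists>g\<in>Hom (U n) Y. g \<cdot> d n = h"
      proof (cases n)
        case 0
        then have "h = Zero A M Y" using hm h(1) M K0 by (simp add: m_def T_def)
        then show ?thesis using 0 M ZO h(1)
          by (intro bexI[of _ "Zero A Z Y"]) (simp_all add: U_def d_def)
      next
        case (Suc k)
        then have hk: "h \<in> Hom (Q (K k)) Y" "h \<cdot> I (K k) = Zero A (K (Suc k)) Y"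
          using hm h(1) by (simp_all add: m_def T_def)
        obtain u where u: "u \<in> Hom (K k) Y" "u \<cdot> P (K k) = h" using ses_extend[OF S hk] .
        obtain g where g: "g \<in> Hom (T k) Y" "g \<cdot> m k = u" using mext[OF Y u(1)] by blast
        have "g \<cdot> d n = h" using Comp_rewrite[OF g(2), of "P (K k)"] g(1) m[of k] P(1)[of k] u(2) Suc
          by (simp add: dSuc)
        then show ?thesis using g(1) Suc by (auto simp: U_def)
      qed
      then show "h \<in> (\<lambda>h. h \<cdot> d n) ` Hom (Cod A (d n)) Y" using d[of n] by auto
    }
  qed
  ultimately show ?thesis by blast
qed

lemma op_cat_resolution [simp]:
  "cat.resolution (op_cat A) S M d = coresolution S M d"
  unfolding cat.resolution_def cat.coresolution_def by simp

lemma cocovers_of_coresolution: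
  assumes "M \<in> Ob A" "coresolution D M d"
    and "\<And>X n. X \<in> C \<Longrightarrow> Hom_exact_at X (d n) (d (Suc n))"
  shows "\<exists>i p. short_exact i p \<and> Dom A i = M \<and> Cod A i \<in> D \<and> lifts C p \<and> extends D i"
  using abelian_category.covers_of_resolution[OF abelian_op_cat, of M D d C] assms by (simp; blast)

lemma coresolution_exists:
  assumes "cocovers C D" "N \<in> Ob A"
  shows "\<exists>d. coresolution D N d \<and> (\<forall>X\<in>C. \<forall>n. Hom_exact_at X (d n) (d (Suc n)))"
  using abelian_category.resolution_exists[OF abelian_op_cat, of D C N] assms by simp

lemma covers_epimorphic_precovering:
  assumes "covers C D"
  shows "epimorphic_precovering C"
  unfolding epimorphic_precovering_def
proof
  fix M assume "M \<in> Ob A"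
  then obtain i p where ip: "short_exact i p" "Cod A p = M" "Dom A p \<in> C" "lifts C p"
    using assms unfolding covers_def by blast
  then have "is_epi p" "p \<in> Mor A" using short_exact_iff ses_Hom(2,12) by blast+
  then show "\<exists>f. precover C M f \<and> is_epi f" using ip unfolding precover_def lifts_def by auto
qed

lemma op_cat_preenveloping [simp]:
  "cat.epimorphic_precovering (op_cat A) S = monomorphic_preenveloping S"
  unfolding cat.epimorphic_precovering_def cat.monomorphic_preenveloping_def
    cat.precover_def cat.preenvelope_def by simp

lemma cocovers_monomorphic_preenveloping: "cocovers C D \<Longrightarrow> monomorphic_preenveloping D"
  using abelian_category.covers_epimorphic_precovering[OF abelian_op_cat, of D C] by simp

text \<open>From here on resolutions are replaced by single covering and cocovering sequences. In
  the converse direction these also provide the precovers and preenvelopes.\<close>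

lemma balanced_pairs_iff:
  "(C, D) \<in> balanced_pairs \<longleftrightarrow> subcategory C \<and> subcategory D \<and> covers C D \<and> cocovers C D"
proof
  assume B: "(C, D) \<in> balanced_pairs"
  have "covers C D" unfolding covers_def
    using B covers_of_resolution[of _ C _ D] unfolding balanced_pairs_def by blast
  moreover have "cocovers C D" unfolding cocovers_def
    using B cocovers_of_coresolution[of _ D _ C] unfolding balanced_pairs_def by blast
  ultimately show "subcategory C \<and> subcategory D \<and> covers C D \<and> cocovers C D"
    using B unfolding balanced_pairs_def by blast
next
  assume "subcategory C \<and> subcategory D \<and> covers C D \<and> cocovers C D"
  then show "(C, D) \<in> balanced_pairs"
    unfolding balanced_pairs_def
    using covers_epimorphic_precovering cocovers_monomorphic_preenveloping
      resolution_exists coresolution_exists by blast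
qed

section \<open>Balanced pairs correspond to exact structures\<close>

lemma subcategory_subset: "subcategory C \<Longrightarrow> C \<subseteq> Ob A"
  unfolding subcategory_def by blast

text \<open>Stated for mere sets of objects, so that it also applies to \<open>split_obs E\<close>
  and \<open>cosplit_obs E\<close> in the treatment of subfunctors.\<close>

lemma exact_structure_of_covers:
  assumes C: "C \<subseteq> Ob A" and D: "D \<subseteq> Ob A" and cov: "covers C D" and coc: "cocovers C D"
  shows "lift_seqs C \<in> exact_structures_enough"
proof -
  have eq: "lift_seqs C = extend_seqs D" by (rule lift_seqs_eq_extend_seqs[OF cov coc])
  have "enough_E_projectives (lift_seqs C)"
    unfolding enough_E_projectives_def
  proof
    fix M assume "M \<in> Ob A"
    then obtain i p where ip: "short_exact i p" "Cod A p = M" "Dom A p \<in> C" "lifts C p"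
      using cov unfolding covers_def by blast
    have "E_projective (lift_seqs C) (Dom A p)"
      using ip(3) C unfolding E_projective_iff admissible_epic_lift_seqs lifts_def by blast
    then show "\<exists>p. admissible_epic (lift_seqs C) p \<and> Cod A p = M \<and> E_projective (lift_seqs C) (Dom A p)"
      using ip unfolding admissible_epic_def lift_seqs_def by blast
  qed
  moreover have "enough_E_injectives (extend_seqs D)"
    unfolding enough_E_injectives_def
  proof
    fix M assume "M \<in> Ob A"
    then obtain i p where ip: "short_exact i p" "Dom A i = M" "Cod A i \<in> D" "extends D i"
      using coc unfolding cocovers_def by blast
    have "E_injective (extend_seqs D) (Cod A i)"
      using ip(3) D unfolding E_injective_iff admissible_monic_extend_seqs extends_def by blast
    then show "\<exists>i. admissible_monic (extend_seqs D) i \<and> Dom A i = M \<and> E_injective (extend_seqs D) (Cod A i)"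
      using ip unfolding admissible_monic_def extend_seqs_def by blast
  qed
  ultimately show ?thesis
    using lift_seqs_exact_structure[OF eq] eq unfolding exact_structures_enough_def by simp
qed

lemma bij_betw_balanced_exact:
  "bij_betw (\<lambda>(C, D). lift_seqs C) balanced_pairs exact_structures_enough"
proof (rule bij_betw_byWitness[where f' = "\<lambda>E. (Collect (E_projective E), Collect (E_injective E))"])
  show "\<forall>a\<in>balanced_pairs. (\<lambda>E. (Collect (E_projective E), Collect (E_injective E)))
      ((\<lambda>(C, D). lift_seqs C) a) = a"
  proof (intro ballI, clarify)
    fix C D assume "(C, D) \<in> balanced_pairs"
    then have *: "subcategory C" "subcategory D" "covers C D" "cocovers C D"
      unfolding balanced_pairs_iff by auto
    then show "Collect (E_projective (lift_seqs C)) = C \<and> Collect (E_injective (lift_seqs C)) = D"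
      using E_projective_lift_seqs E_injective_extend_seqs lift_seqs_eq_extend_seqs by metis
  qed
  show "\<forall>E\<in>exact_structures_enough. (\<lambda>(C, D). lift_seqs C)
      (Collect (E_projective E), Collect (E_injective E)) = E"
    unfolding exact_structures_enough_def using exact_structure_eq_lift_seqs by simp
  show "(\<lambda>(C, D). lift_seqs C) ` balanced_pairs \<subseteq> exact_structures_enough"
  proof (intro subsetI, clarify)
    fix C D assume "(C, D) \<in> balanced_pairs"
    then show "lift_seqs C \<in> exact_structures_enough"
      using exact_structure_of_covers subcategory_subset unfolding balanced_pairs_iff by blast
  qed
  show "(\<lambda>E. (Collect (E_projective E), Collect (E_injective E))) ` exact_structures_enough \<subseteq> balanced_pairs"
    unfolding exact_structures_enough_def
    using balanced_pairs_iff covers_of_exact_structure cocovers_of_exact_structure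
      subcategory_E_projective subcategory_E_injective by blast
qed

section \<open>Extension classes and the Baer sum\<close>

lemma extensions_iff: "(i, p) \<in> extensions X Y \<longleftrightarrow> (\<exists>Z. ses Y Z X i p)"
proof
  assume "(i, p) \<in> extensions X Y"
  then show "\<exists>Z. ses Y Z X i p" unfolding extensions_def short_exact_iff by auto
next
  assume "\<exists>Z. ses Y Z X i p"
  then obtain Z where S: "ses Y Z X i p" by blast
  show "(i, p) \<in> extensions X Y" unfolding extensions_def using ses_short_exact[OF S] ses_Hom[OF S] by simp
qed

text \<open>By the short five lemma any morphism of sequences with identities at both ends is
  invertible in the middle. Equality of extension classes thus reduces to exhibiting one comparison
  morphism.\<close>

lemma ext_rel_iff:
  "((i, p), (j, q)) \<in> ext_rel X Y \<longleftrightarrow>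
    (\<exists>Z Z' u. ses Y Z X i p \<and> ses Y Z' X j q \<and> u \<in> Hom Z Z' \<and> u \<cdot> i = j \<and> q \<cdot> u = p)" (is "_ \<longleftrightarrow> ?R")
proof
  assume "((i, p), (j, q)) \<in> ext_rel X Y"
  then obtain Z Z' u where S: "ses Y Z X i p" and T: "ses Y Z' X j q"
    and u: "u \<in> Hom (Cod A i) (Cod A j)" "u \<cdot> i = j" "q \<cdot> u = p"
    unfolding ext_rel_def extensions_iff by blast
  then show ?R using ses_Hom(4)[OF S] ses_Hom(4)[OF T] by blast
next
  assume ?R
  then obtain Z Z' u where S: "ses Y Z X i p" and T: "ses Y Z' X j q"
    and u: "u \<in> Hom Z Z'" "u \<cdot> i = j" "q \<cdot> u = p" by blast
  have "is_iso u" by (rule ses_middle_iso[OF S T u])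
  moreover have "u \<in> Hom (Cod A i) (Cod A j)" using u(1) ses_Hom(4)[OF S] ses_Hom(4)[OF T] by simp
  ultimately show "((i, p), (j, q)) \<in> ext_rel X Y"
    unfolding ext_rel_def using S T u extensions_iff by blast
qed

lemma ses_same_middle: "ses Y Z X i p \<Longrightarrow> ses Y' Z' X' i p \<Longrightarrow> Z' = Z"
  using ses_Hom(4)[of Y Z X i p] ses_Hom(4)[of Y' Z' X' i p] by simp

lemma equiv_ext_rel: "equiv (extensions X Y) (ext_rel X Y)"
proof (rule equivI)
  show "ext_rel X Y \<subseteq> extensions X Y \<times> extensions X Y"
    unfolding ext_rel_def by blast
  show "refl_on (extensions X Y) (ext_rel X Y)"
  proof (rule refl_onI)
    fix x assume "x \<in> extensions X Y"
    then obtain i p Z where x: "x = (i, p)" and S: "ses Y Z X i p" using extensions_iff by (metis surj_pair)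
    have "Ide A Z \<in> Hom Z Z" "Ide A Z \<cdot> i = i" "p \<cdot> Ide A Z = p" using ses_Hom[OF S] by simp_all
    then show "(x, x) \<in> ext_rel X Y" unfolding x ext_rel_iff using S by blast
  qed
  show "sym (ext_rel X Y)"
  proof (rule symI)
    fix x y assume "(x, y) \<in> ext_rel X Y"
    moreover obtain i p j q where xy: "x = (i, p)" "y = (j, q)" by (metis surj_pair)
    ultimately obtain Z Z' u where S: "ses Y Z X i p" and T: "ses Y Z' X j q"
      and u: "u \<in> Hom Z Z'" "u \<cdot> i = j" "q \<cdot> u = p" unfolding xy ext_rel_iff by blast
    obtain v where "v \<in> Hom Z' Z" "v \<cdot> j = i" "p \<cdot> v = q" using ses_middle_inverse[OF S T u] .
    then show "(y, x) \<in> ext_rel X Y" unfolding xy ext_rel_iff using S T by blast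
  qed
  show "trans (ext_rel X Y)"
  proof (rule transI)
    fix x y z assume r: "(x, y) \<in> ext_rel X Y" "(y, z) \<in> ext_rel X Y"
    obtain i p j q k s where xyz: "x = (i, p)" "y = (j, q)" "z = (k, s)" by (metis surj_pair)
    obtain Z Z' u where S: "ses Y Z X i p" and T: "ses Y Z' X j q"
      and u: "u \<in> Hom Z Z'" "u \<cdot> i = j" "q \<cdot> u = p" using r(1) unfolding xyz ext_rel_iff by blast
    obtain W' W v where T': "ses Y W' X j q" and R: "ses Y W X k s"
      and v': "v \<in> Hom W' W" and v: "v \<cdot> j = k" "s \<cdot> v = q" using r(2) unfolding xyz ext_rel_iff by blast
    have vH: "v \<in> Hom Z' W" using v' ses_same_middle[OF T T'] by simp
    note s = ses_Hom[OF S] ses_Hom[OF R]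
    have "v \<cdot> u \<in> Hom Z W" "(v \<cdot> u) \<cdot> i = k" "s \<cdot> (v \<cdot> u) = p"
      using u vH v(1) Comp_rewrite[OF v(2), of u] s by simp_all
    then show "(x, z) \<in> ext_rel X Y" unfolding xyz ext_rel_iff using S R by blast
  qed
qed

lemma ext_class_ses: "ses Y Z X i p \<Longrightarrow> ext_class i p = ext_rel X Y `` {(i, p)}"
  unfolding ext_class_def using ses_Hom(3,6)[of Y Z X i p] by simp

lemma mem_ext_class:
  assumes "ses Y Z X i p"
  shows "(j, q) \<in> ext_class i p \<longleftrightarrow> (\<exists>Z' u. ses Y Z' X j q \<and> u \<in> Hom Z Z' \<and> u \<cdot> i = j \<and> q \<cdot> u = p)"
  unfolding ext_class_ses[OF assms] Image_singleton_iff ext_rel_iff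
  using assms ses_same_middle by metis

lemma ext_class_self: "ses Y Z X i p \<Longrightarrow> (i, p) \<in> ext_class i p"
  unfolding ext_class_ses using equiv_class_self[OF equiv_ext_rel] extensions_iff by metis

lemma ext_class_eqI:
  assumes "ses Y Z X i p" "ses Y Z' X j q" "u \<in> Hom Z Z'" "u \<cdot> i = j" "q \<cdot> u = p"
  shows "ext_class i p = ext_class j q"
proof -
  have "((i, p), (j, q)) \<in> ext_rel X Y" unfolding ext_rel_iff using assms by blast
  then show ?thesis
    unfolding ext_class_ses[OF assms(1)] ext_class_ses[OF assms(2)] by (rule equiv_class_eq[OF equiv_ext_rel])
qed

lemma ext_class_eqE:
  assumes "ses Y Z X i p" "ses Y' Z' X' j q" "ext_class i p = ext_class j q"
  obtains u where "Y' = Y" "X' = X" "u \<in> Hom Z Z'" "u \<cdot> i = j" "q \<cdot> u = p"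
proof -
  have "(j, q) \<in> ext_class i p" using assms(3) ext_class_self[OF assms(2)] by simp
  then obtain W u where W: "ses Y W X j q" and u: "u \<in> Hom Z W" "u \<cdot> i = j" "q \<cdot> u = p"
    unfolding mem_ext_class[OF assms(1)] by blast
  then show ?thesis using that[of u] ses_Hom[OF W] ses_Hom[OF assms(2)] by simp
qed

lemma ext_class_in_Ext1: "ses Y Z X i p \<Longrightarrow> ext_class i p \<in> Ext1 X Y"
  unfolding Ext1_def ext_class_ses by (rule quotientI) (use extensions_iff in blast)

lemma Ext1E:
  assumes "\<xi> \<in> Ext1 X Y"
  obtains i p Z where "ses Y Z X i p" "\<xi> = ext_class i p"
proof -
  obtain x where "x \<in> extensions X Y" and x: "\<xi> = ext_rel X Y `` {x}"
    using assms unfolding Ext1_def by (rule quotientE)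
  then obtain i p Z where "x = (i, p)" "ses Y Z X i p" using extensions_iff by (metis surj_pair)
  then show ?thesis using that x ext_class_ses by metis
qed

text \<open>\<open>ext_pull\<close> collects all pull-backs of all representatives. They are
  equivalent to one another by \<open>ses_pull_unique\<close>, and anything equivalent to one of
  them is again a pull-back by \<open>ses_pull_is_pullback\<close>; so the collection is exactly one
  class, computed by any morphism of sequences over \<open>f\<close>.\<close>

lemma ext_pull_class:
  assumes S: "ses Y Z X i p" and f: "f \<in> Hom X' X"
    and T: "ses Y P X' j q" "u \<in> Hom P Z" "u \<cdot> j = i" "p \<cdot> u = f \<cdot> q"
  shows "ext_pull f (ext_class i p) = ext_class j q"
proof (intro equalityI subsetI)
  fix x assume "x \<in> ext_pull f (ext_class i p)"
  then obtain j' q' i' p' u' where x: "x = (j', q')" "short_exact j' q'" and ip': "(i', p') \<in> ext_class i p"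
    and pb: "is_pullback p' f u' q'" and d: "Dom A j' = Dom A i'" and uj: "u' \<cdot> j' = i'"
    unfolding ext_pull_def by blast
  obtain Z' v where S': "ses Y Z' X i' p'" and v: "v \<in> Hom Z Z'" "v \<cdot> i = i'" "p' \<cdot> v = p"
    using ip' unfolding mem_ext_class[OF S] by blast
  obtain w where w: "w \<in> Hom Z' Z" "w \<cdot> i' = i" "p \<cdot> w = p'" using ses_middle_inverse[OF S S' v] .
  note s = ses_Hom[OF S] ses_Hom[OF S']
  obtain P' where P': "u' \<in> Hom P' Z'" "q' \<in> Hom P' X'" "p' \<cdot> u' = f \<cdot> q'"
    by (rule pullback_Hom[OF pb _ f, of Z']) (use s in simp_all, blast?)
  obtain Y1 P1 X1 where "ses Y1 P1 X1 j' q'" using short_exactE[OF x(2)] .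
  then have T': "ses Y P' X' j' q'" using ses_Hom[of Y1 P1 X1 j' q'] d s P' by simp
  have u2: "w \<cdot> u' \<in> Hom P' Z" "(w \<cdot> u') \<cdot> j' = i" "p \<cdot> (w \<cdot> u') = f \<cdot> q'"
    using w(1,2) P' uj ses_Hom[OF T'] s Comp_rewrite[OF w(3), of u'] by simp_all
  obtain t where "t \<in> Hom P P'" "t \<cdot> j = j'" "q' \<cdot> t = q"
    using ses_pull_unique[OF S f T T' u2] .
  then show "x \<in> ext_class j q" unfolding x(1) mem_ext_class[OF T(1)] using T' by blast
next
  fix x assume "x \<in> ext_class j q"
  then obtain j' q' P' t where x: "x = (j', q')" and T': "ses Y P' X' j' q'"
    and t: "t \<in> Hom P P'" "t \<cdot> j = j'" "q' \<cdot> t = q"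
    using mem_ext_class[OF T(1)] by (metis surj_pair)
  obtain w where w: "w \<in> Hom P' P" "w \<cdot> j' = j" "q \<cdot> w = q'" using ses_middle_inverse[OF T(1) T' t] .
  note s = ses_Hom[OF S] ses_Hom[OF T'] ses_Hom[OF T(1)]
  have uj: "(u \<cdot> w) \<cdot> j' = i" using w(1,2) T s by simp
  have "p \<cdot> (u \<cdot> w) = f \<cdot> q'"
    using Comp_rewrite[OF T(4), of w] w(1,3) T(2) f s by simp
  then have pb: "is_pullback p f (u \<cdot> w) q'"
    by (intro ses_pull_is_pullback[OF S f T']) (use w(1) T(2) uj in simp_all)
  show "x \<in> ext_pull f (ext_class i p)"
    unfolding ext_pull_def x using ses_short_exact[OF T'] ext_class_self[OF S] pb uj s by force
qed

text \<open>In the opposite category the comparison morphism runs the other way; its inverse from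
  the short five lemma restores the direction.\<close>

lemma op_cat_ext_class: "ses Y Z X i p \<Longrightarrow> cat.ext_class (op_cat A) p i = (ext_class i p)\<inverse>"
proof -
  assume S: "ses Y Z X i p"
  have S': "cat.ses (op_cat A) X Z Y p i" using S by simp
  have "(q, j) \<in> cat.ext_class (op_cat A) p i \<longleftrightarrow> (j, q) \<in> ext_class i p" for j q
  proof -
    have "(q, j) \<in> cat.ext_class (op_cat A) p i \<longleftrightarrow>
        (\<exists>Z' u. ses Y Z' X j q \<and> u \<in> Hom Z' Z \<and> p \<cdot> u = q \<and> u \<cdot> j = i)"
      unfolding abelian_category.mem_ext_class[OF abelian_op_cat S'] by simp
    also have "\<dots> \<longleftrightarrow> (\<exists>Z' u. ses Y Z' X j q \<and> u \<in> Hom Z Z' \<and> u \<cdot> i = j \<and> q \<cdot> u = p)"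
      using ses_middle_inverse[OF S] ses_middle_inverse[OF _ S] by metis
    finally show ?thesis unfolding mem_ext_class[OF S] .
  qed
  then show ?thesis by auto
qed

lemma op_cat_ext_pull: "cat.ext_pull (op_cat A) g (\<xi>\<inverse>) = (ext_push g \<xi>)\<inverse>"
  by (auto simp: cat.ext_pull_def cat.ext_push_def)

lemma ext_push_class:
  assumes "ses Y Z X i p" "g \<in> Hom Y Y'"
    "ses Y' P X j q" "u \<in> Hom Z P" "q \<cdot> u = p" "u \<cdot> i = j \<cdot> g"
  shows "ext_push g (ext_class i p) = ext_class j q"
proof -
  have "cat.ext_pull (op_cat A) g (cat.ext_class (op_cat A) p i) = cat.ext_class (op_cat A) q j"
    by (rule abelian_category.ext_pull_class[OF abelian_op_cat, of X Z Y p i g Y' P q j u])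
      (use assms in simp_all)
  then show ?thesis
    unfolding op_cat_ext_class[OF assms(1)] op_cat_ext_class[OF assms(3)] op_cat_ext_pull by auto
qed

text \<open>A subfunctor is closed under the joint action in both variables. Putting an identity in
  one of them isolates the pull-back, and likewise the push-out in the next lemma.\<close>

lemma Ext1_map_pull:
  assumes "ses Y Z X i p" "f \<in> Hom X' X"
    "ses Y P X' j q" "u \<in> Hom P Z" "u \<cdot> j = i" "p \<cdot> u = f \<cdot> q"
  shows "Ext1_map f (Ide A Y) (ext_class i p) = ext_class j q"
proof -
  note s = ses_Hom[OF assms(3)]
  have "ext_push (Ide A Y) (ext_class j q) = ext_class j q"
    by (rule ext_push_class[OF assms(3) _ assms(3), of _ "Ide A P"]) (use s in simp_all)
  then show ?thesis unfolding Ext1_map_def ext_pull_class[OF assms] .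
qed

lemma Ext1_map_push:
  assumes "ses Y Z X i p" "g \<in> Hom Y Y'"
    "ses Y' P X j q" "u \<in> Hom Z P" "q \<cdot> u = p" "u \<cdot> i = j \<cdot> g"
  shows "Ext1_map (Ide A X) g (ext_class i p) = ext_class j q"
proof -
  note s = ses_Hom[OF assms(1)]
  have "ext_pull (Ide A X) (ext_class i p) = ext_class i p"
    by (rule ext_pull_class[OF assms(1) _ assms(1), of _ "Ide A Z"]) (use s in simp_all)
  then show ?thesis unfolding Ext1_map_def by (simp only: ext_push_class[OF assms])
qed

section \<open>Biproducts, split extensions and direct sums of extensions\<close>

lemma is_biproduct_biprod:
  assumes "X \<in> Ob A" "Y \<in> Ob A"
  shows "is_biproduct X Y (Cod A (inl X Y)) (inl X Y) (inr X Y) (prl X Y) (prr X Y)"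
proof -
  obtain P i1 i2 p1 p2 where "is_biproduct X Y P i1 i2 p1 p2" using biproduct_exists[OF assms] by blast
  then have "case (i1, i2, p1, p2) of (i1, i2, p1, p2) \<Rightarrow> \<exists>P. is_biproduct X Y P i1 i2 p1 p2"
    unfolding prod.case by blast
  then have "case biprod X Y of (i1, i2, p1, p2) \<Rightarrow> \<exists>P. is_biproduct X Y P i1 i2 p1 p2"
    unfolding biprod_def by (rule someI)
  then obtain P where P: "is_biproduct X Y P (inl X Y) (inr X Y) (prl X Y) (prr X Y)"
    unfolding inl_def inr_def prl_def prr_def case_prod_beta by blast
  have "Cod A (inl X Y) = P" using biproduct_simps(9)[OF P] .
  then show ?thesis using P by simp
qed

lemma biproduct_ses:
  assumes "is_biproduct X Y P i1 i2 p1 p2"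
  shows "ses X P Y i1 p2"
proof (rule ses_of_epi)
  note b = biproduct_simps[OF assms]
  show H: "i1 \<in> Hom X P" "p2 \<in> Hom P Y" using b by simp_all
  show "is_epi p2"
    by (rule is_epi_of_comp[of p2 i2 Y P Y]) (use b is_epi_Ide in simp_all)
  have "is_mono (p1 \<cdot> i1)" unfolding b(16) by (subst is_mono_iff[of _ X X]) (use b in simp_all)
  then have m: "is_mono i1" by (rule is_mono_of_comp[of p1 i1 X P X]) (use b in simp_all)
  show "is_kernel p2 i1"
  proof (rule is_kernelI[OF m H])
    show "p2 \<cdot> i1 = Zero A X Y" by (rule b)
    fix W h assume h: "h \<in> Hom W P" "p2 \<cdot> h = Zero A W Y"
    have "i1 \<cdot> (p1 \<cdot> h) = h" 
      by (rule biproduct_eqI_to[OF assms, where W=W]) (use h b in simp_all)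
    then show "\<exists>u\<in>Hom W X. i1 \<cdot> u = h" using h b by (intro bexI[of _ "p1 \<cdot> h"]) simp_all
  qed
qed

text \<open>A comparison morphism out of the biproduct is determined by its two components: the
  first must be \<open>i\<close>, the second is a section of \<open>p\<close>.\<close>

lemma ext_class_trivial_iff:
  assumes S: "ses Y Z X i p"
  shows "ext_class i p = ext_class (inl Y X) (prr Y X) \<longleftrightarrow> (\<exists>t\<in>Hom X Z. p \<cdot> t = Ide A X)"
proof
  note s = ses_Hom[OF S]
  have B: "is_biproduct Y X (Cod A (inl Y X)) (inl Y X) (inr Y X) (prl Y X) (prr Y X)"
    using is_biproduct_biprod s by blast
  note b = biproduct_simps[OF B]
  note T = biproduct_ses[OF B]
  {
    assume "ext_class i p = ext_class (inl Y X) (prr Y X)"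
    then obtain u where u: "u \<in> Hom (Cod A (inl Y X)) Z" "p \<cdot> u = prr Y X"
      using ext_class_eqE[OF T S] by metis
    have "p \<cdot> (u \<cdot> inr Y X) = Ide A X" using Comp_rewrite[OF u(2), of "inr Y X"] u(1) b s by simp
    then show "\<exists>t\<in>Hom X Z. p \<cdot> t = Ide A X" using u(1) b by (intro bexI[of _ "u \<cdot> inr Y X"]) simp_all
  next
    assume "\<exists>t\<in>Hom X Z. p \<cdot> t = Ide A X"
    then obtain t where t: "t \<in> Hom X Z" "p \<cdot> t = Ide A X" by blast
    let ?u = "(i \<cdot> prl Y X) \<boxplus> (t \<cdot> prr Y X)"
    have u: "?u \<in> Hom (Cod A (inl Y X)) Z" "?u \<cdot> inl Y X = i"
      using b s t(1) by simp_all
    have "p \<cdot> (i \<cdot> prl Y X) = Zero A (Cod A (inl Y X)) X" by (rule ses_Comp_Comp[OF S]) (use b in simp)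
    moreover have "p \<cdot> (t \<cdot> prr Y X) = prr Y X" using Comp_rewrite[OF t(2), of "prr Y X"] b s t(1) by simp
    ultimately have "p \<cdot> ?u = prr Y X" using b s t(1) by simp
    then show "ext_class i p = ext_class (inl Y X) (prr Y X)"
      using ext_class_eqI[OF T S u] by simp
  }
qed

lemma ext_class_trivial_iff_retract:
  assumes S: "ses Y Z X i p"
  shows "ext_class i p = ext_class (inl Y X) (prr Y X) \<longleftrightarrow> (\<exists>r\<in>Hom Z Y. r \<cdot> i = Ide A Y)"
proof -
  have S': "cat.ses (op_cat A) X Z Y p i" using S by simp
  have "(\<exists>t\<in>Hom X Z. p \<cdot> t = Ide A X) \<longleftrightarrow> (\<exists>r\<in>Hom Z Y. r \<cdot> i = Ide A Y)"
  proof
    assume "\<exists>t\<in>Hom X Z. p \<cdot> t = Ide A X"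
    then obtain t r where B: "is_biproduct Y X Z i t r p" using ses_split_biproduct[OF S] by blast
    then show "\<exists>r\<in>Hom Z Y. r \<cdot> i = Ide A Y" using biproduct_simps[OF B] by (intro bexI[of _ r]) simp_all
  next
    assume "\<exists>r\<in>Hom Z Y. r \<cdot> i = Ide A Y"
    then obtain r where r: "r \<in> Hom Z Y" "r \<cdot> i = Ide A Y" by blast
    obtain t where B: "is_biproduct X Y Z t i p r"
      by (rule abelian_category.ses_split_biproduct[OF abelian_op_cat S', of r]) (use r in simp_all, blast?)
    show "\<exists>t\<in>Hom X Z. p \<cdot> t = Ide A X" using biproduct_simps[OF B] by (intro bexI[of _ t]) simp_all
  qed
  then show ?thesis unfolding ext_class_trivial_iff[OF S] .
qed

end

abbreviation (in cat) sum_ob :: "'o \<Rightarrow> 'o \<Rightarrow> 'o" where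
  "sum_ob X Y \<equiv> Cod A (inl X Y)"

context abelian_category
begin

text \<open>Stated for arbitrary biproduct data because of the dual: the biproduct chosen by
  \<open>biprod\<close> in the opposite category may differ from the one chosen in \<open>A\<close>,
  so a version about \<open>dsum\<close> would not dualise to cokernels.\<close>

lemma biproduct_kernel:
  assumes B1: "is_biproduct Y Y' BY a1 a2 b1 b2" and B2: "is_biproduct Z Z' BZ c1 c2 d1 d2"
    and B3: "is_biproduct X X' BX e1 e2 f1 f2"
    and S: "is_kernel p i" "i \<in> Hom Y Z" "p \<in> Hom Z X" and T: "is_kernel q j" "j \<in> Hom Y' Z'" "q \<in> Hom Z' X'"
  shows "is_kernel ((e1 \<cdot> (p \<cdot> d1)) \<boxplus> (e2 \<cdot> (q \<cdot> d2))) ((c1 \<cdot> (i \<cdot> b1)) \<boxplus> (c2 \<cdot> (j \<cdot> b2)))"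
    (is "is_kernel ?Q ?K")
proof -
  note b1 = biproduct_simps[OF B1] and b2 = biproduct_simps[OF B2] and b3 = biproduct_simps[OF B3]
  have pi: "p \<cdot> i = Zero A Y X" "q \<cdot> j = Zero A Y' X'"
    using is_kernel_Comp[OF S(1)] is_kernel_Comp[OF T(1)] S(2,3) T(2,3) by simp_all
  have K: "?K \<in> Hom BY BZ" and Q: "?Q \<in> Hom BZ BX" using b1(1-15) b2(1-15) b3(1-15) S(2,3) T(2,3) by simp_all
  have dK: "d1 \<cdot> ?K = i \<cdot> b1" "d2 \<cdot> ?K = j \<cdot> b2"
    using b1(1-15) b2(1-24) S(2) T(2) by simp_all
  have fQ: "f1 \<cdot> ?Q = p \<cdot> d1" "f2 \<cdot> ?Q = q \<cdot> d2"
    using b2(1-15) b3(1-24) S(3) T(3) by simp_all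
  show ?thesis
  proof (rule is_kernelI[OF _ K Q])
    show "is_mono ?K"
    proof (subst is_mono_iff[OF K], intro allI ballI impI)
      fix W h assume h: "h \<in> Hom W BY" "?K \<cdot> h = Zero A W BZ"
      have "i \<cdot> (b1 \<cdot> h) = d1 \<cdot> (?K \<cdot> h)" "j \<cdot> (b2 \<cdot> h) = d2 \<cdot> (?K \<cdot> h)"
        using Comp_rewrite[OF dK(1), of h] Comp_rewrite[OF dK(2), of h] h(1) K b1(1-15) b2(1-15) S(2) T(2)
        by simp_all
      then have "i \<cdot> (b1 \<cdot> h) = Zero A W Z" "j \<cdot> (b2 \<cdot> h) = Zero A W Z'"
        unfolding h(2) using h(1) b2(1-15) by simp_all
      then have "b1 \<cdot> h = Zero A W Y" "b2 \<cdot> h = Zero A W Y'"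
        using is_mono_iff[OF S(2)] is_mono_iff[OF T(2)] is_kernel_mono[OF S(1)] is_kernel_mono[OF T(1)]
          h(1) b1(1-15) by simp_all
      then show "h = Zero A W BY"
        by (intro biproduct_eqI_to[OF B1 h(1)]) (use h(1) b1(1-15) in simp_all)
    qed
    have Kd: "d1 \<cdot> ?K \<in> Hom BY Z" "d2 \<cdot> ?K \<in> Hom BY Z'" using K b2(1-15) by simp_all
    show "?Q \<cdot> ?K = Zero A BY BX"
    proof (rule biproduct_eqI_to[OF B3, where W=BY])
      show "f1 \<cdot> (?Q \<cdot> ?K) = f1 \<cdot> Zero A BY BX"
        using Comp_rewrite[OF fQ(1), of ?K] Comp_rewrite[OF pi(1), of b1] dK(1) K Q b1(1-15) b2(1-15) b3(1-15) S(2,3)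
        by (simp del: Comp_distrib)
      show "f2 \<cdot> (?Q \<cdot> ?K) = f2 \<cdot> Zero A BY BX"
        using Comp_rewrite[OF fQ(2), of ?K] Comp_rewrite[OF pi(2), of b2] dK(2) K Q b1(1-15) b2(1-15) b3(1-15) T(2,3)
        by (simp del: Comp_distrib)
    qed (use K Q b1(3) b3(3) in \<open>simp_all del: Comp_distrib\<close>)
    fix W h assume h: "h \<in> Hom W BZ" "?Q \<cdot> h = Zero A W BX"
    have "p \<cdot> (d1 \<cdot> h) = f1 \<cdot> (?Q \<cdot> h)" "q \<cdot> (d2 \<cdot> h) = f2 \<cdot> (?Q \<cdot> h)"
      using Comp_rewrite[OF fQ(1), of h] Comp_rewrite[OF fQ(2), of h] h(1) Q b2(1-15) b3(1-15) S(3) T(3)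
      by simp_all
    then have z: "p \<cdot> (d1 \<cdot> h) = Zero A W X" "q \<cdot> (d2 \<cdot> h) = Zero A W X'"
      unfolding h(2) using h(1) b3(1-15) by simp_all
    have dh: "d1 \<cdot> h \<in> Hom W Z" "d2 \<cdot> h \<in> Hom W Z'" using h(1) b2(1-15) by simp_all
    obtain y where y: "y \<in> Hom W Y" "i \<cdot> y = d1 \<cdot> h" using is_kernel_lift[OF S(1-3) dh(1) z(1)] .
    obtain y' where y': "y' \<in> Hom W Y'" "j \<cdot> y' = d2 \<cdot> h" using is_kernel_lift[OF T(1-3) dh(2) z(2)] .
    let ?w = "(a1 \<cdot> y) \<boxplus> (a2 \<cdot> y')"
    have w: "?w \<in> Hom W BY" "b1 \<cdot> ?w = y" "b2 \<cdot> ?w = y'" using y(1) y'(1) b1(1-24) by simp_all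
    have "?K \<cdot> ?w = h"
    proof (rule biproduct_eqI_to[OF B2, where W=W])
      show "d1 \<cdot> (?K \<cdot> ?w) = d1 \<cdot> h"
        using Comp_rewrite[OF dK(1), of ?w] w K b1(1-15) b2(1-15) S(2) y(2) by (simp del: Comp_distrib)
      show "d2 \<cdot> (?K \<cdot> ?w) = d2 \<cdot> h"
        using Comp_rewrite[OF dK(2), of ?w] w K b1(1-15) b2(1-15) T(2) y'(2) by (simp del: Comp_distrib)
    qed (use K w h(1) in \<open>simp_all del: Comp_distrib\<close>)
    then show "\<exists>u\<in>Hom W BY. ?K \<cdot> u = h" using w(1) by blast
  qed
qed

lemma biproduct_cokernel:
  assumes B1: "is_biproduct Y Y' BY a1 a2 b1 b2" and B2: "is_biproduct Z Z' BZ c1 c2 d1 d2"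
    and B3: "is_biproduct X X' BX e1 e2 f1 f2"
    and S: "is_cokernel i p" "i \<in> Hom Y Z" "p \<in> Hom Z X" and T: "is_cokernel j q" "j \<in> Hom Y' Z'" "q \<in> Hom Z' X'"
  shows "is_cokernel ((c1 \<cdot> (i \<cdot> b1)) \<boxplus> (c2 \<cdot> (j \<cdot> b2))) ((e1 \<cdot> (p \<cdot> d1)) \<boxplus> (e2 \<cdot> (q \<cdot> d2)))"
proof -
  note b1 = biproduct_simps[OF B1] and b2 = biproduct_simps[OF B2] and b3 = biproduct_simps[OF B3]
  have "is_cokernel (((c1 \<cdot> i) \<cdot> b1) \<boxplus> ((c2 \<cdot> j) \<cdot> b2)) (((e1 \<cdot> p) \<cdot> d1) \<boxplus> ((e2 \<cdot> q) \<cdot> d2))"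
    using abelian_category.biproduct_kernel[OF abelian_op_cat, of X X' BX f1 f2 e1 e2 Z Z' BZ d1 d2 c1 c2
        Y Y' BY b1 b2 a1 a2 i p j q]
    unfolding op_cat_simps op_cat_notions using assms by blast
  then show ?thesis using S(2,3) T(2,3) b1(1-15) b2(1-15) b3(1-15) by simp
qed

lemma dsum_eq:
  assumes "f \<in> Hom X Y" "g \<in> Hom X' Y'"
  shows "dsum f g = (inl Y Y' \<cdot> (f \<cdot> prl X X')) \<boxplus> (inr Y Y' \<cdot> (g \<cdot> prr X X'))"
  unfolding dsum_def
  using assms biproduct_simps[OF is_biproduct_biprod[of X X']] biproduct_simps[OF is_biproduct_biprod[of Y Y']]
  by simp

lemma dsum_simps:
  assumes f: "f \<in> Hom X Y" and g: "g \<in> Hom X' Y'"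
  shows "dsum f g \<in> Hom (sum_ob X X') (sum_ob Y Y')"
    "prl Y Y' \<cdot> dsum f g = f \<cdot> prl X X'" "prr Y Y' \<cdot> dsum f g = g \<cdot> prr X X'"
    "dsum f g \<cdot> inl X X' = inl Y Y' \<cdot> f" "dsum f g \<cdot> inr X X' = inr Y Y' \<cdot> g"
proof -
  have "X \<in> Ob A" "X' \<in> Ob A" "Y \<in> Ob A" "Y' \<in> Ob A" using f g by simp_all
  note b = biproduct_simps(1-24)[OF is_biproduct_biprod[OF this(1,2)]]
    biproduct_simps(1-24)[OF is_biproduct_biprod[OF this(3,4)]]
  show "dsum f g \<in> Hom (sum_ob X X') (sum_ob Y Y')"
    "prl Y Y' \<cdot> dsum f g = f \<cdot> prl X X'" "prr Y Y' \<cdot> dsum f g = g \<cdot> prr X X'"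
    "dsum f g \<cdot> inl X X' = inl Y Y' \<cdot> f" "dsum f g \<cdot> inr X X' = inr Y Y' \<cdot> g"
    unfolding dsum_eq[OF f g] using f g b by simp_all
qed

lemma dsum_Comp:
  assumes "f \<in> Hom X Y" "g \<in> Hom X' Y'" "h \<in> Hom Y Z" "k \<in> Hom Y' Z'"
  shows "dsum h k \<cdot> dsum f g = dsum (h \<cdot> f) (k \<cdot> g)"
proof (rule biproduct_eqI_to[OF is_biproduct_biprod])
  have hf: "h \<cdot> f \<in> Hom X Z" "k \<cdot> g \<in> Hom X' Z'" using assms by simp_all
  have "X \<in> Ob A" "X' \<in> Ob A" "Y \<in> Ob A" "Y' \<in> Ob A" and Z: "Z \<in> Ob A" "Z' \<in> Ob A" using assms by simp_all
  note b = biproduct_simps(1-15)[OF is_biproduct_biprod[OF this(1,2)]]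
    biproduct_simps(1-15)[OF is_biproduct_biprod[OF this(3,4)]]
    biproduct_simps(1-15)[OF is_biproduct_biprod[OF this(5,6)]]
  note d1 = dsum_simps[OF assms(1,2)] and d2 = dsum_simps[OF assms(3,4)] and d3 = dsum_simps[OF hf]
  show "Z \<in> Ob A" "Z' \<in> Ob A" by (rule Z)+
  show "dsum h k \<cdot> dsum f g \<in> Hom (sum_ob X X') (sum_ob Z Z')" using d1(1) d2(1) by simp
  show "dsum (h \<cdot> f) (k \<cdot> g) \<in> Hom (sum_ob X X') (sum_ob Z Z')" using d3(1) .
  show "prl Z Z' \<cdot> (dsum h k \<cdot> dsum f g) = prl Z Z' \<cdot> dsum (h \<cdot> f) (k \<cdot> g)"
    using Comp_rewrite[OF d2(2), of "dsum f g"] d1(1,2) d2(1) d3(2) b assms by simp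
  show "prr Z Z' \<cdot> (dsum h k \<cdot> dsum f g) = prr Z Z' \<cdot> dsum (h \<cdot> f) (k \<cdot> g)"
    using Comp_rewrite[OF d2(3), of "dsum f g"] d1(1,3) d2(1) d3(3) b assms by simp
qed

lemma dsum_ses:
  assumes S: "ses Y Z X i p" and T: "ses Y' Z' X' j q"
  shows "ses (sum_ob Y Y') (sum_ob Z Z') (sum_ob X X') (dsum i j) (dsum p q)"
proof -
  note s = ses_Hom[OF S] and t = ses_Hom[OF T]
  have H: "i \<in> Hom Y Z" "p \<in> Hom Z X" "j \<in> Hom Y' Z'" "q \<in> Hom Z' X'" using s t by simp_all
  note B = is_biproduct_biprod[OF s(8) t(8)] is_biproduct_biprod[OF s(9) t(9)] is_biproduct_biprod[OF s(7) t(7)]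
  show ?thesis
    unfolding ses_def
    using biproduct_kernel[OF B s(13) H(1,2) t(13) H(3,4)] biproduct_cokernel[OF B s(14) H(1,2) t(14) H(3,4)]
      dsum_simps(1)[OF H(1,3)] dsum_simps(1)[OF H(2,4)]
    unfolding dsum_eq[OF H(1,3)] dsum_eq[OF H(2,4)] by blast
qed

text \<open>\<open>ext_dsum\<close> is a union over all representatives. Direct sums of comparison
  morphisms are comparison morphisms, so all members of the union are the same class.\<close>

lemma ext_dsum_class:
  assumes S: "ses Y Z X i p" and T: "ses Y' Z' X' j q"
  shows "ext_dsum (ext_class i p) (ext_class j q) = ext_class (dsum i j) (dsum p q)"
proof -
  have eq: "ext_class (dsum i' j') (dsum p' q') = ext_class (dsum i j) (dsum p q)"
    if i': "(i', p') \<in> ext_class i p" and j': "(j', q') \<in> ext_class j q" for i' p' j' q'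
  proof -
    obtain W u where S': "ses Y W X i' p'" and u: "u \<in> Hom Z W" "u \<cdot> i = i'" "p' \<cdot> u = p"
      using i' unfolding mem_ext_class[OF S] by blast
    obtain W' v where T': "ses Y' W' X' j' q'" and v: "v \<in> Hom Z' W'" "v \<cdot> j = j'" "q' \<cdot> v = q"
      using j' unfolding mem_ext_class[OF T] by blast
    note s = ses_Hom[OF S] ses_Hom[OF S'] and t = ses_Hom[OF T] ses_Hom[OF T']
    have "dsum u v \<in> Hom (sum_ob Z Z') (sum_ob W W')" by (rule dsum_simps(1)[OF u(1) v(1)])
    moreover have "dsum u v \<cdot> dsum i j = dsum i' j'"
      by (subst dsum_Comp[of i Y Z j Y' Z' u W v W']) (use s t u v in simp_all)
    moreover have "dsum p' q' \<cdot> dsum u v = dsum p q"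
      by (subst dsum_Comp[of u Z W v Z' W' p' X q' X']) (use s t u v in simp_all)
    ultimately show ?thesis
      using ext_class_eqI[OF dsum_ses[OF S T] dsum_ses[OF S' T']] by metis
  qed
  show ?thesis unfolding ext_dsum_def
    using eq ext_class_self[OF S] ext_class_self[OF T] by (intro equalityI) (fast, fast)
qed

section \<open>The Baer sum and its inverses\<close>

lemma diagonal_simps:
  assumes "X \<in> Ob A"
  shows "diagonal X \<in> Hom X (sum_ob X X)" "prl X X \<cdot> diagonal X = Ide A X" "prr X X \<cdot> diagonal X = Ide A X"
  unfolding diagonal_def using biproduct_simps(1-24)[OF is_biproduct_biprod[OF assms assms]] by simp_all

lemma codiagonal_simps:
  assumes "X \<in> Ob A"
  shows "codiagonal X \<in> Hom (sum_ob X X) X" "codiagonal X \<cdot> inl X X = Ide A X" "codiagonal X \<cdot> inr X X = Ide A X"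
  unfolding codiagonal_def using biproduct_simps(1-24)[OF is_biproduct_biprod[OF assms assms]] by simp_all

lemma baer_sum_eqI:
  assumes S: "ses Y Z X i p" and T: "ses Y W X j q"
    and P: "ses (sum_ob Y Y) P X a b" "u \<in> Hom P (sum_ob Z W)" "u \<cdot> a = dsum i j" "dsum p q \<cdot> u = diagonal X \<cdot> b"
    and V: "ses Y V X k s" "t \<in> Hom P V" "s \<cdot> t = b" "t \<cdot> a = k \<cdot> codiagonal Y"
  shows "baer_sum X Y (ext_class i p) (ext_class j q) = ext_class k s"
proof -
  note o = ses_Hom(7,8)[OF S]
  show ?thesis
    unfolding baer_sum_def Ext1_map_def ext_dsum_class[OF S T]
    unfolding ext_pull_class[OF dsum_ses[OF S T] diagonal_simps(1)[OF o(1)] P]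
    by (rule ext_push_class[OF P(1) codiagonal_simps(1)[OF o(2)] V])
qed

lemma baer_sumE:
  assumes S: "ses Y Z X i p" and T: "ses Y W X j q"
  obtains P a b u V k s t where
    "ses (sum_ob Y Y) P X a b" "u \<in> Hom P (sum_ob Z W)" "u \<cdot> a = dsum i j" "dsum p q \<cdot> u = diagonal X \<cdot> b"
    "ses Y V X k s" "t \<in> Hom P V" "s \<cdot> t = b" "t \<cdot> a = k \<cdot> codiagonal Y"
    "baer_sum X Y (ext_class i p) (ext_class j q) = ext_class k s"
proof -
  note o = ses_Hom(7,8)[OF S]
  obtain P u a b where P: "ses (sum_ob Y Y) P X a b" "u \<in> Hom P (sum_ob Z W)" "u \<cdot> a = dsum i j"
    "dsum p q \<cdot> u = diagonal X \<cdot> b"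
    using ses_pull[OF dsum_ses[OF S T] diagonal_simps(1)[OF o(1)]] by metis
  obtain V t k s where V: "ses Y V X k s" "t \<in> Hom P V" "s \<cdot> t = b" "t \<cdot> a = k \<cdot> codiagonal Y"
    using ses_push[OF P(1) codiagonal_simps(1)[OF o(2)]] by metis
  show ?thesis using that[OF P V] baer_sum_eqI[OF S T P V] by blast
qed

text \<open>The representative of the inverse class. Since \<open>p\<close> is left untouched, every
  lifting property of the sequence passes to the inverse.\<close>

lemma ses_neg:
  assumes S: "ses Y Z X i p"
  shows "ses Y Z X (neg i) p"
proof (rule ses_of_epi)
  note s = ses_Hom[OF S]
  show p: "p \<in> Hom Z X" and n: "neg i \<in> Hom Y Z" and "is_epi p" using s by simp_all
  have "is_mono (neg i)"
  proof (subst is_mono_iff[OF n], intro allI ballI impI)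
    fix W h assume h: "h \<in> Hom W Y" "neg i \<cdot> h = Zero A W Z"
    then have "neg (neg (i \<cdot> h)) = neg (Zero A W Z)" using s by simp
    then have "i \<cdot> h = Zero A W Z" using h(1) s by simp
    then show "h = Zero A W Y" using is_mono_iff[of i Y Z] s h(1) by simp
  qed
  then show "is_kernel p (neg i)"
  proof (rule is_kernelI[OF _ n p])
    show "p \<cdot> neg i = Zero A Y X" using s by simp
    fix W h assume h: "h \<in> Hom W Z" "p \<cdot> h = Zero A W X"
    obtain u where u: "u \<in> Hom W Y" "i \<cdot> u = h" using ses_lift[OF S h] .
    have "neg i \<cdot> neg u = h" using u h(1) s by simp
    then show "\<exists>u\<in>Hom W Y. neg i \<cdot> u = h" using u(1) by (intro bexI[of _ "neg u"]) simp_all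
  qed
qed

text \<open>The pull-back of \<open>Z + W\<close> along the diagonal is the fibre product of
  \<open>Z\<close> and \<open>W\<close> over \<open>X\<close>. These are its two projections,
  together with their restrictions to \<open>Y + Y\<close>.\<close>

lemma baer_sum_projections:
  assumes S: "ses Y Z X i p" and T: "ses Y W X j q"
    and P: "ses (sum_ob Y Y) P X a b" "u \<in> Hom P (sum_ob Z W)" "u \<cdot> a = dsum i j" "dsum p q \<cdot> u = diagonal X \<cdot> b"
  shows "prl Z W \<cdot> u \<in> Hom P Z" "(prl Z W \<cdot> u) \<cdot> a = i \<cdot> prl Y Y" "p \<cdot> (prl Z W \<cdot> u) = b"
    "prr Z W \<cdot> u \<in> Hom P W" "(prr Z W \<cdot> u) \<cdot> a = j \<cdot> prr Y Y" "q \<cdot> (prr Z W \<cdot> u) = b"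
proof -
  note s = ses_Hom[OF S] and t = ses_Hom[OF T] and r = ses_Hom[OF P(1)]
  have H: "i \<in> Hom Y Z" "p \<in> Hom Z X" "j \<in> Hom Y W" "q \<in> Hom W X" using s t by simp_all
  note d1 = dsum_simps[OF H(1,3)] and d2 = dsum_simps[OF H(2,4)]
  note b1 = biproduct_simps(1-15)[OF is_biproduct_biprod[OF s(9) t(9)]]
  note b2 = biproduct_simps(1-15)[OF is_biproduct_biprod[OF s(7) s(7)]]
  note D = diagonal_simps[OF s(7)]
  show "prl Z W \<cdot> u \<in> Hom P Z" "prr Z W \<cdot> u \<in> Hom P W" using b1 P(2) by simp_all
  show "(prl Z W \<cdot> u) \<cdot> a = i \<cdot> prl Y Y" "(prr Z W \<cdot> u) \<cdot> a = j \<cdot> prr Y Y"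
    using b1 P(2,3) r d1(2,3) by simp_all
  have "p \<cdot> (prl Z W \<cdot> u) = (prl X X \<cdot> dsum p q) \<cdot> u" unfolding d2(2) using b1 P(2) H by simp
  also have "\<dots> = prl X X \<cdot> (diagonal X \<cdot> b)" using b2 P(2,4) d2(1) by simp
  also have "\<dots> = b" using Comp_rewrite[OF D(2), of b] D(1) b2 r by simp
  finally show "p \<cdot> (prl Z W \<cdot> u) = b" .
  have "q \<cdot> (prr Z W \<cdot> u) = (prr X X \<cdot> dsum p q) \<cdot> u" unfolding d2(3) using b1 P(2) H by simp
  also have "\<dots> = prr X X \<cdot> (diagonal X \<cdot> b)" using b2 P(2,4) d2(1) by simp
  also have "\<dots> = b" using Comp_rewrite[OF D(3), of b] D(1) b2 r by simp
  finally show "q \<cdot> (prr Z W \<cdot> u) = b" .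
qed

text \<open>The difference of the two projections of the fibre product \<open>P\<close> is killed by
  \<open>p\<close>, so it lands in \<open>Y\<close> as a morphism \<open>d\<close>; the sign in
  \<open>neg i\<close> makes its restriction to \<open>Y + Y\<close> the codiagonal. With
  \<open>d\<close> and \<open>b\<close> as components, \<open>P\<close> maps to
  \<open>Y + X\<close>, which exhibits the split sequence as the push-out along the
  codiagonal.\<close>

lemma baer_sum_neg:
  assumes S: "ses Y Z X i p"
  shows "baer_sum X Y (ext_class i p) (ext_class (neg i) p) = ext_class (inl Y X) (prr Y X)"
proof -
  note s = ses_Hom[OF S]
  have i: "i \<in> Hom Y Z" using s by simp
  note S' = ses_neg[OF S]
  obtain P a b u where P: "ses (sum_ob Y Y) P X a b" "u \<in> Hom P (sum_ob Z Z)" "u \<cdot> a = dsum i (neg i)"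
    "dsum p p \<cdot> u = diagonal X \<cdot> b" using baer_sumE[OF S S'] by metis
  note r = ses_Hom[OF P(1)] and pr = baer_sum_projections[OF S S' P]
  have B: "is_biproduct Y X (sum_ob Y X) (inl Y X) (inr Y X) (prl Y X) (prr Y X)"
    using is_biproduct_biprod s by blast
  note b = biproduct_simps(1-24)[OF B] and bY = biproduct_simps(1-15)[OF is_biproduct_biprod[OF s(8) s(8)]]
  note c = codiagonal_simps[OF s(8)]
  define x y where "x = prl Z Z \<cdot> u" and "y = prr Z Z \<cdot> u"
  note pr = pr[folded x_def y_def]
  obtain d where d: "d \<in> Hom P Y" "i \<cdot> d = x \<boxplus> neg y"
    by (rule ses_lift[OF S, of "x \<boxplus> neg y" P]) (use pr s r in simp_all, blast?)
  have "i \<cdot> (d \<cdot> a) = (x \<boxplus> neg y) \<cdot> a" by (rule Comp_rewrite[OF d(2)]) (use d(1) s r in simp_all)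
  also have "\<dots> = i \<cdot> codiagonal Y"
    unfolding codiagonal_def using pr(1,2,4,5) r s bY by simp
  finally have da: "d \<cdot> a = codiagonal Y"
    by (rule is_mono_cancel[OF s(11) i, rotated 2]) (use d(1) r c(1) in simp_all)
  let ?t = "(inl Y X \<cdot> d) \<boxplus> (inr Y X \<cdot> b)"
  have "?t \<in> Hom P (sum_ob Y X)" "prr Y X \<cdot> ?t = b" using b d(1) r by simp_all
  moreover have "?t \<cdot> a = inl Y X \<cdot> codiagonal Y" using b d(1) r da c(1) by simp
  ultimately show ?thesis by (rule baer_sum_eqI[OF S S' P biproduct_ses[OF B]])
qed

text \<open>Both \<open>(j, q)\<close> and \<open>(- i, p)\<close> turn out to be push-outs along the second projection \<open>Y \<oplus> Y \<rightarrow> Y\<close> of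
  the extension by \<open>Y \<oplus> Y\<close> that defines the Baer sum. Together with the previous lemma this gives
  inverses in \<open>Ext1_group\<close> without any use of associativity.\<close>

lemma baer_sum_trivial:
  assumes S: "ses Y Z X i p" and T: "ses Y W X j q"
    and e: "baer_sum X Y (ext_class i p) (ext_class j q) = ext_class (inl Y X) (prr Y X)"
  shows "ext_class j q = ext_class (neg i) p"
proof -
  note s = ses_Hom[OF S] and t = ses_Hom[OF T]
  have i: "i \<in> Hom Y Z" using s by simp
  obtain P a b u V k l v where P: "ses (sum_ob Y Y) P X a b" "u \<in> Hom P (sum_ob Z W)" "u \<cdot> a = dsum i j"
      "dsum p q \<cdot> u = diagonal X \<cdot> b"
    and V: "ses Y V X k l" "v \<in> Hom P V" "l \<cdot> v = b" "v \<cdot> a = k \<cdot> codiagonal Y"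
    and kl: "baer_sum X Y (ext_class i p) (ext_class j q) = ext_class k l"
    by (rule baer_sumE[OF S T])
  note r = ses_Hom[OF P(1)] and r' = ses_Hom[OF V(1)] and pr = baer_sum_projections[OF S T P]
  note c = codiagonal_simps[OF s(8)]
  note bY = biproduct_simps(1-24)[OF is_biproduct_biprod[OF s(8) s(8)]]
  define x y where "x = prl Z W \<cdot> u" and "y = prr Z W \<cdot> u"
  note pr = pr[folded x_def y_def]
  \<comment> \<open>A trivial Baer sum splits, so \<open>k\<close> has a retraction
    \<open>m\<close>; then \<open>m \<cdot> v\<close> extends the codiagonal from
    \<open>Y + Y\<close> to all of \<open>P\<close>.\<close>
  obtain m where m: "m \<in> Hom V Y" "m \<cdot> k = Ide A Y"
    using ext_class_trivial_iff_retract[OF V(1)] e kl by auto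
  have mva: "(m \<cdot> v) \<cdot> a = codiagonal Y"
    using Comp_rewrite[OF m(2), of "codiagonal Y"] m(1) V(2,4) r r' c(1) by simp
  define z where "z = m \<cdot> v"
  have z: "z \<in> Hom P Y" "z \<cdot> a = codiagonal Y" using mva m(1) V(2) by (simp_all add: z_def)
  \<comment> \<open>Subtracting \<open>i \<cdot> z\<close> keeps the composite with \<open>p\<close>
    and changes the restriction to \<open>Y + Y\<close> from \<open>i \<cdot> prl\<close> to
    \<open>i \<cdot> prl - i \<cdot> (prl + prr) = - i \<cdot> prr\<close>, so that
    \<open>?w\<close> now lies over the second projection.\<close>
  let ?w = "x \<boxplus> neg (i \<cdot> z)"
  have w: "?w \<in> Hom P Z" using pr(1) z(1) i by simp
  have piz: "p \<cdot> (i \<cdot> z) = Zero A P X" by (rule ses_Comp_Comp[OF S z(1)])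
  have pw: "p \<cdot> ?w = b" using pr(1,3) z(1) s piz r by simp
  have wa: "?w \<cdot> a = neg i \<cdot> prr Y Y"
  proof (rule biproduct_eqI_from[OF is_biproduct_biprod[OF s(8) s(8)], where W=Z])
    have "?w \<cdot> a = (i \<cdot> prl Y Y) \<boxplus> neg (i \<cdot> codiagonal Y)" using pr(1,2) z i r by simp
    then show "(?w \<cdot> a) \<cdot> inl Y Y = (neg i \<cdot> prr Y Y) \<cdot> inl Y Y"
      "(?w \<cdot> a) \<cdot> inr Y Y = (neg i \<cdot> prr Y Y) \<cdot> inr Y Y"
      using i c bY by simp_all
  qed (use w r i bY in simp_all)
  have prY: "prr Y Y \<in> Hom (sum_ob Y Y) Y" using bY by simp
  obtain h where "h \<in> Hom W Z" "h \<cdot> j = neg i" "p \<cdot> h = q"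
    by (rule ses_push_unique[OF P(1) prY T pr(4) pr(6) pr(5) ses_neg[OF S] w pw wa])
  then show ?thesis by (rule ext_class_eqI[OF T ses_neg[OF S]])
qed

text \<open>\<open>m_inv\<close> is a definite description of a two-sided inverse. Existence is
  \<open>baer_sum_neg\<close> for \<open>i\<close> and for \<open>neg i\<close>; uniqueness is
  \<open>baer_sum_trivial\<close>.\<close>

lemma m_inv_Ext1_group:
  assumes S: "ses Y Z X i p"
  shows "inv\<^bsub>Ext1_group X Y\<^esub> (ext_class i p) = ext_class (neg i) p"
proof -
  note S' = ses_neg[OF S]
  have sel: "carrier (Ext1_group X Y) = Ext1 X Y" "monoid.mult (Ext1_group X Y) = baer_sum X Y"
    "one (Ext1_group X Y) = ext_class (inl Y X) (prr Y X)"
    by (simp_all only: Ext1_group_def partial_object.simps monoid.simps)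
  have nn: "neg (neg i) = i" using ses_Hom(1)[OF S] by simp
  show ?thesis
    unfolding m_inv_def sel
  proof (rule the_equality)
    show "ext_class (neg i) p \<in> Ext1 X Y \<and>
        baer_sum X Y (ext_class i p) (ext_class (neg i) p) = ext_class (inl Y X) (prr Y X) \<and>
        baer_sum X Y (ext_class (neg i) p) (ext_class i p) = ext_class (inl Y X) (prr Y X)"
      using ext_class_in_Ext1[OF S'] baer_sum_neg[OF S] baer_sum_neg[OF S', unfolded nn] by blast
  next
    fix \<eta> assume \<eta>: "\<eta> \<in> Ext1 X Y \<and> baer_sum X Y (ext_class i p) \<eta> = ext_class (inl Y X) (prr Y X) \<and>
      baer_sum X Y \<eta> (ext_class i p) = ext_class (inl Y X) (prr Y X)"
    then obtain j q W where "ses Y W X j q" "\<eta> = ext_class j q" using Ext1E by metis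
    then show "\<eta> = ext_class (neg i) p" using baer_sum_trivial[OF S] \<eta> by blast
  qed
qed

end

section \<open>Exact structures and subfunctors\<close>

context cat
begin

definition seq_classes :: "('m \<times> 'm) set \<Rightarrow> 'o \<Rightarrow> 'o \<Rightarrow> ('m \<times> 'm) set set" where
  "seq_classes E X Y = {ext_class i p | i p. (i, p) \<in> E \<and> Dom A i = Y \<and> Cod A p = X}"

definition F_sequences :: "('o \<Rightarrow> 'o \<Rightarrow> ('m \<times> 'm) set set) \<Rightarrow> ('m \<times> 'm) set" where
  "F_sequences F = {(i, p). F_sequence F i p}"

text \<open>The condition \<open>F(C, -) = 0\<close> expressed through representatives, for a class
  \<open>E\<close> that is not yet known to be an exact structure.\<close>

definition split_obs :: "('m \<times> 'm) set \<Rightarrow> 'o set" where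
  "split_obs E = {C \<in> Ob A. \<forall>(i, p)\<in>E. Cod A p = C \<longrightarrow> (\<exists>t\<in>Hom C (Dom A p). p \<cdot> t = Ide A C)}"

definition cosplit_obs :: "('m \<times> 'm) set \<Rightarrow> 'o set" where
  "cosplit_obs E = {D \<in> Ob A. \<forall>(i, p)\<in>E. Dom A i = D \<longrightarrow> (\<exists>r\<in>Hom (Cod A i) D. r \<cdot> i = Ide A D)}"

text \<open>The pull-back is described by a morphism of sequences that is the identity on
  \<open>Y\<close>. By \<open>ses_pull_is_pullback\<close> this amounts to the universal property,
  and since it mentions only \<open>ses\<close> and equations, its dual is
  \<open>closed_under_push\<close> up to renaming.\<close>

definition closed_under_pull :: "('m \<times> 'm) set \<Rightarrow> bool" where
  "closed_under_pull E \<longleftrightarrow> (\<forall>Y Z X i p X' f P j q u.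
    (i, p) \<in> E \<and> ses Y Z X i p \<and> f \<in> Hom X' X \<and> ses Y P X' j q \<and> u \<in> Hom P Z \<and> u \<cdot> j = i \<and> p \<cdot> u = f \<cdot> q
      \<longrightarrow> (j, q) \<in> E)"

definition closed_under_push :: "('m \<times> 'm) set \<Rightarrow> bool" where
  "closed_under_push E \<longleftrightarrow> (\<forall>Y Z X i p Y' g P j q u.
    (i, p) \<in> E \<and> ses Y Z X i p \<and> g \<in> Hom Y Y' \<and> ses Y' P X j q \<and> u \<in> Hom Z P \<and> q \<cdot> u = p \<and> u \<cdot> i = j \<cdot> g
      \<longrightarrow> (j, q) \<in> E)"

end

context abelian_category
begin

lemma op_cat_closed [simp]:
  "cat.closed_under_pull (op_cat A) (E\<inverse>) = closed_under_push E"
  "cat.closed_under_push (op_cat A) (E\<inverse>) = closed_under_pull E"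
proof -
  have swap: "(\<forall>Y Z X i p X' f P j q u. R X Z Y p i X' f P q j u) \<longleftrightarrow> (\<forall>Y Z X i p X' f P j q u. R Y Z X i p X' f P j q u)"
    for R
    by blast
  show "cat.closed_under_pull (op_cat A) (E\<inverse>) = closed_under_push E"
    unfolding cat.closed_under_pull_def cat.closed_under_push_def op_cat_simps op_cat_ses converse_iff
    by (rule swap)
  show "cat.closed_under_push (op_cat A) (E\<inverse>) = closed_under_pull E"
    unfolding cat.closed_under_pull_def cat.closed_under_push_def op_cat_simps op_cat_ses converse_iff
    by (rule swap)
qed

lemma op_cat_split_obs [simp]: "cat.split_obs (op_cat A) (E\<inverse>) = cosplit_obs E"
  by (auto simp: cat.split_obs_def cosplit_obs_def)

text \<open>To lift \<open>f : C -> X\<close> along a member of \<open>E\<close>, pull the sequence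
  back along \<open>f\<close>: the result lies in \<open>E\<close> and ends at \<open>C\<close>,
  hence splits, and a section followed by \<open>u\<close> is the lift. Splitting of sequences
  ending at \<open>C\<close> thus already implies lifting along all of \<open>E\<close>.\<close>

lemma closed_eq_lift_seqs:
  assumes ses: "\<And>i p. (i, p) \<in> E \<Longrightarrow> short_exact i p"
    and pull: "closed_under_pull E" and push: "closed_under_push E"
    and enough: "\<And>M. M \<in> Ob A \<Longrightarrow> \<exists>(i, p)\<in>E. Cod A p = M \<and> Dom A p \<in> split_obs E"
  shows "lift_seqs (split_obs E) = E"
proof (rule equalityI; rule subsetI; clarify)
  fix i p assume ip: "(i, p) \<in> E"
  obtain Y Z X where S: "ses Y Z X i p" using ses[OF ip] by (rule short_exactE)
  note s = ses_Hom[OF S]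
  have "lifts (split_obs E) p" unfolding lifts_ses[OF S]
  proof (intro ballI)
    fix C f assume C: "C \<in> split_obs E" and f: "f \<in> Hom C X"
    obtain P u j q where T: "ses Y P C j q" and u: "u \<in> Hom P Z" "u \<cdot> j = i" "p \<cdot> u = f \<cdot> q"
      using ses_pull[OF S f] by metis
    note t = ses_Hom[OF T]
    have "(j, q) \<in> E" using pull ip S f T u unfolding closed_under_pull_def by blast
    then have "Cod A q = C \<longrightarrow> (\<exists>t\<in>Hom C (Dom A q). q \<cdot> t = Ide A C)"
      using C unfolding split_obs_def by blast
    then obtain v where v: "v \<in> Hom C P" "q \<cdot> v = Ide A C" using t by auto
    have "p \<cdot> (u \<cdot> v) = f" using Comp_rewrite[OF u(3), of v] u(1) v s t f by simp
    then show "\<exists>g\<in>Hom C Z. p \<cdot> g = f" using u(1) v(1) by (intro bexI[of _ "u \<cdot> v"]) simp_all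
  qed
  then show "(i, p) \<in> lift_seqs (split_obs E)" using ses[OF ip] unfolding lift_seqs_def by blast
next
  fix i p assume "(i, p) \<in> lift_seqs (split_obs E)"
  then have ip: "short_exact i p" and l: "lifts (split_obs E) p" unfolding lift_seqs_def by auto
  obtain Y Z X where S: "ses Y Z X i p" using ip by (rule short_exactE)
  note s = ses_Hom[OF S]
  obtain k e where ke: "(k, e) \<in> E" and X: "Cod A e = X" and Q: "Dom A e \<in> split_obs E"
    using enough[OF s(7)] by blast
  then obtain K P where T: "ses K P X k e" using ses[OF ke] short_exact_iff by metis
  note t = ses_Hom[OF T]
  have PC: "P \<in> split_obs E" using Q t by simp
  obtain h g where h: "h \<in> Hom P Z" "p \<cdot> h = e" and g: "g \<in> Hom K Y" "h \<cdot> k = i \<cdot> g"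
    and po: "is_pushout k g h i" using lifts_pushout[OF S T l PC] .
  show "(i, p) \<in> E" using push ke T g S h unfolding closed_under_push_def by blast
qed

lemma closed_eq_extend_seqs:
  assumes "\<And>i p. (i, p) \<in> E \<Longrightarrow> short_exact i p" "closed_under_pull E" "closed_under_push E"
    and "\<And>M. M \<in> Ob A \<Longrightarrow> \<exists>(i, p)\<in>E. Dom A i = M \<and> Cod A i \<in> cosplit_obs E"
  shows "extend_seqs (cosplit_obs E) = E"
proof -
  have "(extend_seqs (cosplit_obs E))\<inverse> = E\<inverse>"
    using abelian_category.closed_eq_lift_seqs[OF abelian_op_cat, of "E\<inverse>"] assms by fastforce
  then show ?thesis by simp
qed

text \<open>The two descriptions of \<open>E\<close> give every member both the lifting and the
  extension property, so the sequences granted by \<open>en\<close> and \<open>co\<close> themselves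
  witness \<open>covers\<close> and \<open>cocovers\<close>.\<close>

lemma closed_exact_structure:
  assumes ses: "\<And>i p. (i, p) \<in> E \<Longrightarrow> short_exact i p" and cl: "closed_under_pull E" "closed_under_push E"
    and en: "\<And>M. M \<in> Ob A \<Longrightarrow> \<exists>(i, p)\<in>E. Cod A p = M \<and> Dom A p \<in> split_obs E"
    and co: "\<And>M. M \<in> Ob A \<Longrightarrow> \<exists>(i, p)\<in>E. Dom A i = M \<and> Cod A i \<in> cosplit_obs E"
  shows "E \<in> exact_structures_enough"
proof -
  have l: "lift_seqs (split_obs E) = E" by (rule closed_eq_lift_seqs[OF ses cl en])
  have e: "extend_seqs (cosplit_obs E) = E" by (rule closed_eq_extend_seqs[OF ses cl co])
  have le: "short_exact i p \<and> lifts (split_obs E) p \<and> extends (cosplit_obs E) i" if "(i, p) \<in> E" for i p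
    using that l e unfolding lift_seqs_def extend_seqs_def by blast
  have "covers (split_obs E) (cosplit_obs E)" "cocovers (split_obs E) (cosplit_obs E)"
    unfolding covers_def cocovers_def using en co le by fast+
  moreover have "split_obs E \<subseteq> Ob A" "cosplit_obs E \<subseteq> Ob A"
    unfolding split_obs_def cosplit_obs_def by blast+
  ultimately show ?thesis using exact_structure_of_covers l by metis
qed

section \<open>From subfunctors to exact structures\<close>

lemma Ext1_group_one: "\<one>\<^bsub>Ext1_group X Y\<^esub> = ext_class (inl Y X) (prr Y X)"
  by (simp only: Ext1_group_def monoid.simps)

lemma subfunctor_map:
  assumes F: "Ext1_subfunctor F" and "f \<in> Hom X' X" "g \<in> Hom Y Y'" "\<xi> \<in> F X Y"
  shows "Ext1_map f g \<xi> \<in> F X' Y'"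
proof -
  have "f \<in> Mor A" "g \<in> Mor A" using assms(2,3) by simp_all
  then have "Ext1_map f g ` F (Cod A f) (Dom A g) \<subseteq> F (Dom A f) (Cod A g)"
    using F unfolding Ext1_subfunctor_def by blast
  then show ?thesis using assms(2-4) by auto
qed

lemma F_sequences_iff:
  "ses Y Z X i p \<Longrightarrow> (i, p) \<in> F_sequences F \<longleftrightarrow> ext_class i p \<in> F X Y"
  unfolding F_sequences_def F_sequence_def
  using ses_short_exact[of Y Z X i p] ses_Hom(3,6)[of Y Z X i p] by simp

lemma F_sequences_short_exact: "(i, p) \<in> F_sequences F \<Longrightarrow> short_exact i p"
  unfolding F_sequences_def F_sequence_def by blast

lemma F_sequences_closed:
  assumes F: "Ext1_subfunctor F"
  shows "closed_under_pull (F_sequences F)" "closed_under_push (F_sequences F)"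
proof -
  show "closed_under_pull (F_sequences F)"
    unfolding closed_under_pull_def
  proof (intro allI impI, elim conjE)
    fix Y Z X i p X' f P j q u
    assume ip: "(i, p) \<in> F_sequences F" and S: "ses Y Z X i p" and f: "f \<in> Hom X' X"
      and T: "ses Y P X' j q" "u \<in> Hom P Z" "u \<cdot> j = i" "p \<cdot> u = f \<cdot> q"
    have "Ide A Y \<in> Hom Y Y" using ses_Hom(8)[OF S] by simp
    then show "(j, q) \<in> F_sequences F"
      using subfunctor_map[OF F f, of "Ide A Y" Y Y] ip
      unfolding F_sequences_iff[OF S] F_sequences_iff[OF T(1)] Ext1_map_pull[OF S f T, symmetric] by blast
  qed
  show "closed_under_push (F_sequences F)"
    unfolding closed_under_push_def
  proof (intro allI impI, elim conjE)
    fix Y Z X i p Y' g P j q u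
    assume ip: "(i, p) \<in> F_sequences F" and S: "ses Y Z X i p" and g: "g \<in> Hom Y Y'"
      and T: "ses Y' P X j q" "u \<in> Hom Z P" "q \<cdot> u = p" "u \<cdot> i = j \<cdot> g"
    have "Ide A X \<in> Hom X X" using ses_Hom(7)[OF S] by simp
    then show "(j, q) \<in> F_sequences F"
      using subfunctor_map[OF F, of "Ide A X" X X g Y Y'] ip g
      unfolding F_sequences_iff[OF S] F_sequences_iff[OF T(1)] Ext1_map_push[OF S g T, symmetric] by blast
  qed
qed

lemma F_projective_split:
  assumes C: "F_projective F C"
  shows "C \<in> split_obs (F_sequences F)"
proof -
  have "\<exists>t\<in>Hom C (Dom A p). p \<cdot> t = Ide A C" if ip: "(i, p) \<in> F_sequences F" and c: "Cod A p = C" for i p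
  proof -
    obtain Y Z where S: "ses Y Z C i p" using F_sequences_short_exact[OF ip] short_exact_iff c by metis
    then have "ext_class i p = ext_class (inl Y C) (prr Y C)"
      using C ip ses_Hom(8)[OF S] unfolding F_projective_def Ext1_group_one F_sequences_iff[OF S] by blast
    then show ?thesis using ext_class_trivial_iff[OF S] ses_Hom(5)[OF S] by simp
  qed
  then show ?thesis using C unfolding split_obs_def F_projective_def by blast
qed

lemma F_injective_cosplit:
  assumes D: "F_injective F D"
  shows "D \<in> cosplit_obs (F_sequences F)"
proof -
  have "\<exists>r\<in>Hom (Cod A i) D. r \<cdot> i = Ide A D" if ip: "(i, p) \<in> F_sequences F" and d: "Dom A i = D" for i p
  proof -
    obtain Z X where S: "ses D Z X i p" using F_sequences_short_exact[OF ip] short_exact_iff d by metis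
    then have "ext_class i p = ext_class (inl D X) (prr D X)"
      using D ip ses_Hom(7)[OF S] unfolding F_injective_def Ext1_group_one F_sequences_iff[OF S] by blast
    then show ?thesis using ext_class_trivial_iff_retract[OF S] ses_Hom(4)[OF S] by simp
  qed
  then show ?thesis using D unfolding cosplit_obs_def F_injective_def by blast
qed

lemma F_sequences_exact_structure:
  assumes "F \<in> Ext1_subfunctors_enough"
  shows "F_sequences F \<in> exact_structures_enough"
proof -
  have F: "Ext1_subfunctor F" and en: "enough_F_projectives F" and co: "enough_F_injectives F"
    using assms unfolding Ext1_subfunctors_enough_def by auto
  show ?thesis
  proof (rule closed_exact_structure[OF F_sequences_short_exact F_sequences_closed[OF F]])
    fix M assume M: "M \<in> Ob A"
    show "\<exists>(i, p)\<in>F_sequences F. Cod A p = M \<and> Dom A p \<in> split_obs (F_sequences F)"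
      using en M F_projective_split unfolding enough_F_projectives_def F_sequences_def by fast
    show "\<exists>(i, p)\<in>F_sequences F. Dom A i = M \<and> Cod A i \<in> cosplit_obs (F_sequences F)"
      using co M F_injective_cosplit unfolding enough_F_injectives_def F_sequences_def by fast
  qed
qed

section \<open>From classes of sequences back to subfunctors\<close>

lemma seq_classes_F_sequences:
  assumes "Ext1_subfunctor F"
  shows "seq_classes (F_sequences F) = F"
proof (intro ext equalityI subsetI)
  fix X Y \<xi> assume "\<xi> \<in> seq_classes (F_sequences F) X Y"
  then show "\<xi> \<in> F X Y" unfolding seq_classes_def F_sequences_def F_sequence_def by blast
next
  fix X Y \<xi> assume x: "\<xi> \<in> F X Y"
  then have "\<xi> \<in> Ext1 X Y" using assms unfolding Ext1_subfunctor_def by blast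
  then obtain i p Z where S: "ses Y Z X i p" and \<xi>: "\<xi> = ext_class i p" by (rule Ext1E)
  then have "(i, p) \<in> F_sequences F" using x unfolding F_sequences_iff[OF S] by blast
  then show "\<xi> \<in> seq_classes (F_sequences F) X Y"
    unfolding seq_classes_def using \<xi> ses_Hom(3,6)[OF S] by blast
qed

text \<open>The epi of a push-out, or of an equivalent sequence, is a second factor of the original
  epi. Stability of the lifting property under both operations is an instance of this.\<close>

lemma lifts_of_Comp:
  assumes "s \<in> Hom V X" "t \<in> Hom P V" "lifts C (s \<cdot> t)"
  shows "lifts C s"
  unfolding lifts_iff[OF assms(1)]
proof (intro ballI)
  fix c f assume c: "c \<in> C" and f: "f \<in> Hom c X"
  obtain g where "g \<in> Hom c P" "(s \<cdot> t) \<cdot> g = f"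
    by (rule liftsE[OF assms(3) _ c f, of P]) (use assms in simp_all, blast?)
  then show "\<exists>g\<in>Hom c V. s \<cdot> g = f" using assms by (intro bexI[of _ "t \<cdot> g"]) simp_all
qed

lemma lifts_pull:
  assumes S: "ses Y Z X i p" and f: "f \<in> Hom X' X"
    and T: "ses Y P X' j q" "u \<in> Hom P Z" "u \<cdot> j = i" "p \<cdot> u = f \<cdot> q"
    and l: "lifts C p"
  shows "lifts C q"
  unfolding lifts_ses[OF T(1)]
proof (intro ballI)
  note s = ses_Hom[OF S] ses_Hom[OF T(1)]
  have p: "p \<in> Hom Z X" and q: "q \<in> Hom P X'" using s by simp_all
  fix c h assume c: "c \<in> C" and h: "h \<in> Hom c X'"
  have fh: "f \<cdot> h \<in> Hom c X" using f h by simp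
  obtain g where g: "g \<in> Hom c Z" "p \<cdot> g = f \<cdot> h" using liftsE[OF l p c fh] .
  obtain w where "w \<in> Hom c P" "q \<cdot> w = h"
    using pullback_lift[OF ses_pull_is_pullback[OF S f T] p f q g(1) h g(2)] by metis
  then show "\<exists>g\<in>Hom c P. q \<cdot> g = h" by blast
qed

lemma lifts_dsum:
  assumes p: "p \<in> Hom Z X" and q: "q \<in> Hom W Y" and l: "lifts C p" "lifts C q"
  shows "lifts C (dsum p q)"
  unfolding lifts_iff[OF dsum_simps(1)[OF p q]]
proof (intro ballI)
  have o: "X \<in> Ob A" "Y \<in> Ob A" "Z \<in> Ob A" "W \<in> Ob A" using p q by simp_all
  note B = is_biproduct_biprod[OF o(1,2)]
  note b = biproduct_simps(1-24)[OF B] biproduct_simps(1-24)[OF is_biproduct_biprod[OF o(3,4)]]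
  note d = dsum_simps[OF p q]
  fix c f assume c: "c \<in> C" and f: "f \<in> Hom c (sum_ob X Y)"
  have pf: "prl X Y \<cdot> f \<in> Hom c X" "prr X Y \<cdot> f \<in> Hom c Y" using f b by simp_all
  obtain g where g: "g \<in> Hom c Z" "p \<cdot> g = prl X Y \<cdot> f" using liftsE[OF l(1) p c pf(1)] .
  obtain h where h: "h \<in> Hom c W" "q \<cdot> h = prr X Y \<cdot> f" using liftsE[OF l(2) q c pf(2)] .
  let ?w = "(inl Z W \<cdot> g) \<boxplus> (inr Z W \<cdot> h)"
  have w: "?w \<in> Hom c (sum_ob Z W)" "prl Z W \<cdot> ?w = g" "prr Z W \<cdot> ?w = h" using g(1) h(1) b by simp_all
  have "dsum p q \<cdot> ?w = f"
  proof (rule biproduct_eqI_to[OF B, where W=c])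
    show "prl X Y \<cdot> (dsum p q \<cdot> ?w) = prl X Y \<cdot> f"
      using Comp_rewrite[OF d(2), of ?w] w d(1) p g(2) b by (simp del: Comp_distrib)
    show "prr X Y \<cdot> (dsum p q \<cdot> ?w) = prr X Y \<cdot> f"
      using Comp_rewrite[OF d(3), of ?w] w d(1) q h(2) b by (simp del: Comp_distrib)
  qed (use w d(1) f in \<open>simp_all del: Comp_distrib\<close>)
  then show "\<exists>g\<in>Hom c (sum_ob Z W). dsum p q \<cdot> g = f" using w(1) by blast
qed

text \<open>Lifting depends only on the extension class: if some equivalent \<open>q\<close> lifts,
  then \<open>q = p \<cdot> u\<close> shows that \<open>p\<close> lifts.\<close>

lemma seq_classes_lift_seqs_iff:
  assumes S: "ses Y Z X i p"
  shows "ext_class i p \<in> seq_classes (lift_seqs C) X Y \<longleftrightarrow> lifts C p"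
proof
  assume "lifts C p"
  then show "ext_class i p \<in> seq_classes (lift_seqs C) X Y"
    unfolding seq_classes_def lift_seqs_def using ses_short_exact[OF S] ses_Hom(3,6)[OF S] by blast
next
  assume "ext_class i p \<in> seq_classes (lift_seqs C) X Y"
  then obtain j q where e: "ext_class i p = ext_class j q" and jq: "short_exact j q" "lifts C q"
    unfolding seq_classes_def lift_seqs_def by blast
  obtain Y' W X' where T: "ses Y' W X' j q" using short_exactE[OF jq(1)] .
  obtain u where "X' = X" "u \<in> Hom W Z" "p \<cdot> u = q" using ext_class_eqE[OF T S] e by metis
  then show "lifts C p" using lifts_of_Comp[of p Z X u W C] jq(2) ses_Hom[OF S] by simp
qed

lemma seq_classes_subset:
  assumes "\<And>i p. (i, p) \<in> E \<Longrightarrow> short_exact i p"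
  shows "seq_classes E X Y \<subseteq> Ext1 X Y"
proof
  fix \<xi> assume "\<xi> \<in> seq_classes E X Y"
  then obtain i p where "(i, p) \<in> E" and ip: "\<xi> = ext_class i p" "Dom A i = Y" "Cod A p = X"
    unfolding seq_classes_def by blast
  then have "ses Y (Cod A i) X i p" using assms short_exact_iff by blast
  then show "\<xi> \<in> Ext1 X Y" unfolding ip by (rule ext_class_in_Ext1)
qed

lemma seq_classesE:
  assumes "\<xi> \<in> seq_classes (lift_seqs C) X Y"
  obtains i p Z where "ses Y Z X i p" "\<xi> = ext_class i p" "lifts C p"
proof -
  have "\<xi> \<in> Ext1 X Y"
    using assms seq_classes_subset[of "lift_seqs C"] unfolding lift_seqs_def by blast
  then obtain i p Z where S: "ses Y Z X i p" "\<xi> = ext_class i p" by (rule Ext1E)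
  then show ?thesis using that assms seq_classes_lift_seqs_iff by blast
qed

lemma seq_classes_subgroup:
  assumes XY: "X \<in> Ob A" "Y \<in> Ob A"
  shows "subgroup (seq_classes (lift_seqs C) X Y) (Ext1_group X Y)"
proof
  let ?H = "seq_classes (lift_seqs C) X Y"
  have sel: "carrier (Ext1_group X Y) = Ext1 X Y" "monoid.mult (Ext1_group X Y) = baer_sum X Y"
    by (simp_all only: Ext1_group_def partial_object.simps monoid.simps)
  show "?H \<subseteq> carrier (Ext1_group X Y)"
    unfolding sel by (rule seq_classes_subset) (simp add: lift_seqs_def)
  show "\<xi> \<otimes>\<^bsub>Ext1_group X Y\<^esub> \<eta> \<in> ?H" if x: "\<xi> \<in> ?H" and y: "\<eta> \<in> ?H" for \<xi> \<eta>
  proof -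
    obtain i p Z where S: "ses Y Z X i p" and \<xi>: "\<xi> = ext_class i p" and p: "lifts C p"
      using x by (rule seq_classesE)
    obtain j q W where T: "ses Y W X j q" and \<eta>: "\<eta> = ext_class j q" and q: "lifts C q"
      using y by (rule seq_classesE)
    obtain P a b u V k s t where P: "ses (sum_ob Y Y) P X a b" "u \<in> Hom P (sum_ob Z W)" "u \<cdot> a = dsum i j"
        "dsum p q \<cdot> u = diagonal X \<cdot> b"
      and V: "ses Y V X k s" "t \<in> Hom P V" "s \<cdot> t = b"
      and e: "baer_sum X Y (ext_class i p) (ext_class j q) = ext_class k s"
      by (rule baer_sumE[OF S T])
    have H: "p \<in> Hom Z X" "q \<in> Hom W X" "s \<in> Hom V X" using ses_Hom[OF S] ses_Hom[OF T] ses_Hom[OF V(1)] by simp_all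
    \<comment> \<open>The property follows the construction of the Baer sum: direct sum, pull-back
      along the diagonal, and then push-out by means of \<open>b = s \<cdot> t\<close>.\<close>
    have "lifts C b"
      by (rule lifts_pull[OF dsum_ses[OF S T] diagonal_simps(1)[OF XY(1)] P lifts_dsum[OF H(1,2) p q]])
    then have "lifts C s" using lifts_of_Comp[OF H(3) V(2)] V(3) by simp
    then show ?thesis unfolding sel \<xi> \<eta> e seq_classes_lift_seqs_iff[OF V(1)] .
  qed
  show "\<one>\<^bsub>Ext1_group X Y\<^esub> \<in> ?H"
  proof -
    note B = is_biproduct_biprod[OF XY(2,1)]
    note b = biproduct_simps(1-24)[OF B]
    have r: "prr Y X \<in> Hom (sum_ob Y X) X" "inr Y X \<in> Hom X (sum_ob Y X)" using b by simp_all
    have "lifts C (prr Y X)"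
      by (rule lifts_of_Comp[OF r]) (use b lifts_Ide XY in simp)
    then show ?thesis unfolding Ext1_group_one seq_classes_lift_seqs_iff[OF biproduct_ses[OF B]] .
  qed
  show "inv\<^bsub>Ext1_group X Y\<^esub> \<xi> \<in> ?H" if x: "\<xi> \<in> ?H" for \<xi>
  proof -
    obtain i p Z where S: "ses Y Z X i p" and \<xi>: "\<xi> = ext_class i p" and p: "lifts C p"
      using x by (rule seq_classesE)
    show ?thesis unfolding \<xi> m_inv_Ext1_group[OF S] seq_classes_lift_seqs_iff[OF ses_neg[OF S]] by (rule p)
  qed
qed

lemma seq_classes_map:
  assumes "f \<in> Hom X' X" "g \<in> Hom Y Y'" "\<xi> \<in> seq_classes (lift_seqs C) X Y"
  shows "Ext1_map f g \<xi> \<in> seq_classes (lift_seqs C) X' Y'"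
proof -
  obtain i p Z where S: "ses Y Z X i p" and \<xi>: "\<xi> = ext_class i p" and p: "lifts C p"
    using assms(3) by (rule seq_classesE)
  obtain P u j q where P: "ses Y P X' j q" "u \<in> Hom P Z" "u \<cdot> j = i" "p \<cdot> u = f \<cdot> q"
    using ses_pull[OF S assms(1)] by metis
  obtain V t k s where V: "ses Y' V X' k s" "t \<in> Hom P V" "s \<cdot> t = q" "t \<cdot> j = k \<cdot> g"
    using ses_push[OF P(1) assms(2)] by metis
  have e: "Ext1_map f g \<xi> = ext_class k s"
    unfolding Ext1_map_def \<xi> ext_pull_class[OF S assms(1) P] by (rule ext_push_class[OF P(1) assms(2) V])
  have "lifts C q" by (rule lifts_pull[OF S assms(1) P p])
  then have "lifts C s" using lifts_of_Comp[of s V X' t P C] V ses_Hom[OF V(1)] by simp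
  then show ?thesis unfolding e seq_classes_lift_seqs_iff[OF V(1)] .
qed

lemma seq_classes_subfunctor: "Ext1_subfunctor (seq_classes (lift_seqs C))"
  unfolding Ext1_subfunctor_def
proof (intro conjI allI ballI)
  show "seq_classes (lift_seqs C) X Y \<subseteq> Ext1 X Y" for X Y
    by (rule seq_classes_subset) (simp add: lift_seqs_def)
  show "subgroup (seq_classes (lift_seqs C) X Y) (Ext1_group X Y)" if "X \<in> Ob A" "Y \<in> Ob A" for X Y
    using that by (rule seq_classes_subgroup)
  show "Ext1_map f g ` seq_classes (lift_seqs C) (Cod A f) (Dom A g) \<subseteq> seq_classes (lift_seqs C) (Dom A f) (Cod A g)"
    if "f \<in> Mor A" "g \<in> Mor A" for f g
    using seq_classes_map[of f "Dom A f" "Cod A f" g "Dom A g" "Cod A g"] that by auto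
qed

lemma F_sequences_seq_classes: "F_sequences (seq_classes (lift_seqs C)) = lift_seqs C"
proof (intro Set.set_eqI; clarify)
  fix i p
  show "(i, p) \<in> F_sequences (seq_classes (lift_seqs C)) \<longleftrightarrow> (i, p) \<in> lift_seqs C"
  proof (cases "short_exact i p")
    case True
    then obtain Y Z X where S: "ses Y Z X i p" by (rule short_exactE)
    show ?thesis
      unfolding F_sequences_iff[OF S] seq_classes_lift_seqs_iff[OF S]
      unfolding lift_seqs_def using True by simp
  next
    case False
    then show ?thesis using F_sequences_short_exact unfolding lift_seqs_def by blast
  qed
qed

lemma seq_classes_enough:
  assumes "E \<in> exact_structures_enough"
  shows "F_sequences (seq_classes E) = E" "seq_classes E \<in> Ext1_subfunctors_enough"
proof -
  have E: "exact_structure E" and en: "enough_E_projectives E" and co: "enough_E_injectives E"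
    using assms unfolding exact_structures_enough_def by auto
  define C where "C = Collect (E_projective E)"
  have lE: "lift_seqs C = E" unfolding C_def by (rule exact_structure_eq_lift_seqs[OF E en])
  have sub: "Ext1_subfunctor (seq_classes E)" using seq_classes_subfunctor[of C] unfolding lE .
  show FE: "F_sequences (seq_classes E) = E" using F_sequences_seq_classes[of C] unfolding lE .
  have one: "\<one>\<^bsub>Ext1_group X Y\<^esub> \<in> seq_classes E X Y" if "X \<in> Ob A" "Y \<in> Ob A" for X Y
    using sub that unfolding Ext1_subfunctor_def by (auto intro: subgroup.one_closed)
  have proj: "F_projective (seq_classes E) P" if P: "E_projective E P" for P
    unfolding F_projective_def
  proof (intro conjI ballI)
    show PO: "P \<in> Ob A" using P unfolding E_projective_def by blast
    fix Y assume Y: "Y \<in> Ob A"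
    have "\<xi> = \<one>\<^bsub>Ext1_group P Y\<^esub>" if x: "\<xi> \<in> seq_classes E P Y" for \<xi>
    proof -
      obtain i p Z where S: "ses Y Z P i p" and \<xi>: "\<xi> = ext_class i p" and l: "lifts C p"
        using x[folded lE] by (rule seq_classesE)
      have "P \<in> C" using P C_def by blast
      then have "\<exists>t\<in>Hom P Z. p \<cdot> t = Ide A P"
        using l PO unfolding lifts_ses[OF S] by simp
      then show ?thesis unfolding \<xi> Ext1_group_one ext_class_trivial_iff[OF S] .
    qed
    then show "seq_classes E P Y = {\<one>\<^bsub>Ext1_group P Y\<^esub>}" using one[OF PO Y] by blast
  qed
  have inj: "F_injective (seq_classes E) I" if I: "E_injective E I" for I
    unfolding F_injective_def
  proof (intro conjI ballI)
    show IO: "I \<in> Ob A" using I unfolding E_injective_def by blast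
    fix X assume X: "X \<in> Ob A"
    have "\<xi> = \<one>\<^bsub>Ext1_group X I\<^esub>" if x: "\<xi> \<in> seq_classes E X I" for \<xi>
    proof -
      obtain i p Z where S: "ses I Z X i p" and \<xi>: "\<xi> = ext_class i p" and l: "lifts C p"
        using x[folded lE] by (rule seq_classesE)
      \<comment> \<open>The set \<open>C\<close> records lifting only. Returning to membership in
        \<open>E\<close> makes \<open>i\<close> an admissible monic, along which the identity of the
        injective \<open>I\<close> extends to a retraction.\<close>
      have "(i, p) \<in> E" using l ses_short_exact[OF S] unfolding lE[symmetric] lift_seqs_def by blast
      then have "admissible_monic E i" unfolding admissible_monic_def by blast
      then have "extends (Collect (E_injective E)) i" by (rule extends_Collect)
      then have "\<exists>r\<in>Hom Z I. r \<cdot> i = Ide A I" using I IO unfolding extends_ses[OF S] by simp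
      then show ?thesis unfolding \<xi> Ext1_group_one ext_class_trivial_iff_retract[OF S] .
    qed
    then show "seq_classes E X I = {\<one>\<^bsub>Ext1_group X I\<^esub>}" using one[OF X IO] by blast
  qed
  have seqs: "F_sequence (seq_classes E) i p \<longleftrightarrow> (i, p) \<in> E" for i p
    using FE unfolding F_sequences_def by blast
  have "enough_F_projectives (seq_classes E)"
    using en proj unfolding enough_F_projectives_def enough_E_projectives_def admissible_epic_def seqs by metis
  moreover have "enough_F_injectives (seq_classes E)"
    using co inj unfolding enough_F_injectives_def enough_E_injectives_def admissible_monic_def seqs by metis
  ultimately show "seq_classes E \<in> Ext1_subfunctors_enough"
    using sub unfolding Ext1_subfunctors_enough_def by blast
qed

lemma bij_betw_exact_subfunctors:
  "bij_betw seq_classes exact_structures_enough Ext1_subfunctors_enough"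
  "bij_betw F_sequences Ext1_subfunctors_enough exact_structures_enough"
proof -
  have e: "\<forall>E\<in>exact_structures_enough. F_sequences (seq_classes E) = E"
    using seq_classes_enough by blast
  have f: "\<forall>F\<in>Ext1_subfunctors_enough. seq_classes (F_sequences F) = F"
    unfolding Ext1_subfunctors_enough_def using seq_classes_F_sequences by blast
  have "seq_classes ` exact_structures_enough \<subseteq> Ext1_subfunctors_enough"
    "F_sequences ` Ext1_subfunctors_enough \<subseteq> exact_structures_enough"
    using seq_classes_enough F_sequences_exact_structure by blast+
  then show "bij_betw seq_classes exact_structures_enough Ext1_subfunctors_enough"
    "bij_betw F_sequences Ext1_subfunctors_enough exact_structures_enough"
    using e f by (auto intro: bij_betw_byWitness)
qed

end

theorem theorem2p9:
  fixes A :: "('o, 'm) category"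
  assumes "abelian_category A"
  shows "(\<exists>f. bij_betw f (cat.balanced_pairs A) (cat.Ext1_subfunctors_enough A)) \<and>
         (\<exists>g. bij_betw g (cat.Ext1_subfunctors_enough A) (cat.exact_structures_enough A)) \<and>
         (\<exists>h. bij_betw h (cat.balanced_pairs A) (cat.exact_structures_enough A))"
proof -
  interpret abelian_category A by (rule assms)
  show ?thesis
    using bij_betw_trans[OF bij_betw_balanced_exact bij_betw_exact_subfunctors(1)]
      bij_betw_exact_subfunctors(2) bij_betw_balanced_exact by blast
qed

end
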